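(* Suppose that the three samples $\{x_{ji}:i=1,\ldots,n_j\}$, $j=1,2,3$, follow the exponential tilt mixture (ETM) model with true parameter values $(\rho^*,\beta^* )$. Let $(\hat\rho,\hat\beta)$ be the maximum likelihood estimator in the ETM model, and let $\hat\beta^\ell$ be the estimator of $\beta$ obtained by maximizing $\kappa\{\rho^\ell,\beta,\tilde\alpha(\rho^\ell)\}$ over $\beta$, where $\rho^\ell=n_2/(n_1+n_2)$, or equivalently by logistic regression based on the labeled data (samples $j=1,2$) only. Then, under standard regularity conditions, the asymptotic variance matrix of $\hat\beta$ is no greater, in the usual order on positive-definite matrices, than that of $\hat\beta^\ell$.
   Context: Setting: $\{x_{ji}:i=1,\ldots,n_j\}\subset\mathbb{R}^p$ are i.i.d. from $P_j$, independently over $j=1,2,3$, where $dP_j=(1-\rho_j)dG_0+\rho_j\,dG_1$ with $\rho_1=0$, $\rho_2=1$, $\rho_3=\rho\in(0,1)$, and $dG_1/dG_0=\exp(\beta_0+\beta_1^{T}x)$; $G_0$ is an unspecified probability distribution and $\beta=(\beta_0,\beta_1^T)^T$. The true values are $(\rho^*,\beta^* )$. Samples $1$ and $2$ are the labeled data (labels $0$ and $1$), sample $3$ is unlabeled. Let $n=n_1+n_2$, $N=n_1+n_2+n_3$; asymptotics are as $N\to\infty$ with $n_j/N\to\eta_j\in(0,1)$. Define $$\kappa(\rho,\beta,\alpha)=\frac1N\sum_{j=1}^3\sum_{i=1}^{n_j}\log\left\{\frac{1-\rho_j+\rho_j\exp(\beta_0+\beta_1^{T}x_{ji})}{1-\alpha+\alpha\exp(\beta_0+\beta_1^{T}x_{ji})}\right\}-\log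 N,\qquad \tilde\alpha(\rho)=(n_2+n_3\rho)/N.$$ The MLE in the ETM model is $(\hat\rho,\hat\beta)=\mathrm{argmax}_{(\rho,\beta)}\min_{\alpha\in(0,1)}\kappa(\rho,\beta,\alpha)$. With $\rho^\ell=n_2/n$ one has $\tilde\alpha(\rho^\ell)=n_2/n$, and maximizing $\kappa\{\rho^\ell,\beta,\tilde\alpha(\rho^\ell)\}$ over $\beta$ is the same as logistic regression maximum likelihood on the labeled data after the intercept shift $\beta_0^c=\beta_0+\log(n_2/n_1)$. The asymptotic variance matrices of the two estimators are compared on the same scale: e.g. they are the covariance matrices of the limiting normal distributions of $\sqrt N(\hat\beta-\beta^* )$ and $\sqrt N(\hat\beta^\ell-\beta^* )$. "Standard regularity conditions" are the usual ones ensuring consistency and asymptotic normality of these M-estimators. *)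

theory Defs
  imports "HOL-Probability.Probability"
begin

section \<open>The exponential tilt mixture model\<close>

text \<open>
  The parameter \<open>\<beta> = (\<beta>\<^sub>0, \<beta>\<^sub>1)\<close> is a vector indexed by \<^typ>\<open>'p option\<close>:
  \<^term>\<open>None\<close> is the intercept, and \<open>Some i\<close> is the slope of the \<open>i\<close>-th covariate.
\<close>

definition intercept :: "real ^ 'p::finite option \<Rightarrow> real" where
  "intercept \<beta> = \<beta> $ None"

definition slope :: "real ^ 'p::finite option \<Rightarrow> real ^ 'p" where
  "slope \<beta> = (\<chi> i. \<beta> $ Some i)"

definition linpred :: "real ^ 'p::finite option \<Rightarrow> real ^ 'p \<Rightarrow> real" where
  "linpred \<beta> x = intercept \<beta> + slope \<beta> \<bullet> x"

definition tilt :: "(real ^ 'p::finite) measure \<Rightarrow> real ^ 'p option \<Rightarrow> (real ^ 'p) measure" where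
  "tilt G \<beta> = density G (\<lambda>x. ennreal (exp (linpred \<beta> x)))"

text \<open>\<open>\<rho>\<^sub>1 = 0\<close>, \<open>\<rho>\<^sub>2 = 1\<close>, \<open>\<rho>\<^sub>3 = \<rho>\<close>.\<close>

definition mixprop :: "real \<Rightarrow> nat \<Rightarrow> real" where
  "mixprop \<rho> j = (if j = 1 then 0 else if j = 2 then 1 else \<rho>)"

text \<open>
  The observations of sample \<open>j\<close> are the first \<open>n\<^sub>j\<close> terms of an infinite i.i.d. sequence
  \<open>x j 0, x j 1, \<dots>\<close>.  That \<open>tilt G0 \<beta>\<close> has total mass one is the constraint
  \<open>\<integral> exp (\<beta>\<^sub>0 + \<beta>\<^sub>1\<^sup>T x) dG\<^sub>0 = 1\<close>.
\<close>

locale ETM =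
  prob_space M + G0: prob_space G0 + G1: prob_space "tilt G0 \<beta>"
  for M :: "'w measure" and x :: "nat \<Rightarrow> nat \<Rightarrow> 'w \<Rightarrow> real ^ 'p::finite"
    and G0 :: "(real ^ 'p) measure" and \<rho> :: real and \<beta> :: "real ^ 'p option" +
  assumes sets_G0: "sets G0 = sets borel"
    and mixing_proportion: "0 < \<rho>" "\<rho> < 1"
    and independent: "indep_vars (\<lambda>_. borel) (\<lambda>(j, i). x j i) ({1, 2, 3} \<times> UNIV)"
    and mixture: "j \<in> {1, 2, 3} \<Longrightarrow> A \<in> sets borel \<Longrightarrow>
      measure (distr M borel (x j i)) A =
        (1 - mixprop \<rho> j) * measure G0 A + mixprop \<rho> j * measure (tilt G0 \<beta>) A"


section \<open>The two estimators\<close>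

text \<open>
  In this section \<open>n\<close> gives the three sample sizes and \<open>d j i\<close> is the observed value of
  observation \<open>i < n j\<close> in sample \<open>j\<close>.
\<close>

definition total_size :: "(nat \<Rightarrow> nat) \<Rightarrow> nat" where
  "total_size n = (\<Sum>j = 1..3. n j)"

definition kappa :: "(nat \<Rightarrow> nat) \<Rightarrow> (nat \<Rightarrow> nat \<Rightarrow> real ^ 'p::finite) \<Rightarrow>
    real \<Rightarrow> real ^ 'p option \<Rightarrow> real \<Rightarrow> real" where
  "kappa n d \<rho> \<beta> \<alpha> =
     (1 / real (total_size n)) * (\<Sum>j = 1..3. \<Sum>i < n j.
        ln ((1 - mixprop \<rho> j + mixprop \<rho> j * exp (linpred \<beta> (d j i))) /
            (1 - \<alpha> + \<alpha> * exp (linpred \<beta> (d j i)))))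
     - ln (real (total_size n))"

definition alpha_tilde :: "(nat \<Rightarrow> nat) \<Rightarrow> real \<Rightarrow> real" where
  "alpha_tilde n \<rho> = (real (n 2) + real (n 3) * \<rho>) / real (total_size n)"

definition rho_lab :: "(nat \<Rightarrow> nat) \<Rightarrow> real" where
  "rho_lab n = real (n 2) / real (n 1 + n 2)"

lemma kappa_bdd_below:
  assumes "\<rho> \<in> {0<..<1}"
  shows "bdd_below ((\<lambda>\<alpha>. kappa n d \<rho> \<beta> \<alpha>) ` {0<..<1})"
proof -
  define num where
    "num = (\<lambda>j i. 1 - mixprop \<rho> j + mixprop \<rho> j * exp (linpred \<beta> (d j i)))"
  define B where "B = (1 / real (total_size n)) * (\<Sum>j = 1..3. \<Sum>i < n j.
      ln (num j i / (1 + exp (linpred \<beta> (d j i))))) - ln (real (total_size n))"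
  have num_pos: "num j i > 0" for j i
    using assms by (auto simp: num_def mixprop_def add_pos_pos)
  have "B \<le> kappa n d \<rho> \<beta> \<alpha>" if \<alpha>: "\<alpha> \<in> {0<..<1}" for \<alpha>
  proof -
    have "ln (num j i / (1 + exp (linpred \<beta> (d j i)))) \<le>
        ln (num j i / (1 - \<alpha> + \<alpha> * exp (linpred \<beta> (d j i))))" for j i
    proof -
      have "0 < 1 - \<alpha> + \<alpha> * exp (linpred \<beta> (d j i))"
        using \<alpha> by (simp add: add_pos_pos)
      moreover have "\<alpha> * exp (linpred \<beta> (d j i)) \<le> 1 * exp (linpred \<beta> (d j i))"
        using \<alpha> by (intro mult_right_mono) auto
      then have "1 - \<alpha> + \<alpha> * exp (linpred \<beta> (d j i)) \<le> 1 + exp (linpred \<beta> (d j i))"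
        using \<alpha> unfolding greaterThanLessThan_iff by linarith
      ultimately show ?thesis
        using num_pos[of j i] by (intro ln_mono divide_left_mono divide_pos_pos) auto
    qed
    then show ?thesis
      unfolding B_def kappa_def num_def
      by (intro diff_right_mono mult_left_mono sum_mono) auto
  qed
  then show ?thesis
    by (intro bdd_belowI2[where m = B]) auto
qed

text \<open>The minimum over \<open>\<alpha>\<close> is read as an infimum, which is finite by \<open>kappa_bdd_below\<close>.\<close>

definition is_MLE :: "(nat \<Rightarrow> nat) \<Rightarrow> (nat \<Rightarrow> nat \<Rightarrow> real ^ 'p::finite) \<Rightarrow>
    real \<times> (real ^ 'p option) \<Rightarrow> bool" where
  "is_MLE n d = is_arg_max (\<lambda>(\<rho>, \<beta>). INF \<alpha>\<in>{0<..<1}. kappa n d \<rho> \<beta> \<alpha>)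
     (\<lambda>(\<rho>, \<beta>). \<rho> \<in> {0<..<1})"

definition is_labeled_estimator :: "(nat \<Rightarrow> nat) \<Rightarrow> (nat \<Rightarrow> nat \<Rightarrow> real ^ 'p::finite) \<Rightarrow>
    real ^ 'p option \<Rightarrow> bool" where
  "is_labeled_estimator n d =
     is_arg_max (\<lambda>\<beta>. kappa n d (rho_lab n) \<beta> (alpha_tilde n (rho_lab n))) (\<lambda>_. True)"

text \<open>
  The labeled-data estimator is logistic regression (label \<open>0\<close> for sample \<open>1\<close>, label \<open>1\<close> for
  sample \<open>2\<close>) after the intercept shift \<open>\<beta>\<^sub>0\<^sup>c = \<beta>\<^sub>0 + log (n\<^sub>2 / n\<^sub>1)\<close>.
\<close>

definition logistic_loglik :: "(nat \<Rightarrow> nat) \<Rightarrow> (nat \<Rightarrow> nat \<Rightarrow> real ^ 'p::finite) \<Rightarrow>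
    real ^ 'p option \<Rightarrow> real" where
  "logistic_loglik n d b =
     (\<Sum>i < n 1. ln (1 / (1 + exp (linpred b (d 1 i))))) +
     (\<Sum>i < n 2. ln (exp (linpred b (d 2 i)) / (1 + exp (linpred b (d 2 i)))))"

definition shift_intercept :: "real \<Rightarrow> real ^ 'p::finite option \<Rightarrow> real ^ 'p option" where
  "shift_intercept c \<beta> = \<beta> + axis None c"

lemma linpred_shift_intercept: "linpred (shift_intercept c \<beta>) x = linpred \<beta> x + c"
  by (simp add: linpred_def intercept_def slope_def shift_intercept_def axis_def)

lemma kappa_labeled_eq_logistic:
  assumes n: "n 1 > 0" "n 2 > 0"
  defines "c \<equiv> ln (real (n 2) / real (n 1))"
  shows "kappa n d (rho_lab n) \<beta> (alpha_tilde n (rho_lab n)) =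
    (1 / real (total_size n)) *
      (logistic_loglik n d (shift_intercept c \<beta>)
        - real (n 1) * ln (1 - rho_lab n) - real (n 2) * ln (rho_lab n))
    - ln (real (total_size n))"
proof -
  define a where "a = rho_lab n"
  have a: "0 < a" "a < 1"
    using n by (auto simp: a_def rho_lab_def)
  have tot: "real (total_size n) = n 1 + n 2 + n 3"
    by (simp add: total_size_def numeral_eq_Suc)
  have "a * (real (n 1) + real (n 2)) = n 2"
    using n by (simp add: a_def rho_lab_def)
  then have "real (n 2) + real (n 3) * a = a * (n 1 + n 2 + n 3)"
    by (simp add: algebra_simps)
  then have alpha: "alpha_tilde n a = a"
    using n by (simp add: alpha_tilde_def tot)
  have "1 - a = n 1 / (n 1 + n 2)"
    using n by (simp add: a_def rho_lab_def field_simps)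
  then have c: "exp c = a / (1 - a)"
    using n by (simp add: c_def a_def rho_lab_def)
  have shift: "exp (linpred (shift_intercept c \<beta>) y) = a / (1 - a) * exp (linpred \<beta> y)" for y
    by (simp add: linpred_shift_intercept exp_add c)
  have pos: "1 - a + a * exp (linpred \<beta> y) > 0" for y
    using a by (simp add: add_pos_pos)
  have one_plus: "1 + a / (1 - a) * exp (linpred \<beta> y) =
      (1 - a + a * exp (linpred \<beta> y)) / (1 - a)" for y
    using a by (simp add: add_divide_distrib)
  have 1: "ln (1 / (1 - a + a * exp (linpred \<beta> y))) =
      ln (1 / (1 + exp (linpred (shift_intercept c \<beta>) y))) - ln (1 - a)" for y
  proof -
    have "1 / (1 + exp (linpred (shift_intercept c \<beta>) y)) =
        (1 - a) * (1 / (1 - a + a * exp (linpred \<beta> y)))"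
      using a pos[of y] unfolding shift one_plus by simp
    then show ?thesis
      using a pos[of y] by (simp only: ln_mult_pos[of "1 - a"] divide_pos_pos zero_less_one
          diff_gt_0_iff_gt)
  qed
  have 2: "ln (exp (linpred \<beta> y) / (1 - a + a * exp (linpred \<beta> y))) =
      ln (exp (linpred (shift_intercept c \<beta>) y) /
        (1 + exp (linpred (shift_intercept c \<beta>) y))) - ln a" for y
  proof -
    have "exp (linpred (shift_intercept c \<beta>) y) / (1 + exp (linpred (shift_intercept c \<beta>) y)) =
        a * (exp (linpred \<beta> y) / (1 - a + a * exp (linpred \<beta> y)))"
      using a pos[of y] unfolding shift one_plus by simp
    then show ?thesis
      using a pos[of y] by (simp only: ln_mult_pos[of a] divide_pos_pos exp_gt_zero)
  qed
  have 3: "ln ((1 - a + a * exp (linpred \<beta> y)) / (1 - a + a * exp (linpred \<beta> y))) = 0" for y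
    using pos[of y] by simp
  have "{1..3::nat} = {1, 2, 3}" by auto
  then have "(\<Sum>j = 1..3. \<Sum>i < n j.
        ln ((1 - mixprop a j + mixprop a j * exp (linpred \<beta> (d j i))) /
            (1 - a + a * exp (linpred \<beta> (d j i))))) =
      (\<Sum>i < n 1. ln (1 / (1 - a + a * exp (linpred \<beta> (d 1 i))))) +
      (\<Sum>i < n 2. ln (exp (linpred \<beta> (d 2 i)) / (1 - a + a * exp (linpred \<beta> (d 2 i))))) +
      (\<Sum>i < n 3. ln ((1 - a + a * exp (linpred \<beta> (d 3 i))) /
        (1 - a + a * exp (linpred \<beta> (d 3 i)))))"
    by (simp add: mixprop_def)
  also have "\<dots> = logistic_loglik n d (shift_intercept c \<beta>)
      - real (n 1) * ln (1 - a) - real (n 2) * ln a"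
    unfolding 1 2 3 logistic_loglik_def by (simp add: sum_subtractf)
  finally show ?thesis
    unfolding a_def[symmetric] kappa_def alpha by (simp only:)
qed

lemma is_labeled_estimator_iff_logistic:
  fixes d :: "nat \<Rightarrow> nat \<Rightarrow> real ^ 'p::finite"
  assumes "n 1 > 0" "n 2 > 0"
  shows "is_labeled_estimator n d \<beta> \<longleftrightarrow>
    is_arg_max (logistic_loglik n d) (\<lambda>_. True)
      (shift_intercept (ln (real (n 2) / real (n 1))) \<beta>)"
proof -
  define c where "c = ln (real (n 2) / real (n 1))"
  have "real (total_size n) > 0"
    using assms by (simp add: total_size_def numeral_eq_Suc)
  then have "is_labeled_estimator n d \<beta> \<longleftrightarrow>
      (\<forall>b. \<not> logistic_loglik n d (shift_intercept c \<beta>) <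
        logistic_loglik n d (shift_intercept c b))"
    unfolding is_labeled_estimator_def is_arg_max_def
      kappa_labeled_eq_logistic[where n = n, OF assms] c_def[symmetric]
    by (simp add: divide_less_cancel)
  also have "\<dots> \<longleftrightarrow> (\<forall>b. \<not> logistic_loglik n d (shift_intercept c \<beta>) < logistic_loglik n d b)"
  proof -
    have "b = shift_intercept c (b - axis None c)" for b :: "real ^ 'p option"
      by (simp add: shift_intercept_def)
    then show ?thesis by metis
  qed
  finally show ?thesis
    by (simp add: is_arg_max_def c_def)
qed


section \<open>Asymptotic variance matrices\<close>

text \<open>
  An estimator defined by an optimization may fail to exist on a part of the sample space (for
  example, logistic regression on separated data), so it is only required to be an optimizer
  with probability tending to one.
\<close>

definition with_prob_tending_to_1 :: "'w measure \<Rightarrow> (nat \<Rightarrow> 'w \<Rightarrow> bool) \<Rightarrow> bool" where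
  "with_prob_tending_to_1 M E \<longleftrightarrow>
     (\<exists>A. (\<forall>k. A k \<in> sets M \<and> (\<forall>\<omega>\<in>A k. E k \<omega>)) \<and> (\<lambda>k. measure M (A k)) \<longlonglongrightarrow> 1)"

definition converges_in_distribution ::
    "'w measure \<Rightarrow> (nat \<Rightarrow> 'w \<Rightarrow> 'a::euclidean_space) \<Rightarrow> 'a measure \<Rightarrow> bool" where
  "converges_in_distribution M X \<mu> \<longleftrightarrow>
     (\<forall>f :: 'a \<Rightarrow> real. continuous_on UNIV f \<and> bounded (range f) \<longrightarrow>
        (\<lambda>k. \<integral>\<omega>. f (X k \<omega>) \<partial>M) \<longlonglongrightarrow> (\<integral>y. f y \<partial>\<mu>))"

text \<open>The normal distribution on the line with the given variance; variance zero is allowed.\<close>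

definition normal_law :: "real \<Rightarrow> real measure" where
  "normal_law v = (if v = 0 then return borel 0 else density lborel (normal_density 0 (sqrt v)))"

definition psd :: "real ^ 'm::finite ^ 'm \<Rightarrow> bool" where
  "psd A \<longleftrightarrow> transpose A = A \<and> (\<forall>c. 0 \<le> c \<bullet> (A *v c))"

definition loewner_le :: "real ^ 'm::finite ^ 'm \<Rightarrow> real ^ 'm ^ 'm \<Rightarrow> bool" where
  "loewner_le A B \<longleftrightarrow> psd (B - A)"

text \<open>
  \<open>\<mu>\<close> is the centred multivariate normal distribution with covariance matrix \<open>V\<close>: every linear
  functional \<open>c\<^sup>T y\<close> is normal with variance \<open>c\<^sup>T V c\<close>.
\<close>

definition mvnormal :: "real ^ 'm::finite ^ 'm \<Rightarrow> (real ^ 'm) measure \<Rightarrow> bool" where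
  "mvnormal V \<mu> \<longleftrightarrow> psd V \<and> prob_space \<mu> \<and> sets \<mu> = sets borel \<and>
     (\<forall>c. distr \<mu> borel (\<lambda>y. c \<bullet> y) = normal_law (c \<bullet> (V *v c)))"

definition asymptotic_variance :: "'w measure \<Rightarrow> (nat \<Rightarrow> nat) \<Rightarrow>
    (nat \<Rightarrow> 'w \<Rightarrow> real ^ 'm::finite) \<Rightarrow> real ^ 'm \<Rightarrow> real ^ 'm ^ 'm \<Rightarrow> bool" where
  "asymptotic_variance M N \<theta>_hat \<theta> V \<longleftrightarrow>
     (\<exists>\<mu>. mvnormal V \<mu> \<and>
        converges_in_distribution M (\<lambda>k \<omega>. sqrt (real (N k)) *\<^sub>R (\<theta>_hat k \<omega> - \<theta>)) \<mu>)"

end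

theory Submission
  imports Defs
begin

text \<open>
  Both estimators are shown to be asymptotically linear, and their limiting covariance matrices are
  then compared through their influence functions.

  With \<open>\<alpha> = \<Lambda>(\<zeta>)\<close> and \<open>\<rho> = \<Lambda>(\<gamma>)\<close> for the logistic function \<open>\<Lambda>\<close>, all first-order conditions become
  logistic score equations at \<open>\<beta>\<close> with shifted intercepts \<open>\<gamma>\<close> and \<open>\<zeta>\<close>.  For fixed \<open>\<beta>\<close> the criterion is
  concave in \<open>\<rho>\<close> and convex in \<open>\<alpha>\<close> separately, so consistency of these two one-dimensional solutions
  follows from monotonicity, given that the estimator of \<open>\<beta>\<close> is consistent.  Eliminating \<open>\<gamma>\<close> and
  \<open>\<zeta>\<close> from the linearized equations leaves \<open>S(c) = \<surd>N J c \<bullet> (estimator - \<beta>) + o\<^sub>p(1)\<close>, where \<open>S\<close> is the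
  efficient score, centred in each sample separately, with \<open>Var S(c) = c \<bullet> J c\<close>.  The score \<open>T\<close> of the
  labeled data satisfies the same kind of expansion with a positive definite \<open>L\<close> in place of \<open>J\<close>, and
  \<open>Cov(T(u), S(v)) = L u \<bullet> v\<close>.  Hence \<open>0 \<le> Var(T(u) - S(v)) = Var T(u) - 2 L u \<bullet> v + J v \<bullet> v\<close>; with
  \<open>L u = J v = c\<close> the right-hand side is \<open>c \<bullet> (V_lab - V) c\<close>.
\<close>

section \<open>Convergence and boundedness in probability\<close>

text \<open>The criterion is an infimum over \<open>\<alpha>\<close>, so stationarity in
  \<open>\<beta>\<close> is not a plain derivative condition, and the inner minimizer becomes a
  second nuisance root besides \<open>\<rho>\<close>. Root-N tightness of the two estimators of
  \<open>\<beta>\<close> is read off from the assumed limit laws; the nuisance roots inherit it from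
  their own equations. As the limits are centred normal by assumption, a variance is identified by
  the limit of a single expectation, that of the cosine, and the comparison of the two estimators
  takes place among moments under \<open>G0\<close>. The shares \<open>n j / N\<close> converge
  without a rate, so the labeled score and the equation for \<open>\<alpha>\<close>, evaluated at
  the limiting proportions, could drift by root N times the error of the shares. They are therefore
  evaluated at proportions computed from the actual sizes, which makes the means exactly zero but
  turns the sums into triangular arrays. The covariance with \<open>L\<close> arises because the
  efficient score in direction \<open>v\<close> differs between samples 1 and 2 by exactly
  \<open>v \<bullet> design y\<close>, while the labeled score cancels whatever the two values have
  in common.\<close>

text \<open>
  Convergence along this filter is convergence in probability; maps need not be measurable, which
  matters for the auxiliary minimizer in \<open>\<alpha>\<close>.
\<close>

definition wp1 :: "'w measure \<Rightarrow> (nat \<times> 'w) filter" where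
  "wp1 M = Abs_filter (\<lambda>P. with_prob_tending_to_1 M (\<lambda>k \<omega>. P (k, \<omega>)))"

text \<open>Tightness, characterized by \<open>o\<^sub>p(1) O\<^sub>p(1) = o\<^sub>p(1)\<close> so that the calculus of \<open>O\<^sub>p\<close> becomes algebra of limits.\<close>

definition bounded_in_prob :: "'w measure \<Rightarrow> (nat \<times> 'w \<Rightarrow> real) \<Rightarrow> bool" where
  "bounded_in_prob M X \<longleftrightarrow> (\<forall>Y. (Y \<longlongrightarrow> (0::real)) (wp1 M) \<longrightarrow> ((\<lambda>p. Y p * X p) \<longlongrightarrow> 0) (wp1 M))"

context prob_space
begin

lemma prob_Int_tendsto_1:
  assumes "\<And>k. A k \<in> events" "\<And>k. B k \<in> events"
    "(\<lambda>k. prob (A k)) \<longlonglongrightarrow> 1" "(\<lambda>k. prob (B k)) \<longlonglongrightarrow> 1"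
  shows "(\<lambda>k. prob (A k \<inter> B k)) \<longlonglongrightarrow> 1"
proof (rule tendsto_sandwich)
  have "prob (A k) + prob (B k) - 1 \<le> prob (A k \<inter> B k)" for k
    using finite_measure_Union'[of "A k" "B k"] finite_measure_Diff'[of "B k" "A k"]
      prob_le_1[of "A k \<union> B k"] assms(1,2)[of k]
    by (simp add: Int_commute)
  then show "\<forall>\<^sub>F k in sequentially. prob (A k) + prob (B k) - 1 \<le> prob (A k \<inter> B k)"
    by simp
  show "(\<lambda>k. prob (A k) + prob (B k) - 1) \<longlonglongrightarrow> 1"
    using tendsto_diff[OF tendsto_add[OF assms(3,4)] tendsto_const[of 1]] by simp
qed (auto intro: prob_le_1)

text \<open>\<open>Abs_filter\<close> has its intended meaning only for a predicate satisfying
  \<open>is_filter\<close>. Closure under conjunction is the point with content: the measurable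
  witnesses are intersected, and the probabilities still tend to one.\<close>

lemma eventually_wp1:
  "eventually P (wp1 M) \<longleftrightarrow> with_prob_tending_to_1 M (\<lambda>k \<omega>. P (k, \<omega>))"
  unfolding wp1_def
proof (rule eventually_Abs_filter, standard)
  show "with_prob_tending_to_1 M (\<lambda>k \<omega>. True)"
    unfolding with_prob_tending_to_1_def by (rule exI[of _ "\<lambda>_. space M"]) (simp add: prob_space)
next
  fix P Q :: "nat \<times> 'a \<Rightarrow> bool"
  assume "with_prob_tending_to_1 M (\<lambda>k \<omega>. P (k, \<omega>))" "with_prob_tending_to_1 M (\<lambda>k \<omega>. Q (k, \<omega>))"
  then obtain A B where "\<And>k. A k \<in> events" "\<And>k. B k \<in> events" 
    "(\<lambda>k. prob (A k)) \<longlonglongrightarrow> 1" "(\<lambda>k. prob (B k)) \<longlonglongrightarrow> 1"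
    "\<And>k \<omega>. \<omega> \<in> A k \<Longrightarrow> P (k, \<omega>)" "\<And>k \<omega>. \<omega> \<in> B k \<Longrightarrow> Q (k, \<omega>)"
    unfolding with_prob_tending_to_1_def by metis
  then show "with_prob_tending_to_1 M (\<lambda>k \<omega>. P (k, \<omega>) \<and> Q (k, \<omega>))"
    unfolding with_prob_tending_to_1_def
    by (intro exI[of _ "\<lambda>k. A k \<inter> B k"]) (auto intro: prob_Int_tendsto_1)
next
  fix P Q :: "nat \<times> 'a \<Rightarrow> bool"
  assume "\<forall>x. P x \<longrightarrow> Q x" "with_prob_tending_to_1 M (\<lambda>k \<omega>. P (k, \<omega>))"
  then show "with_prob_tending_to_1 M (\<lambda>k \<omega>. Q (k, \<omega>))"
    unfolding with_prob_tending_to_1_def by blast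
qed

text \<open>The finitely many stages below \<open>K\<close> may be given the empty event.
  Deterministic asymptotics in \<open>k\<close> can therefore be combined freely with random
  statements along \<open>wp1 M\<close>.\<close>

lemma filterlim_fst_wp1: "filterlim fst sequentially (wp1 M)"
proof (rule filterlim_at_top[THEN iffD2], rule allI)
  fix K :: nat
  have "(\<lambda>k. prob (if K \<le> k then space M else {})) \<longlonglongrightarrow> 1"
    by (rule tendsto_eventually, rule eventually_sequentiallyI[of K]) (simp add: prob_space)
  then show "\<forall>\<^sub>F p in wp1 M. K \<le> fst p"
    unfolding eventually_wp1 with_prob_tending_to_1_def
    by (intro exI[of _ "\<lambda>k. if K \<le> k then space M else {}"]) auto
qed

lemma tendsto_fst_wp1: "(f \<longlongrightarrow> l) sequentially \<Longrightarrow> ((\<lambda>p. f (fst p)) \<longlongrightarrow> l) (wp1 M)"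
  by (rule filterlim_compose[OF _ filterlim_fst_wp1])

lemma eventually_fst_wp1: "eventually P sequentially \<Longrightarrow> (\<forall>\<^sub>F p in wp1 M. P (fst p))"
  by (rule eventually_compose_filterlim[OF _ filterlim_fst_wp1])

text \<open>The sets of almost maximal probability inside \<open>{\<omega>. P (k, \<omega>)}\<close> serve for all \<open>\<delta>\<close> at once.\<close>

lemma eventually_wp1I:
  assumes "\<And>\<delta>. \<delta> > 0 \<Longrightarrow>
    \<forall>\<^sub>F k in sequentially. \<exists>A\<in>events. 1 - \<delta> \<le> prob A \<and> (\<forall>\<omega>\<in>A. P (k, \<omega>))"
  shows "eventually P (wp1 M)"
proof -
  define R where "R k = {prob A | A. A \<in> events \<and> (\<forall>\<omega>\<in>A. P (k, \<omega>))}" for k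
  have ne: "R k \<noteq> {}" for k unfolding R_def by blast
  have bdd: "bdd_above (R k)" for k unfolding R_def by (auto intro!: bdd_aboveI[of _ 1])
  \<comment> \<open>The supremum need not be attained; missing it by \<open>1 / Suc k\<close> costs
    nothing in the limit.\<close>
  have "\<exists>A\<in>events. (\<forall>\<omega>\<in>A. P (k, \<omega>)) \<and> Sup (R k) - 1 / Suc k < prob A" for k
  proof -
    have "Sup (R k) - 1 / Suc k < Sup (R k)" by simp
    then obtain r where "r \<in> R k" "Sup (R k) - 1 / Suc k < r"
      using less_cSup_iff[OF ne bdd] by blast
    then show ?thesis unfolding R_def by auto
  qed
  then obtain A where A: "\<And>k. A k \<in> events" "\<And>k \<omega>. \<omega> \<in> A k \<Longrightarrow> P (k, \<omega>)"
    "\<And>k. Sup (R k) - 1 / Suc k < prob (A k)" by metis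
  have "(\<lambda>k. prob (A k)) \<longlonglongrightarrow> 1"
  proof (rule order_tendstoI)
    fix y :: real assume "y < 1"
    \<comment> \<open>One half of the gap goes to the hypothesis, the other to the distance between
      \<open>prob (A k)\<close> and the supremum.\<close>
    define \<delta> where "\<delta> = (1 - y) / 2"
    have "\<delta> > 0" using \<open>y < 1\<close> by (simp add: \<delta>_def)
    have "\<forall>\<^sub>F k in sequentially. 1 / Suc k < \<delta>"
      using LIMSEQ_inverse_real_of_nat \<open>\<delta> > 0\<close>
      by (auto simp: tendsto_iff dist_real_def inverse_eq_divide dest!: order_tendstoD(2))
    with assms[OF \<open>\<delta> > 0\<close>] show "\<forall>\<^sub>F k in sequentially. y < prob (A k)"
    proof eventually_elim
      case (elim k)
      then have "1 - \<delta> \<le> Sup (R k)"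
      proof -
        from elim obtain B where "B \<in> events" "1 - \<delta> \<le> prob B" "\<forall>\<omega>\<in>B. P (k, \<omega>)" by blast
        moreover from this have "prob B \<in> R k" unfolding R_def by blast
        then have "prob B \<le> Sup (R k)" by (rule cSup_upper[OF _ bdd])
        ultimately show ?thesis by linarith
      qed
      moreover have "y = 1 - 2 * \<delta>" by (simp add: \<delta>_def field_simps)
      ultimately show ?case using elim(2) A(3)[of k] by linarith
    qed
  next
    fix y :: real assume "1 < y" then show "\<forall>\<^sub>F k in sequentially. prob (A k) < y"
      using prob_le_1 by (auto intro!: always_eventually intro: le_less_trans)
  qed
  with A show ?thesis unfolding eventually_wp1 with_prob_tending_to_1_def by blast
qed

text \<open>The usual form of tightness, with \<open>K\<close> depending on \<delta>, implies the
  product form of the definition: a factor \<open>Y\<close> tending to zero is below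
  \<open>e / K'\<close> on an event of probability close to one.\<close>

lemma bounded_in_probI:
  assumes "\<And>\<delta>. \<delta> > 0 \<Longrightarrow> \<exists>K. \<forall>\<^sub>F k in sequentially.
      \<exists>A\<in>events. 1 - \<delta> \<le> prob A \<and> (\<forall>\<omega>\<in>A. \<bar>X (k, \<omega>)\<bar> \<le> K)"
  shows "bounded_in_prob M X"
  unfolding bounded_in_prob_def
proof (intro allI impI tendstoI)
  fix Y and e :: real assume Y: "(Y \<longlongrightarrow> (0::real)) (wp1 M)" and "e > 0"
  show "\<forall>\<^sub>F p in wp1 M. dist (Y p * X p) 0 < e"
  proof (rule eventually_wp1I)
    fix \<delta> :: real assume "\<delta> > 0"
    then obtain K where K: "\<forall>\<^sub>F k in sequentially.
      \<exists>A\<in>events. 1 - \<delta> / 2 \<le> prob A \<and> (\<forall>\<omega>\<in>A. \<bar>X (k, \<omega>)\<bar> \<le> K)"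
      using assms[of "\<delta> / 2"] by auto
    \<comment> \<open>Positive even if \<open>K\<close> is not, and strictly above \<open>K\<close>,
      so that the product of the two bounds is strict.\<close>
    define K' where "K' = \<bar>K\<bar> + 1"
    have "K' > 0" by (simp add: K'_def)
    have "\<forall>\<^sub>F p in wp1 M. \<bar>Y p\<bar> < e / K'"
      using Y \<open>e > 0\<close> \<open>K' > 0\<close> by (auto simp: tendsto_iff dist_real_def)
    then obtain B where B: "\<And>k. B k \<in> events" "(\<lambda>k. prob (B k)) \<longlonglongrightarrow> 1"
      "\<And>k \<omega>. \<omega> \<in> B k \<Longrightarrow> \<bar>Y (k, \<omega>)\<bar> < e / K'"
      unfolding eventually_wp1 with_prob_tending_to_1_def by blast
    have "\<forall>\<^sub>F k in sequentially. 1 - \<delta> / 2 < prob (B k)"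
      using B(2) \<open>\<delta> > 0\<close> by (auto dest!: order_tendstoD(1)[of _ 1 _ "1 - \<delta> / 2"])
    with K show "\<forall>\<^sub>F k in sequentially. \<exists>A\<in>events. 1 - \<delta> \<le> prob A \<and>
        (\<forall>\<omega>\<in>A. dist (Y (k, \<omega>) * X (k, \<omega>)) 0 < e)"
    proof eventually_elim
      case (elim k)
      then obtain A where A: "A \<in> events" "1 - \<delta> / 2 \<le> prob A" "\<And>\<omega>. \<omega>\<in>A \<Longrightarrow> \<bar>X (k, \<omega>)\<bar> \<le> K"
        by blast
      show ?case
      proof (rule bexI[of _ "A \<inter> B k"], intro conjI ballI)
        show "1 - \<delta> \<le> prob (A \<inter> B k)"
          using finite_measure_Union'[of "A" "B k"] finite_measure_Diff'[of "B k" "A"]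
            prob_le_1[of "A \<union> B k"] A B(1)[of k] elim by (simp add: Int_commute)
        fix \<omega> assume "\<omega> \<in> A \<inter> B k"
        then have "\<bar>X (k, \<omega>)\<bar> < K'" "\<bar>Y (k, \<omega>)\<bar> < e / K'" using A(3)[of \<omega>] B(3)[of \<omega> k] by (auto simp: K'_def)
        then have "\<bar>Y (k, \<omega>)\<bar> * \<bar>X (k, \<omega>)\<bar> < e / K' * K'"
          using \<open>K' > 0\<close> by (intro mult_strict_mono') auto
        then show "dist (Y (k, \<omega>) * X (k, \<omega>)) 0 < e" using \<open>K' > 0\<close> by (simp add: abs_mult)
      qed (use A B in auto)
    qed
  qed
qed

lemma bounded_in_probD: "bounded_in_prob M X \<Longrightarrow> (Y \<longlongrightarrow> 0) (wp1 M) \<Longrightarrow> ((\<lambda>p. Y p * X p) \<longlongrightarrow> 0) (wp1 M)"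
  by (simp add: bounded_in_prob_def)

lemma bounded_in_prob_add: "bounded_in_prob M X \<Longrightarrow> bounded_in_prob M Y \<Longrightarrow> bounded_in_prob M (\<lambda>p. X p + Y p)"
  unfolding bounded_in_prob_def by (auto simp: distrib_left intro!: tendsto_add_zero)

lemma bounded_in_prob_cmult: "bounded_in_prob M X \<Longrightarrow> bounded_in_prob M (\<lambda>p. c * X p)"
  unfolding bounded_in_prob_def
  by (auto simp: mult.left_commute[of _ c] intro!: tendsto_mult_right_zero)

lemma bounded_in_prob_dominated:
  assumes "bounded_in_prob M X" "\<forall>\<^sub>F p in wp1 M. \<bar>Z p\<bar> \<le> \<bar>X p\<bar>"
  shows "bounded_in_prob M Z"
  unfolding bounded_in_prob_def
proof (intro allI impI)
  fix Y :: "nat \<times> 'a \<Rightarrow> real" assume "(Y \<longlongrightarrow> 0) (wp1 M)"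
  then have "((\<lambda>p. Y p * X p) \<longlongrightarrow> 0) (wp1 M)" using assms(1) by (simp add: bounded_in_prob_def)
  then show "((\<lambda>p. Y p * Z p) \<longlongrightarrow> 0) (wp1 M)"
    by (rule tendsto_0_le[where K = 1]) 
      (use assms(2) in \<open>auto elim!: eventually_mono simp: abs_mult intro!: mult_left_mono\<close>)
qed

lemma tendsto_wp1_L1:
  assumes "\<And>k. integrable M (X k)" "(\<lambda>k. expectation (\<lambda>\<omega>. \<bar>X k \<omega>\<bar>)) \<longlonglongrightarrow> 0"
  shows "((\<lambda>(k, \<omega>). X k \<omega> :: real) \<longlongrightarrow> 0) (wp1 M)"
proof (rule tendstoI)
  fix e :: real assume "e > 0"
  have [measurable]: "X k \<in> borel_measurable M" for k using assms(1) by auto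
  define A where "A k = {\<omega>\<in>space M. \<bar>X k \<omega>\<bar> < e}" for k
  have A[measurable]: "A k \<in> events" for k unfolding A_def by measurable
  have "1 - expectation (\<lambda>\<omega>. \<bar>X k \<omega>\<bar>) / e \<le> prob (A k)" for k
  proof -
    have "prob {\<omega>\<in>space M. e \<le> \<bar>X k \<omega>\<bar>} \<le> expectation (\<lambda>\<omega>. \<bar>X k \<omega>\<bar>) / e"
      using integral_Markov_inequality_measure[of M "\<lambda>\<omega>. \<bar>X k \<omega>\<bar>" "{}" e] assms(1) \<open>e > 0\<close> by simp
    moreover have "{\<omega>\<in>space M. e \<le> \<bar>X k \<omega>\<bar>} = space M - A k" by (auto simp: A_def)
    ultimately show ?thesis by (simp add: prob_compl)
  qed
  moreover have "(\<lambda>k. 1 - expectation (\<lambda>\<omega>. \<bar>X k \<omega>\<bar>) / e) \<longlonglongrightarrow> 1"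
    using tendsto_diff[OF tendsto_const[of 1] tendsto_divide[OF assms(2) tendsto_const[of e]]] \<open>e > 0\<close>
    by simp
  ultimately have "(\<lambda>k. prob (A k)) \<longlonglongrightarrow> 1"
    by - (rule tendsto_sandwich[OF always_eventually always_eventually _ tendsto_const], auto)
  then show "\<forall>\<^sub>F p in wp1 M. dist (case p of (k, \<omega>) \<Rightarrow> X k \<omega>) 0 < e"
    unfolding eventually_wp1 with_prob_tending_to_1_def
    by (intro exI[of _ A]) (auto simp: A_def)
qed

lemma expectation_sq_le: 
  assumes "integrable M (\<lambda>\<omega>. (X \<omega>)\<^sup>2)" "X \<in> borel_measurable M"
  shows "(expectation (\<lambda>\<omega>. \<bar>X \<omega> :: real\<bar>))\<^sup>2 \<le> expectation (\<lambda>\<omega>. (X \<omega>)\<^sup>2)"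
  using variance_positive[of "\<lambda>\<omega>. \<bar>X \<omega>\<bar>"] variance_eq[of "\<lambda>\<omega>. \<bar>X \<omega>\<bar>"]
    square_integrable_imp_integrable[OF assms(2,1)] assms by simp

lemma tendsto_wp1_L2:
  assumes [measurable]: "\<And>k. X k \<in> borel_measurable M" and "\<And>k. integrable M (\<lambda>\<omega>. (X k \<omega>)\<^sup>2)" 
    and lim: "(\<lambda>k. expectation (\<lambda>\<omega>. (X k \<omega>)\<^sup>2)) \<longlonglongrightarrow> 0"
  shows "((\<lambda>(k, \<omega>). X k \<omega> :: real) \<longlongrightarrow> 0) (wp1 M)"
proof (rule tendsto_wp1_L1)
  show "integrable M (X k)" for k using square_integrable_imp_integrable assms by blast
  have "(\<lambda>k. (expectation (\<lambda>\<omega>. \<bar>X k \<omega>\<bar>))\<^sup>2) \<longlonglongrightarrow> 0"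
    by (rule tendsto_sandwich[OF _ _ tendsto_const lim])
      (auto intro!: always_eventually expectation_sq_le assms)
  then show "(\<lambda>k. expectation (\<lambda>\<omega>. \<bar>X k \<omega>\<bar>)) \<longlonglongrightarrow> 0" by simp
qed

lemma bounded_in_prob_L2:
  assumes [measurable]: "\<And>k. X k \<in> borel_measurable M" and int: "\<And>k. integrable M (\<lambda>\<omega>. (X k \<omega>)\<^sup>2)" 
    and bound: "\<forall>\<^sub>F k in sequentially. expectation (\<lambda>\<omega>. (X k \<omega>)\<^sup>2) \<le> C"
  shows "bounded_in_prob M (\<lambda>(k, \<omega>). X k \<omega>)"
proof (rule bounded_in_probI)
  fix \<delta> :: real assume "\<delta> > 0"
  \<comment> \<open>Chosen so that Markov's inequality for the square leaves a tail of probability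
    at most \<delta>.\<close>
  define K where "K = (\<bar>C\<bar> + 1) / \<delta>"
  have "K > 0" using \<open>\<delta> > 0\<close> by (simp add: K_def)
  from bound have "\<forall>\<^sub>F k in sequentially. \<exists>A\<in>events. 1 - \<delta> \<le> prob A \<and>
        (\<forall>\<omega>\<in>A. \<bar>X k \<omega>\<bar> \<le> sqrt K)"
  proof eventually_elim
    case (elim k)
    have "prob {\<omega>\<in>space M. K \<le> (X k \<omega>)\<^sup>2} \<le> expectation (\<lambda>\<omega>. (X k \<omega>)\<^sup>2) / K"
      using integral_Markov_inequality_measure[of M "\<lambda>\<omega>. (X k \<omega>)\<^sup>2" "{}" K] int \<open>K > 0\<close> by simp
    also have "\<dots> \<le> (\<bar>C\<bar> + 1) / K"
      by (rule divide_right_mono) (use elim \<open>K > 0\<close> in auto)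
    also have "\<dots> = \<delta>" by (simp add: K_def)
    finally have "prob {\<omega>\<in>space M. K \<le> (X k \<omega>)\<^sup>2} \<le> \<delta>" .
    moreover have "prob (space M - {\<omega>\<in>space M. K \<le> (X k \<omega>)\<^sup>2}) = 1 - prob {\<omega>\<in>space M. K \<le> (X k \<omega>)\<^sup>2}"
      by (rule prob_compl) measurable
    ultimately show ?case
      by (intro bexI[of _ "space M - {\<omega>\<in>space M. K \<le> (X k \<omega>)\<^sup>2}"])
        (auto simp: not_le intro!: real_le_rsqrt)
  qed
  then show "\<exists>K. \<forall>\<^sub>F k in sequentially. \<exists>A\<in>events. 1 - \<delta> \<le> prob A \<and>
        (\<forall>\<omega>\<in>A. \<bar>case (k, \<omega>) of (k, \<omega>) \<Rightarrow> X k \<omega>\<bar> \<le> K)" by auto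
qed

text \<open>Slutsky's argument for one test function: \<open>cos\<close> is 1-Lipschitz where the
  difference is small and contributes at most 2 elsewhere. In the identification of variances
  \<open>X\<close> is a score whose limit is computed and \<open>Y\<close> the scaled estimator
  whose limit law is assumed.\<close>

lemma expectation_cos_Slutsky:
  assumes [measurable]: "\<And>k. X k \<in> borel_measurable M" "\<And>k. Y k \<in> borel_measurable M"
    and lim: "((\<lambda>(k, \<omega>). X k \<omega> - Y k \<omega> :: real) \<longlongrightarrow> 0) (wp1 M)"
  shows "(\<lambda>k. expectation (\<lambda>\<omega>. cos (X k \<omega>)) - expectation (\<lambda>\<omega>. cos (Y k \<omega>))) \<longlonglongrightarrow> 0"
proof (rule LIMSEQ_I)
  fix r :: real assume "r > 0"
  \<comment> \<open>Once the exceptional event has probability below \<open>e\<close>, the bound is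
    less than \<open>3 * e\<close>, hence less than \<open>r\<close>.\<close>
  define e where "e = r / 4"
  have "e > 0" using \<open>r > 0\<close> by (simp add: e_def)
  from tendstoD[OF lim this] obtain A where A: "\<And>k. A k \<in> events" "(\<lambda>k. prob (A k)) \<longlonglongrightarrow> 1"
      "\<And>k \<omega>. \<omega> \<in> A k \<Longrightarrow> \<bar>X k \<omega> - Y k \<omega>\<bar> < e"
    unfolding eventually_wp1 with_prob_tending_to_1_def by (auto simp: dist_real_def)
  note [measurable] = A(1)
  have int[simp]: "integrable M (\<lambda>\<omega>. cos (Z k \<omega>))" if [measurable]: "Z k \<in> borel_measurable M" for Z :: "nat \<Rightarrow> 'a \<Rightarrow> real" and k
    by (rule integrable_const_bound[of _ 1]) auto
  have cos_lip: "\<bar>cos x - cos y\<bar> \<le> \<bar>x - y\<bar>" for x y :: real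
  proof -
    have "norm (cos x - cos y) \<le> 1 * norm (x - y)"
      by (rule field_differentiable_bound[of UNIV _ "\<lambda>x. - sin x"])
        (auto intro!: derivative_eq_intros)
    then show ?thesis by simp
  qed
  have bound: "\<bar>expectation (\<lambda>\<omega>. cos (X k \<omega>)) - expectation (\<lambda>\<omega>. cos (Y k \<omega>))\<bar> \<le> e + 2 * (1 - prob (A k))" for k
  proof -
    have "\<bar>expectation (\<lambda>\<omega>. cos (X k \<omega>)) - expectation (\<lambda>\<omega>. cos (Y k \<omega>))\<bar>
        = \<bar>expectation (\<lambda>\<omega>. cos (X k \<omega>) - cos (Y k \<omega>))\<bar>" by simp
    also have "\<dots> \<le> expectation (\<lambda>\<omega>. \<bar>cos (X k \<omega>) - cos (Y k \<omega>)\<bar>)" by (rule integral_abs_bound)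
    also have "\<dots> \<le> expectation (\<lambda>\<omega>. e + 2 * indicator (space M - A k) \<omega>)"
    proof (rule integral_mono)
      fix \<omega> assume "\<omega> \<in> space M"
      have "\<bar>cos (X k \<omega>) - cos (Y k \<omega>)\<bar> \<le> 2"
        using abs_cos_le_one[of "X k \<omega>"] abs_cos_le_one[of "Y k \<omega>"] by linarith
      then show "\<bar>cos (X k \<omega>) - cos (Y k \<omega>)\<bar> \<le> e + 2 * indicator (space M - A k) \<omega>"
        using A(3)[of \<omega> k] cos_lip[of "X k \<omega>" "Y k \<omega>"] \<open>e > 0\<close> \<open>\<omega> \<in> space M\<close>
        by (cases "\<omega> \<in> A k") (auto simp: indicator_def)
    next
      show "integrable M (\<lambda>\<omega>. e + 2 * indicat_real (space M - A k) \<omega>)"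
        by (intro Bochner_Integration.integrable_add integrable_mult_right integrable_real_indicator)
          (auto simp: emeasure_eq_measure)
    qed auto
    also have "\<dots> = e + 2 * (1 - prob (A k))"
      by (subst Bochner_Integration.integral_add)
        (auto simp: prob_space prob_compl emeasure_eq_measure intro!: integrable_mult_right integrable_real_indicator)
    finally show ?thesis .
  qed
  have "\<forall>\<^sub>F k in sequentially. 1 - e < prob (A k)"
    using A(2) \<open>e > 0\<close> by (auto dest!: order_tendstoD(1)[of _ 1 _ "1 - e"])
  then show "\<exists>no. \<forall>k\<ge>no. norm (expectation (\<lambda>\<omega>. cos (X k \<omega>)) - expectation (\<lambda>\<omega>. cos (Y k \<omega>)) - 0) < r"
    unfolding eventually_sequentially
  proof (elim exE, intro exI allI impI)
    fix no k assume "\<forall>k\<ge>no. 1 - e < prob (A k)" "no \<le> k"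
    with bound[of k] show "norm (expectation (\<lambda>\<omega>. cos (X k \<omega>)) - expectation (\<lambda>\<omega>. cos (Y k \<omega>)) - 0) < r"
      using \<open>r > 0\<close> by (auto simp: e_def)
  qed
qed

end

section \<open>Sums over independent samples\<close>

context prob_space
begin

text \<open>Cross terms vanish by independence. Integrability is carried through the induction
  because the expectation of a product factorizes only once both factors are known to be
  integrable.\<close>

lemma indep_sum_second_moment:
  fixes X :: "'i \<Rightarrow> 'a \<Rightarrow> real"
  assumes "finite I" "indep_vars (\<lambda>_. borel) X I"
    and "\<And>i. i \<in> I \<Longrightarrow> integrable M (\<lambda>\<omega>. (X i \<omega>)\<^sup>2)" "\<And>i. i \<in> I \<Longrightarrow> expectation (X i) = 0"
  shows "integrable M (\<lambda>\<omega>. (\<Sum>i\<in>I. X i \<omega>)\<^sup>2) \<and>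
    expectation (\<lambda>\<omega>. (\<Sum>i\<in>I. X i \<omega>)\<^sup>2) = (\<Sum>i\<in>I. expectation (\<lambda>\<omega>. (X i \<omega>)\<^sup>2))"
  using assms
proof (induction I rule: finite_induct)
  case (insert a F)
  let ?S = "\<lambda>\<omega>. \<Sum>i\<in>F. X i \<omega>"
  have [measurable]: "X i \<in> borel_measurable M" if "i \<in> insert a F" for i
    using insert.prems(1) that unfolding indep_vars_def2 by blast
  have [measurable]: "X a \<in> borel_measurable M" "?S \<in> borel_measurable M" by measurable
  have indF: "indep_vars (\<lambda>_. borel) X F" using insert.prems(1) by (rule indep_vars_subset) auto
  have IH: "integrable M (\<lambda>\<omega>. (?S \<omega>)\<^sup>2)"
    "expectation (\<lambda>\<omega>. (?S \<omega>)\<^sup>2) = (\<Sum>i\<in>F. expectation (\<lambda>\<omega>. (X i \<omega>)\<^sup>2))"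
    using insert.IH[OF indF] insert.prems by auto
  have Xa: "integrable M (\<lambda>\<omega>. (X a \<omega>)\<^sup>2)" "expectation (X a) = 0" using insert.prems by auto
  have int: "integrable M (X a)" "integrable M ?S"
    using square_integrable_imp_integrable[OF _ Xa(1)] square_integrable_imp_integrable[OF _ IH(1)] by simp_all
  have ind: "indep_var borel (X a) borel ?S" using insert by (intro indep_vars_sum) auto
  have prod: "expectation (\<lambda>\<omega>. X a \<omega> * ?S \<omega>) = 0" "integrable M (\<lambda>\<omega>. X a \<omega> * ?S \<omega>)"
    using indep_var_lebesgue_integral[OF ind int] indep_var_integrable[OF ind int] Xa(2) by simp_all
  have eq: "(\<Sum>i\<in>insert a F. X i \<omega>)\<^sup>2 = (X a \<omega>)\<^sup>2 + 2 * (X a \<omega> * ?S \<omega>) + (?S \<omega>)\<^sup>2" for \<omega>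
    using insert.hyps by (simp add: power2_sum)
  show ?case
    unfolding eq using Xa(1) prod IH insert.hyps by simp
qed simp

end

locale samples = prob_space M
  for M :: "'w measure" +
  fixes J :: "nat set" and z :: "nat \<Rightarrow> nat \<Rightarrow> 'w \<Rightarrow> 'a::topological_space"
    and P :: "nat \<Rightarrow> 'a measure" and n :: "nat \<Rightarrow> nat \<Rightarrow> nat" and N :: "nat \<Rightarrow> nat"
    and \<eta> :: "nat \<Rightarrow> real"
  assumes finite_J[simp]: "finite J"
    and indep: "indep_vars (\<lambda>_. borel) (\<lambda>(j, i). z j i) (J \<times> UNIV)"
    and distr_z: "j \<in> J \<Longrightarrow> distr M borel (z j i) = P j"
    and N_top: "filterlim N at_top sequentially"
    and proportions: "j \<in> J \<Longrightarrow> (\<lambda>k. real (n k j) / real (N k)) \<longlonglongrightarrow> \<eta> j"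
begin

text \<open>Normalized by the total size and not by the size of sample \<open>j\<close>: limits
  carry the factor \<open>\<eta> j\<close>, and contributions of different samples add up without
  weights.\<close>

definition emp :: "nat \<Rightarrow> ('a \<Rightarrow> real) \<Rightarrow> nat \<times> 'w \<Rightarrow> real" where
  "emp j f p = (\<Sum>i<n (fst p) j. f (z j i (snd p))) / real (N (fst p))"

definition nsum :: "(nat \<Rightarrow> 'a \<Rightarrow> real) \<Rightarrow> nat \<times> 'w \<Rightarrow> real" where
  "nsum f p = (\<Sum>j\<in>J. \<Sum>i<n (fst p) j. f j (z j i (snd p))) / sqrt (real (N (fst p)))"

definition var :: "nat \<Rightarrow> ('a \<Rightarrow> real) \<Rightarrow> real" where
  "var j f = (\<integral>y. (f y - (\<integral>y. f y \<partial>P j))\<^sup>2 \<partial>P j)"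

lemma z_measurable[measurable]: "j \<in> J \<Longrightarrow> z j i \<in> borel_measurable M"
  using indep unfolding indep_vars_def2 by auto

lemma prob_space_P: "j \<in> J \<Longrightarrow> prob_space (P j)"
  using distr_z[of j 0] prob_space_distr[of "z j 0" borel] by auto

lemma sets_P: "j \<in> J \<Longrightarrow> sets (P j) = sets borel"
  using distr_z[of j 0] by (metis sets_distr)

lemma integral_z: "j \<in> J \<Longrightarrow> f \<in> borel_measurable borel \<Longrightarrow>
    expectation (\<lambda>\<omega>. f (z j i \<omega>)) = (\<integral>y. (f y :: real) \<partial>P j)"
  using distr_z[of j i] integral_distr[of "z j i" M borel f] by simp

lemma integrable_z: "j \<in> J \<Longrightarrow> f \<in> borel_measurable borel \<Longrightarrow>
    integrable M (\<lambda>\<omega>. f (z j i \<omega>) :: real) \<longleftrightarrow> integrable (P j) f"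
  using distr_z[of j i] integrable_distr_eq[of "z j i" M borel f] by simp

lemma real_N_top: "filterlim (\<lambda>k. real (N k)) at_top sequentially"
  by (rule filterlim_compose[OF filterlim_real_sequentially N_top])

lemma inverse_N: "(\<lambda>k. 1 / real (N k)) \<longlonglongrightarrow> 0"
  by (rule tendsto_divide_0[OF tendsto_const filterlim_at_top_imp_at_infinity[OF real_N_top]])

lemma N_pos: "\<forall>\<^sub>F k in sequentially. N k > 0"
  by (rule eventually_compose_filterlim[OF eventually_gt_at_top N_top])

lemma proportion_nonneg: assumes "j \<in> J" shows "\<eta> j \<ge> 0"
  by (rule tendsto_lowerbound[OF proportions[OF assms]]) auto

lemma nsum_eq: "nsum f (k, \<omega>) =
  (\<Sum>q\<in>(SIGMA j:J. {..<n k j}). f (fst q) (case_prod z q \<omega>) / sqrt (real (N k)))"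
  unfolding nsum_def by (simp add: sum.Sigma split_def sum_divide_distrib[symmetric])

lemma indep_scaled:
  assumes "\<And>j. j \<in> J \<Longrightarrow> f j \<in> borel_measurable borel"
  shows "indep_vars (\<lambda>_. borel) (\<lambda>q \<omega>. f (fst q) (case_prod z q \<omega>) / c :: real) (SIGMA j:J. {..<n k j})"
proof -
  have "indep_vars (\<lambda>_. borel) (\<lambda>q. case_prod z q) (SIGMA j:J. {..<n k j})"
    by (rule indep_vars_subset[OF indep]) auto
  then show ?thesis
    by (rule indep_vars_compose2[where Y = "\<lambda>q y. f (fst q) y / c"]) (use assms in auto)
qed

lemma var_nonneg: "var j f \<ge> 0" unfolding var_def by simp

lemma square_integrable_P:
  assumes "j \<in> J" "f \<in> borel_measurable borel" "integrable (P j) (\<lambda>y. (f y :: real)\<^sup>2)"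
  shows "integrable (P j) f"
proof -
  interpret P: prob_space "P j" by (rule prob_space_P[OF assms(1)])
  have "f \<in> borel_measurable (P j)"
    using assms(2) measurable_cong_sets[OF sets_P[OF assms(1)] refl] by blast
  then show ?thesis using P.square_integrable_imp_integrable assms(3) by blast
qed

lemma var_eq:
  assumes "j \<in> J" "f \<in> borel_measurable borel" "integrable (P j) (\<lambda>y. (f y :: real)\<^sup>2)"
  shows "var j f = (\<integral>y. (f y)\<^sup>2 \<partial>P j) - (\<integral>y. f y \<partial>P j)\<^sup>2"
proof -
  interpret P: prob_space "P j" by (rule prob_space_P[OF assms(1)])
  show ?thesis unfolding var_def
    using P.variance_eq[OF square_integrable_P[OF assms] assms(3)] by simp
qed

lemma measurable_P: "j \<in> J \<Longrightarrow> borel_measurable (P j) = borel_measurable borel"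
  using measurable_cong_sets[OF sets_P refl] by blast

lemma nsum_measurable:
  assumes "\<And>j. j \<in> J \<Longrightarrow> f j \<in> borel_measurable borel"
  shows "(\<lambda>\<omega>. nsum f (k, \<omega>)) \<in> borel_measurable M"
proof -
  have [measurable]: "(\<lambda>\<omega>. f j (z j i \<omega>)) \<in> borel_measurable M" if "j \<in> J" for j i
    by (rule measurable_compose[OF z_measurable[OF that] assms[OF that]])
  show ?thesis unfolding nsum_def by simp
qed

text \<open>Since the weighted means cancel in total, centring each summand within its own sample
  leaves the sum unchanged, and the within-sample variances remain. This reflects sampling with
  fixed sizes, as opposed to drawing from the pooled mixture.\<close>

lemma nsum_second_moment:
  assumes f: "\<And>j. j \<in> J \<Longrightarrow> f j \<in> borel_measurable borel"
    "\<And>j. j \<in> J \<Longrightarrow> integrable (P j) (\<lambda>y. (f j y)\<^sup>2)"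
    and mean: "(\<Sum>j\<in>J. real (n k j) * (\<integral>y. f j y \<partial>P j)) = 0"
  shows "integrable M (\<lambda>\<omega>. (nsum f (k, \<omega>))\<^sup>2)"
    "expectation (\<lambda>\<omega>. (nsum f (k, \<omega>))\<^sup>2) = (\<Sum>j\<in>J. real (n k j) / real (N k) * var j (f j))"
proof -
  define g where "g j y = f j y - (\<integral>y. f j y \<partial>P j)" for j y
  have g: "g j \<in> borel_measurable borel" "integrable (P j) (\<lambda>y. (g j y)\<^sup>2)" 
      "(\<integral>y. g j y \<partial>P j) = 0" "(\<integral>y. (g j y)\<^sup>2 \<partial>P j) = var j (f j)" if "j \<in> J" for j
  proof -
    interpret P: prob_space "P j" by (rule prob_space_P[OF that])
    have i: "integrable (P j) (f j)" using square_integrable_P[OF that f[OF that]] .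
    show "g j \<in> borel_measurable borel" "(\<integral>y. g j y \<partial>P j) = 0" "(\<integral>y. (g j y)\<^sup>2 \<partial>P j) = var j (f j)"
      using f[OF that] i by (auto simp: g_def[abs_def] var_def P.prob_space)
    show "integrable (P j) (\<lambda>y. (g j y)\<^sup>2)"
      using i f(2)[OF that] by (simp add: g_def power2_diff)
  qed
  have eq: "nsum f (k, \<omega>) = nsum g (k, \<omega>)" for \<omega>
    using mean by (simp add: nsum_def g_def sum_subtractf)
  let ?I = "SIGMA j:J. {..<n k j}"
  let ?X = "\<lambda>q \<omega>. g (fst q) (case_prod z q \<omega>) / sqrt (real (N k))"
  have X: "integrable M (\<lambda>\<omega>. (?X q \<omega>)\<^sup>2)" "expectation (?X q) = 0"
    "expectation (\<lambda>\<omega>. (?X q \<omega>)\<^sup>2) = var (fst q) (f (fst q)) / N k" if "q \<in> ?I" for q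
  proof -
    from that obtain j i where q: "q = (j, i)" "j \<in> J" by auto
    have m: "(\<lambda>y. (g j y)\<^sup>2) \<in> borel_measurable borel" using g(1)[OF q(2)] by simp
    show "integrable M (\<lambda>\<omega>. (?X q \<omega>)\<^sup>2)"
      using integrable_z[OF q(2) m] g(2)[OF q(2)] q by (simp add: power_divide)
    show "expectation (?X q) = 0" using integral_z[OF q(2) g(1)[OF q(2)]] g(3)[OF q(2)] q by simp
    show "expectation (\<lambda>\<omega>. (?X q \<omega>)\<^sup>2) = var (fst q) (f (fst q)) / N k"
      using integral_z[OF q(2) m] g(4)[OF q(2)] q by (simp add: power_divide)
  qed
  have fin: "finite ?I" by simp
  have ind: "indep_vars (\<lambda>_. borel) ?X ?I" by (rule indep_scaled[OF g(1)])
  note * = indep_sum_second_moment[OF fin ind X(1,2)]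
  show "integrable M (\<lambda>\<omega>. (nsum f (k, \<omega>))\<^sup>2)"
    unfolding eq unfolding nsum_eq by (rule conjunct1[OF *])
  have "expectation (\<lambda>\<omega>. (nsum f (k, \<omega>))\<^sup>2) = (\<Sum>q\<in>?I. expectation (\<lambda>\<omega>. (?X q \<omega>)\<^sup>2))"
    unfolding eq unfolding nsum_eq by (rule conjunct2[OF *])
  also have "\<dots> = (\<Sum>q\<in>?I. var (fst q) (f (fst q)) / N k)" using X(3) by (intro sum.cong) auto
  also have "\<dots> = (\<Sum>j\<in>J. \<Sum>i<n k j. var j (f j) / N k)"
    using sum.Sigma[of J "\<lambda>j. {..<n k j}" "\<lambda>j i. var j (f j) / N k"] by (simp add: split_def)
  finally show "expectation (\<lambda>\<omega>. (nsum f (k, \<omega>))\<^sup>2) = (\<Sum>j\<in>J. real (n k j) / real (N k) * var j (f j))"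
    by simp
qed

lemma emp_measurable:
  assumes "j \<in> J" "f \<in> borel_measurable borel"
  shows "(\<lambda>\<omega>. emp j f (k, \<omega>)) \<in> borel_measurable M"
proof -
  have [measurable]: "(\<lambda>\<omega>. f (z j i \<omega>)) \<in> borel_measurable M" for i
    by (rule measurable_compose[OF z_measurable[OF assms(1)] assms(2)])
  show ?thesis unfolding emp_def by simp
qed

lemma emp_integrable:
  assumes "j \<in> J" "f \<in> borel_measurable borel" "integrable (P j) f"
  shows "integrable M (\<lambda>\<omega>. emp j f (k, \<omega>))"
    "expectation (\<lambda>\<omega>. emp j f (k, \<omega>)) = real (n k j) / real (N k) * (\<integral>y. f y \<partial>P j)"
  unfolding emp_def using assms integrable_z integral_z by simp_all

lemma emp_diff: "emp j (\<lambda>y. f y - g y) p = emp j f p - emp j g p"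
  by (simp add: emp_def sum_subtractf diff_divide_distrib)

lemma emp_add: "emp j (\<lambda>y. f y + g y) p = emp j f p + emp j g p"
  by (simp add: emp_def sum.distrib add_divide_distrib)

lemma emp_cmult: "emp j (\<lambda>y. c * f y) p = c * emp j f p"
  by (simp add: emp_def sum_distrib_left)

lemma emp_mono: "(\<And>y. f y \<le> g y) \<Longrightarrow> emp j f p \<le> emp j g p"
  unfolding emp_def by (intro divide_right_mono sum_mono) auto

lemma emp_abs: "\<bar>emp j f p\<bar> \<le> emp j (\<lambda>y. \<bar>f y\<bar>) p"
  unfolding emp_def by (auto intro!: divide_right_mono)

lemma emp_L2_bound:
  assumes j: "j \<in> J" and f: "f \<in> borel_measurable borel" "integrable (P j) (\<lambda>y. (f y)\<^sup>2)"
    "(\<integral>y. f y \<partial>P j) = 0"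
  shows "(expectation (\<lambda>\<omega>. \<bar>emp j f (k, \<omega>)\<bar>))\<^sup>2 \<le> real (n k j) / real (N k) * (1 / real (N k)) * (\<integral>y. (f y)\<^sup>2 \<partial>P j)"
proof -
  \<comment> \<open>A single sample is viewed as a sum over all samples with zero summands
    elsewhere, so that the second moment formula applies.\<close>
  define g where "g i = (if i = j then f else (\<lambda>_. 0))" for i
  have g: "g i \<in> borel_measurable borel" "integrable (P i) (\<lambda>y. (g i y)\<^sup>2)" "(\<integral>y. g i y \<partial>P i) = 0" if "i \<in> J" for i
    using f by (auto simp: g_def)
  have eq: "emp j f (k, \<omega>) = nsum g (k, \<omega>) / sqrt (real (N k))" for \<omega>
  proof -
    have "(\<Sum>i\<in>J. \<Sum>l<n k i. g i (z i l \<omega>)) = (\<Sum>i\<in>J. if i = j then \<Sum>l<n k j. f (z j l \<omega>) else 0)"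
      by (intro sum.cong) (auto simp: g_def)
    then show ?thesis using j by (simp add: emp_def nsum_def)
  qed
  have mean: "(\<Sum>i\<in>J. real (n k i) * (\<integral>y. g i y \<partial>P i)) = 0" using g(3) by simp
  note m = nsum_second_moment[OF g(1,2) mean]
  have "(expectation (\<lambda>\<omega>. \<bar>emp j f (k, \<omega>)\<bar>))\<^sup>2 \<le> expectation (\<lambda>\<omega>. (emp j f (k, \<omega>))\<^sup>2)"
    by (rule expectation_sq_le[OF _ emp_measurable[OF j f(1)]]) (use m(1) in \<open>auto simp: eq power_divide\<close>)
  also have "\<dots> = (\<Sum>i\<in>J. real (n k i) / real (N k) * var i (g i)) / N k"
    using m(2) by (simp add: eq power_divide)
  also have "(\<Sum>i\<in>J. real (n k i) / real (N k) * var i (g i)) = 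
      (\<Sum>i\<in>J. if i = j then real (n k j) / real (N k) * (\<integral>y. (f y)\<^sup>2 \<partial>P j) else 0)"
    using f(3) by (intro sum.cong) (auto simp: g_def var_def)
  finally show ?thesis using j by simp
qed

text \<open>Truncation reduces the law of large numbers for an integrable summand to bounded summands.\<close>

lemma weak_law:
  assumes j: "j \<in> J" and f[measurable]: "f \<in> borel_measurable borel" and int: "integrable (P j) f"
  shows "(emp j f \<longlongrightarrow> \<eta> j * (\<integral>y. f y \<partial>P j)) (wp1 M)"
proof -
  interpret P: prob_space "P j" by (rule prob_space_P[OF j])
  note [simp] = measurable_P[OF j]
  define m where "m = (\<integral>y. f y \<partial>P j)"
  have "((\<lambda>(k, \<omega>). emp j (\<lambda>y. f y - m) (k, \<omega>)) \<longlongrightarrow> 0) (wp1 M)"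
  proof (rule tendsto_wp1_L1)
    have int': "integrable (P j) (\<lambda>y. f y - m)" using int by simp
    show "integrable M (\<lambda>\<omega>. emp j (\<lambda>y. f y - m) (k, \<omega>))" for k
      by (rule emp_integrable(1)[OF j _ int']) simp
    show "(\<lambda>k. expectation (\<lambda>\<omega>. \<bar>emp j (\<lambda>y. f y - m) (k, \<omega>)\<bar>)) \<longlonglongrightarrow> 0"
    proof (rule LIMSEQ_I)
      fix r :: real assume "r > 0"
      \<comment> \<open>The added one keeps the divisor below positive when \<open>\<eta> j\<close>
        is zero. The truncation error enters twice, through the tail and through the shift of the
        mean, each time at most \<open>\<delta>\<close>, which leaves \<open>r / 2\<close> in the
        limit.\<close>
      define c where "c = \<eta> j + 1"
      have "c > 0" using proportion_nonneg[OF j] by (simp add: c_def)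
      define \<delta> where "\<delta> = r / (4 * c)"
      have "\<delta> > 0" using \<open>c > 0\<close> \<open>r > 0\<close> by (simp add: \<delta>_def)
      define h where "h K y = (if \<bar>f y\<bar> \<le> real K then 0 else f y)" for K y
      have [measurable]: "h K \<in> borel_measurable borel" for K unfolding h_def by measurable
      have habs: "\<bar>h K y\<bar> \<le> \<bar>f y\<bar>" for K y by (simp add: h_def)
      have hint: "integrable (P j) (h K)" for K
        by (rule Bochner_Integration.integrable_bound[OF int]) (use habs in auto)
      have "(\<lambda>K. \<integral>y. \<bar>h K y\<bar> \<partial>P j) \<longlonglongrightarrow> (\<integral>y. 0 \<partial>P j)"
      proof (rule integral_dominated_convergence[where w = "\<lambda>y. \<bar>f y\<bar>"])
        have "(\<lambda>K. \<bar>h K y\<bar>) \<longlonglongrightarrow> 0" for y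
        proof (rule tendsto_eventually)
          show "\<forall>\<^sub>F K in sequentially. \<bar>h K y\<bar> = 0"
            using eventually_ge_at_top[of "nat \<lceil>\<bar>f y\<bar>\<rceil>"]
            by eventually_elim (auto simp: h_def)
        qed
        then show "AE y in P j. (\<lambda>K. \<bar>h K y\<bar>) \<longlonglongrightarrow> 0" by simp
      qed (use int habs in auto)
      then have "\<forall>\<^sub>F K in sequentially. (\<integral>y. \<bar>h K y\<bar> \<partial>P j) < \<delta>"
        using \<open>\<delta> > 0\<close> by (auto dest: order_tendstoD(2))
      then obtain K where K: "(\<integral>y. \<bar>h K y\<bar> \<partial>P j) < \<delta>"
        by (auto simp: eventually_sequentially)
      define g where "g y = f y - h K y" for y
      have g_bound: "\<bar>g y\<bar> \<le> real K" for y by (simp add: g_def h_def)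
      have [measurable]: "g \<in> borel_measurable borel" unfolding g_def by measurable
      have gint: "integrable (P j) g" unfolding g_def using int hint by simp
      define mg where "mg = (\<integral>y. g y \<partial>P j)"
      define g0 where "g0 y = g y - mg" for y
      have [measurable]: "g0 \<in> borel_measurable borel" unfolding g0_def by measurable
      have g0_int: "integrable (P j) g0" "(\<integral>y. g0 y \<partial>P j) = 0"
        using gint by (auto simp: g0_def[abs_def] mg_def P.prob_space)
      have g0_sq: "integrable (P j) (\<lambda>y. (g0 y)\<^sup>2)"
      proof (rule P.integrable_const_bound[of _ "(real K + \<bar>mg\<bar>)\<^sup>2"])
        have "(g0 y)\<^sup>2 \<le> (real K + \<bar>mg\<bar>)\<^sup>2" for y 
          using g_bound[of y] by (intro abs_le_square_iff[THEN iffD1]) (simp add: g0_def)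
        then show "AE y in P j. norm ((g0 y)\<^sup>2) \<le> (real K + \<bar>mg\<bar>)\<^sup>2" by simp
      qed simp
      have mdiff: "\<bar>m - mg\<bar> \<le> \<delta>"
      proof -
        have "m - mg = (\<integral>y. h K y \<partial>P j)" using int hint by (simp add: m_def mg_def g_def)
        then show ?thesis using integral_abs_bound[of "P j" "h K"] K by linarith
      qed
      define C where "C = (\<integral>y. (g0 y)\<^sup>2 \<partial>P j)"
      have bound: "expectation (\<lambda>\<omega>. \<bar>emp j (\<lambda>y. f y - m) (k, \<omega>)\<bar>) \<le>
          sqrt (real (n k j) / real (N k) * (1 / real (N k)) * C) + real (n k j) / real (N k) * (2 * \<delta>)" for k
      proof -
        have "expectation (\<lambda>\<omega>. \<bar>emp j (\<lambda>y. f y - m) (k, \<omega>)\<bar>) \<le>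
          expectation (\<lambda>\<omega>. \<bar>emp j g0 (k, \<omega>)\<bar> + emp j (\<lambda>y. \<bar>h K y\<bar> + \<delta>) (k, \<omega>))"
        proof (rule integral_mono)
          show "integrable M (\<lambda>\<omega>. \<bar>emp j (\<lambda>y. f y - m) (k, \<omega>)\<bar>)"
            by (rule integrable_abs[OF emp_integrable(1)[OF j _ int']]) simp
          show "integrable M (\<lambda>\<omega>. \<bar>emp j g0 (k, \<omega>)\<bar> + emp j (\<lambda>y. \<bar>h K y\<bar> + \<delta>) (k, \<omega>))"
            by (intro Bochner_Integration.integrable_add integrable_abs emp_integrable(1)[OF j] g0_int) (use hint in auto)
          fix \<omega>
          have "\<bar>emp j (\<lambda>y. f y - m) (k, \<omega>)\<bar> = \<bar>emp j g0 (k, \<omega>) + emp j (\<lambda>y. h K y + (mg - m)) (k, \<omega>)\<bar>"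
            by (simp add: emp_add[symmetric] g0_def g_def)
          also have "\<dots> \<le> \<bar>emp j g0 (k, \<omega>)\<bar> + \<bar>emp j (\<lambda>y. h K y + (mg - m)) (k, \<omega>)\<bar>" by simp
          also have "\<bar>emp j (\<lambda>y. h K y + (mg - m)) (k, \<omega>)\<bar> \<le> emp j (\<lambda>y. \<bar>h K y\<bar> + \<delta>) (k, \<omega>)"
            by (rule order_trans[OF emp_abs emp_mono]) (use mdiff in linarith)
          finally show "\<bar>emp j (\<lambda>y. f y - m) (k, \<omega>)\<bar> \<le> \<bar>emp j g0 (k, \<omega>)\<bar> + emp j (\<lambda>y. \<bar>h K y\<bar> + \<delta>) (k, \<omega>)"
            by simp
        qed
        also have "\<dots> = expectation (\<lambda>\<omega>. \<bar>emp j g0 (k, \<omega>)\<bar>) + expectation (\<lambda>\<omega>. emp j (\<lambda>y. \<bar>h K y\<bar> + \<delta>) (k, \<omega>))"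
          by (intro Bochner_Integration.integral_add integrable_abs emp_integrable(1)[OF j] g0_int) (use hint in auto)
        also have "expectation (\<lambda>\<omega>. \<bar>emp j g0 (k, \<omega>)\<bar>) \<le> sqrt (real (n k j) / real (N k) * (1 / real (N k)) * C)"
          using emp_L2_bound[OF j _ g0_sq g0_int(2), of k] by (intro real_le_rsqrt) (simp add: C_def)
        also have "expectation (\<lambda>\<omega>. emp j (\<lambda>y. \<bar>h K y\<bar> + \<delta>) (k, \<omega>)) = 
            real (n k j) / real (N k) * ((\<integral>y. \<bar>h K y\<bar> \<partial>P j) + \<delta>)"
          by (subst emp_integrable(2)[OF j]) (use hint in \<open>auto simp: P.prob_space\<close>)
        also have "\<dots> \<le> real (n k j) / real (N k) * (2 * \<delta>)"
          using K by (intro mult_left_mono) auto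
        finally show ?thesis by simp
      qed
      have "(\<lambda>k. sqrt (real (n k j) / real (N k) * (1 / real (N k)) * C) + real (n k j) / real (N k) * (2 * \<delta>))
        \<longlonglongrightarrow> sqrt (\<eta> j * 0 * C) + \<eta> j * (2 * \<delta>)"
        by (intro tendsto_intros proportions[OF j] inverse_N)
      moreover have "sqrt (\<eta> j * 0 * C) + \<eta> j * (2 * \<delta>) < r"
      proof -
        have "\<eta> j * (2 * \<delta>) \<le> c * (2 * \<delta>)" using \<open>\<delta> > 0\<close> by (simp add: c_def)
        also have "\<dots> < r" using \<open>c > 0\<close> \<open>r > 0\<close> by (simp add: \<delta>_def)
        finally show ?thesis by simp
      qed
      ultimately have "\<forall>\<^sub>F k in sequentially. 
          sqrt (real (n k j) / real (N k) * (1 / real (N k)) * C) + real (n k j) / real (N k) * (2 * \<delta>) < r"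
        by (rule order_tendstoD(2))
      then have "\<forall>\<^sub>F k in sequentially. norm (expectation (\<lambda>\<omega>. \<bar>emp j (\<lambda>y. f y - m) (k, \<omega>)\<bar>) - 0) < r"
      proof eventually_elim
        case (elim k)
        have "0 \<le> expectation (\<lambda>\<omega>. \<bar>emp j (\<lambda>y. f y - m) (k, \<omega>)\<bar>)" by simp
        with bound[of k] elim show ?case by simp
      qed
      then show "\<exists>no. \<forall>k\<ge>no. norm (expectation (\<lambda>\<omega>. \<bar>emp j (\<lambda>y. f y - m) (k, \<omega>)\<bar>) - 0) < r"
        by (simp add: eventually_sequentially)
    qed
  qed
  moreover have "((\<lambda>p. real (n (fst p) j) / real (N (fst p)) * m) \<longlongrightarrow> \<eta> j * m) (wp1 M)"
    by (intro tendsto_mult tendsto_const tendsto_fst_wp1[of "\<lambda>k. real (n k j) / real (N k)"] proportions[OF j])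
  ultimately have "((\<lambda>p. emp j (\<lambda>y. f y - m) p + real (n (fst p) j) / real (N (fst p)) * m) \<longlongrightarrow> 0 + \<eta> j * m) (wp1 M)"
    by (intro tendsto_add) (simp_all add: split_def)
  moreover have "emp j (\<lambda>y. f y - m) p + real (n (fst p) j) / real (N (fst p)) * m = emp j f p" for p
    by (simp add: emp_diff) (simp add: emp_def)
  ultimately show ?thesis by (simp add: m_def)
qed

end

section \<open>Central limit theorem for several samples and for triangular arrays\<close>

lemma power_one_minus_tendsto_exp:
  assumes "filterlim N at_top sequentially" "(\<lambda>k. real (m k) / real (N k)) \<longlonglongrightarrow> e"
  shows "(\<lambda>k. (1 - s / real (N k)) ^ m k) \<longlonglongrightarrow> exp (- (e * s))"
proof -
  have top: "filterlim (\<lambda>k. real (N k)) at_top sequentially"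
    by (rule filterlim_compose[OF filterlim_real_sequentially assms(1)])
  have lim: "((\<lambda>x. x * ln (1 - s / x)) \<longlongrightarrow> - s) at_top" by real_asymp
  have "(\<lambda>k. real (N k) * ln (1 - s / real (N k))) \<longlonglongrightarrow> - s"
    by (rule filterlim_compose[OF lim top])
  then have "(\<lambda>k. exp (real (m k) / real (N k) * (real (N k) * ln (1 - s / real (N k))))) \<longlonglongrightarrow> exp (e * (- s))"
    by (intro tendsto_intros assms(2))
  moreover have "\<forall>\<^sub>F k in sequentially. real (N k) > max 0 s"
    by (rule eventually_compose_filterlim[OF eventually_gt_at_top top])
  then have "\<forall>\<^sub>F k in sequentially. exp (real (m k) / real (N k) * (real (N k) * ln (1 - s / real (N k)))) =
      (1 - s / real (N k)) ^ m k"
  proof eventually_elim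
    case (elim k)
    then have "s / real (N k) < 1" by (auto simp: divide_less_eq)
    then show ?case using elim by (simp add: exp_of_nat_mult)
  qed
  ultimately show ?thesis using tendsto_cong by fastforce
qed

context samples
begin

text \<open>The characteristic function of the sum is a product in which every factor
  \<open>\<psi> j k\<close> is replaced by its second-order polynomial \<open>w j k\<close>. There
  are \<open>n k j\<close> replacements, of the order of \<open>N k\<close>, each costing
  \<open>R j k / (6 * N k)\<close> with \<open>R j k\<close> tending to zero. The real part at the
  argument 1 is the expectation of the cosine.\<close>

lemma nsum_cos_centred:
  assumes f: "\<And>j. j \<in> J \<Longrightarrow> f j \<in> borel_measurable borel"
    "\<And>j. j \<in> J \<Longrightarrow> integrable (P j) (\<lambda>y. (f j y)\<^sup>2)"
    and mean: "\<And>j. j \<in> J \<Longrightarrow> (\<integral>y. f j y \<partial>P j) = 0"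
  shows "(\<lambda>k. expectation (\<lambda>\<omega>. cos (nsum f (k, \<omega>)))) \<longlonglongrightarrow> exp (- (\<Sum>j\<in>J. \<eta> j * var j (f j)) / 2)"
proof -
  define s where "s j = var j (f j)" for j
  have s_eq: "s j = (\<integral>y. (f j y)\<^sup>2 \<partial>P j)" if "j \<in> J" for j using mean[OF that] by (simp add: s_def var_def)
  define \<psi> where "\<psi> j k = (CLINT y|P j. iexp (f j y / sqrt (real (N k))))" for j k
  \<comment> \<open>The Taylor remainder of the characteristic function. The minimum with the
    quadratic term gives an integrable envelope even if third moments are infinite.\<close>
  define R where "R j k = (\<integral>y. min (6 * (f j y)\<^sup>2) (1 / sqrt (real (N k)) * \<bar>f j y\<bar> ^ 3) \<partial>P j)" for j k
  define w where "w j k = complex_of_real (1 - s j / 2 / real (N k))" for j k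
  let ?I = "\<lambda>k. SIGMA j:J. {..<n k j}"
  let ?X = "\<lambda>k q \<omega>. f (fst q) (case_prod z q \<omega>) / sqrt (real (N k))"
  have char: "char (distr M borel (\<lambda>\<omega>. nsum f (k, \<omega>))) 1 = (\<Prod>j\<in>J. \<psi> j k ^ n k j)" for k
  proof -
    have "char (distr M borel (\<lambda>\<omega>. nsum f (k, \<omega>))) 1 = (\<Prod>q\<in>?I k. char (distr M borel (?X k q)) 1)"
      unfolding nsum_eq by (rule char_distr_sum[OF indep_scaled[OF f(1)]])
    also have "\<dots> = (\<Prod>q\<in>?I k. \<psi> (fst q) k)"
    proof (rule prod.cong[OF refl])
      fix q assume "q \<in> ?I k"
      then obtain j i where q: "q = (j, i)" "j \<in> J" by auto
      note [measurable] = f(1)[OF q(2)] z_measurable[OF q(2), of i]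
      have "char (distr M borel (?X k q)) 1 = (CLINT \<omega>|M. iexp (f j (z j i \<omega>) / sqrt (real (N k))))"
        unfolding char_def by (subst integral_distr) (auto simp: q)
      also have "\<dots> = (CLINT y|distr M borel (z j i). iexp (f j y / sqrt (real (N k))))"
        by (subst integral_distr) auto
      finally show "char (distr M borel (?X k q)) 1 = \<psi> (fst q) k"
        using distr_z[OF q(2)] q by (simp add: \<psi>_def)
    qed
    also have "\<dots> = (\<Prod>j\<in>J. \<Prod>i<n k j. \<psi> j k)"
      using prod.Sigma[of J "\<lambda>j. {..<n k j}" "\<lambda>j i. \<psi> j k"] by (simp add: split_def)
    finally show ?thesis by simp
  qed
  have \<psi>_le: "cmod (\<psi> j k) \<le> 1" and \<psi>_approx: "N k > 0 \<Longrightarrow> cmod (\<psi> j k - w j k) \<le> R j k / (6 * real (N k))"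
    if "j \<in> J" for j k
  proof -
    interpret Pj: prob_space "P j" by (rule prob_space_P[OF that])
    have m[measurable]: "f j \<in> borel_measurable (P j)" unfolding measurable_P[OF that] by (rule f(1)[OF that])
    have rd: "real_distribution (distr (P j) borel (f j))"
      by (rule Pj.real_distribution_distr) (rule m)
    have ch: "\<psi> j k = char (distr (P j) borel (f j)) (1 / sqrt (real (N k)))"
      unfolding \<psi>_def char_def by (subst integral_distr) auto
    show "cmod (\<psi> j k) \<le> 1"
      unfolding ch by (rule real_distribution.cmod_char_le_1[OF rd])
    assume "N k > 0"
    have "cmod (char (distr (P j) borel (f j)) (1 / sqrt (real (N k))) - (1 - (1 / sqrt (real (N k)))\<^sup>2 * s j / 2)) 
      \<le> ((1 / sqrt (real (N k)))\<^sup>2 / 6) * (\<integral>y. min (6 * (f j y)\<^sup>2) (\<bar>1 / sqrt (real (N k))\<bar> * \<bar>f j y\<bar> ^ 3) \<partial>P j)"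
    proof (rule Pj.char_approx3')
      show "Pj.variance (f j) = s j" using mean[OF that] by (simp add: s_def var_def)
    qed (use f(2)[OF that] mean[OF that] square_integrable_P[OF that f[OF that]] m in auto)
    then show "cmod (\<psi> j k - w j k) \<le> R j k / (6 * real (N k))"
      using \<open>N k > 0\<close> unfolding ch[symmetric] w_def R_def by (simp add: power_divide mult.commute)
  qed
  have R0: "R j \<longlonglongrightarrow> 0" if "j \<in> J" for j
  proof -
    note [simp] = measurable_P[OF that] and [measurable] = f(1)[OF that]
    have inv_sqrt: "(\<lambda>k. 1 / sqrt (real (N k))) \<longlonglongrightarrow> 0"
      using tendsto_real_sqrt[OF inverse_N] by (simp add: real_sqrt_divide)
    have "(\<lambda>k. R j k) \<longlonglongrightarrow> (\<integral>y. 0 \<partial>P j)"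
      unfolding R_def
    proof (rule integral_dominated_convergence[where w = "\<lambda>y. 6 * (f j y)\<^sup>2"])
      have "(\<lambda>k. min (6 * (f j y)\<^sup>2) (1 / sqrt (real (N k)) * \<bar>f j y\<bar> ^ 3)) \<longlonglongrightarrow> min (6 * (f j y)\<^sup>2) (0 * \<bar>f j y\<bar> ^ 3)" for y
        by (intro tendsto_intros inv_sqrt)
      then show "AE y in P j. (\<lambda>k. min (6 * (f j y)\<^sup>2) (1 / sqrt (real (N k)) * \<bar>f j y\<bar> ^ 3)) \<longlonglongrightarrow> 0" by simp
    qed (use f(2)[OF that] in auto)
    then show ?thesis by simp
  qed
  have w_lim: "(\<lambda>k. \<Prod>j\<in>J. w j k ^ n k j) \<longlonglongrightarrow> (\<Prod>j\<in>J. complex_of_real (exp (- (\<eta> j * (s j / 2)))))"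
    unfolding w_def of_real_power[symmetric]
    by (intro tendsto_prod tendsto_of_real power_one_minus_tendsto_exp N_top proportions)
  \<comment> \<open>Comparing products factor by factor requires all factors in the closed unit
    disc; for \<open>w\<close> this holds once \<open>N k\<close> exceeds
    \<open>s j\<close>.\<close>
  have w_le: "\<forall>\<^sub>F k in sequentially. \<forall>j\<in>J. cmod (w j k) \<le> 1"
    unfolding eventually_ball_finite_distrib[OF finite_J]
  proof
    fix j assume "j \<in> J"
    have "\<forall>\<^sub>F k in sequentially. real (N k) > s j"
      by (rule eventually_compose_filterlim[OF eventually_gt_at_top real_N_top])
    with N_pos show "\<forall>\<^sub>F k in sequentially. cmod (w j k) \<le> 1"
    proof eventually_elim
      case (elim k)
      have "0 \<le> s j / 2 / real (N k)" "s j / 2 / real (N k) \<le> 1"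
        using var_nonneg[of j "f j"] elim by (auto simp: s_def divide_le_eq)
      then show ?case unfolding w_def norm_of_real by simp
    qed
  qed
  have "(\<lambda>k. \<Sum>j\<in>J. real (n k j) / real (N k) * R j k / 6) \<longlonglongrightarrow> (\<Sum>j\<in>J. \<eta> j * 0 / 6)"
    by (intro tendsto_intros proportions R0) auto
  then have R_lim: "(\<lambda>k. \<Sum>j\<in>J. real (n k j) / real (N k) * R j k / 6) \<longlonglongrightarrow> 0" by simp
  have "\<forall>\<^sub>F k in sequentially. cmod ((\<Prod>j\<in>J. \<psi> j k ^ n k j) - (\<Prod>j\<in>J. w j k ^ n k j))
      \<le> (\<Sum>j\<in>J. real (n k j) / real (N k) * R j k / 6)"
    using w_le N_pos
  proof eventually_elim
    case (elim k)
    have "cmod ((\<Prod>j\<in>J. \<psi> j k ^ n k j) - (\<Prod>j\<in>J. w j k ^ n k j)) \<le> (\<Sum>j\<in>J. cmod (\<psi> j k ^ n k j - w j k ^ n k j))"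
      by (rule norm_prod_diff) (use elim \<psi>_le in \<open>auto simp: norm_power intro!: power_le_one\<close>)
    also have "\<dots> \<le> (\<Sum>j\<in>J. real (n k j) / real (N k) * R j k / 6)"
    proof (rule sum_mono)
      fix j assume j: "j \<in> J"
      have "cmod (\<psi> j k ^ n k j - w j k ^ n k j) \<le> n k j * cmod (\<psi> j k - w j k)"
        by (rule norm_power_diff) (use elim \<psi>_le j in auto)
      also have "\<dots> \<le> n k j * (R j k / (6 * real (N k)))"
        using \<psi>_approx[OF j] elim by (intro mult_left_mono) auto
      finally show "cmod (\<psi> j k ^ n k j - w j k ^ n k j) \<le> real (n k j) / real (N k) * R j k / 6"
        by (simp add: field_simps)
    qed
    finally show ?case .
  qed
  then have diff_lim: "(\<lambda>k. (\<Prod>j\<in>J. \<psi> j k ^ n k j) - (\<Prod>j\<in>J. w j k ^ n k j)) \<longlonglongrightarrow> 0"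
    by (rule Lim_null_comparison[OF _ R_lim])
  have lim_eq: "(\<Prod>j\<in>J. complex_of_real (exp (- (\<eta> j * (s j / 2))))) = complex_of_real (exp (- (\<Sum>j\<in>J. \<eta> j * s j) / 2))"
    unfolding of_real_prod[symmetric] exp_sum[symmetric, OF finite_J]
    by (simp add: sum_negf sum_divide_distrib)
  from tendsto_add[OF diff_lim w_lim[unfolded lim_eq]]
  have char_lim: "(\<lambda>k. char (distr M borel (\<lambda>\<omega>. nsum f (k, \<omega>))) 1) \<longlonglongrightarrow> complex_of_real (exp (- (\<Sum>j\<in>J. \<eta> j * s j) / 2))"
    unfolding char by (simp only: diff_add_cancel add_0_left)
  have "Re (char (distr M borel (\<lambda>\<omega>. nsum f (k, \<omega>))) 1) = expectation (\<lambda>\<omega>. cos (nsum f (k, \<omega>)))" for k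
  proof -
    have [measurable]: "(\<lambda>\<omega>. nsum f (k, \<omega>)) \<in> borel_measurable M" by (rule nsum_measurable[OF f(1)])
    have "char (distr M borel (\<lambda>\<omega>. nsum f (k, \<omega>))) 1 = (CLINT \<omega>|M. iexp (nsum f (k, \<omega>)))"
      unfolding char_def by (subst integral_distr) auto
    also have "Re \<dots> = expectation (\<lambda>\<omega>. Re (iexp (nsum f (k, \<omega>))))"
      by (rule integral_Re[symmetric]) (rule integrable_iexp, simp_all)
    finally show ?thesis by (simp add: cis_conv_exp[symmetric] Re_exp)
  qed
  with tendsto_Re[OF char_lim] show ?thesis by (simp add: s_def)
qed

lemma var_le:
  assumes j: "j \<in> J" and u: "u \<in> borel_measurable borel" "integrable (P j) (\<lambda>y. (u y)\<^sup>2)"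
  shows "var j (\<lambda>y. u y + c) \<le> (\<integral>y. (u y)\<^sup>2 \<partial>P j)"
proof -
  interpret P: prob_space "P j" by (rule prob_space_P[OF j])
  have "var j (\<lambda>y. u y + c) = var j u"
    using square_integrable_P[OF j u] by (simp add: var_def P.prob_space)
  also have "\<dots> \<le> (\<integral>y. (u y)\<^sup>2 \<partial>P j)" using var_eq[OF j u] by simp
  finally show ?thesis .
qed

text \<open>The sum is split into \<open>g\<close>, which is \<open>f\<close> centred within each
  sample, and the rest \<open>d\<close>, which carries the sample means and so inherits the
  vanishing total mean of \<open>fk k\<close>. The variance of \<open>d\<close> is at most
  \<open>(r k)\<^sup>2\<close> times a second moment of \<open>h\<close>, whatever constants it
  contains, so \<open>d\<close> disappears in mean square and \<open>g\<close> determines the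
  limit.\<close>

lemma nsum_triangular:
  assumes fk: "\<And>k j. j \<in> J \<Longrightarrow> fk k j \<in> borel_measurable borel"
    and f: "\<And>j. j \<in> J \<Longrightarrow> f j \<in> borel_measurable borel"
      "\<And>j. j \<in> J \<Longrightarrow> integrable (P j) (\<lambda>y. (f j y)\<^sup>2)"
    and lip: "\<And>k j y. j \<in> J \<Longrightarrow> \<bar>fk k j y - f j y\<bar> \<le> r k * h y" "r \<longlonglongrightarrow> 0"
    and h: "h \<in> borel_measurable borel" "\<And>j. j \<in> J \<Longrightarrow> integrable (P j) (\<lambda>y. (h y)\<^sup>2)"
    and mean: "\<forall>\<^sub>F k in sequentially. (\<Sum>j\<in>J. real (n k j) * (\<integral>y. fk k j y \<partial>P j)) = 0"
  shows "bounded_in_prob M (\<lambda>p. nsum (fk (fst p)) p)"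
    "(\<lambda>k. expectation (\<lambda>\<omega>. cos (nsum (fk k) (k, \<omega>)))) \<longlonglongrightarrow> exp (- (\<Sum>j\<in>J. \<eta> j * var j (f j)) / 2)"
proof -
  define m where "m j = (\<integral>y. f j y \<partial>P j)" for j
  define g where "g j y = f j y - m j" for j y
  define u where "u k j y = fk k j y - f j y" for k j y
  define d where "d k j y = u k j y + m j" for k j y
  have g: "g j \<in> borel_measurable borel" "integrable (P j) (\<lambda>y. (g j y)\<^sup>2)" "(\<integral>y. g j y \<partial>P j) = 0"
    "var j (g j) = var j (f j)" if "j \<in> J" for j
  proof -
    interpret P: prob_space "P j" by (rule prob_space_P[OF that])
    have i: "integrable (P j) (f j)" using square_integrable_P[OF that f[OF that]] .
    show *: "g j \<in> borel_measurable borel" "(\<integral>y. g j y \<partial>P j) = 0"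
      using f[OF that] i by (auto simp: g_def[abs_def] m_def P.prob_space)
    show "integrable (P j) (\<lambda>y. (g j y)\<^sup>2)"
      using i f(2)[OF that] by (simp add: g_def power2_diff)
    show "var j (g j) = var j (f j)" unfolding var_def *(2) by (simp add: g_def m_def)
  qed
  have u: "u k j \<in> borel_measurable borel" "integrable (P j) (\<lambda>y. (u k j y)\<^sup>2)"
    "(\<integral>y. (u k j y)\<^sup>2 \<partial>P j) \<le> (r k)\<^sup>2 * (\<integral>y. (h y)\<^sup>2 \<partial>P j)" if "j \<in> J" for k j
  proof -
    show m: "u k j \<in> borel_measurable borel" unfolding u_def using fk[OF that] f(1)[OF that] by simp
    have b: "(u k j y)\<^sup>2 \<le> (r k)\<^sup>2 * (h y)\<^sup>2" for y
      using power_mono[OF lip(1)[OF that, of k y] abs_ge_zero, of 2]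
      by (simp add: u_def power_mult_distrib)
    have hi: "integrable (P j) (\<lambda>y. (r k)\<^sup>2 * (h y)\<^sup>2)" using h(2)[OF that] by simp
    show i: "integrable (P j) (\<lambda>y. (u k j y)\<^sup>2)"
      by (rule Bochner_Integration.integrable_bound[OF hi])
        (use b m in \<open>auto simp: measurable_P[OF that] intro: order_trans\<close>)
    show "(\<integral>y. (u k j y)\<^sup>2 \<partial>P j) \<le> (r k)\<^sup>2 * (\<integral>y. (h y)\<^sup>2 \<partial>P j)"
      using integral_mono[OF i hi] b by simp
  qed
  have d: "d k j \<in> borel_measurable borel" "integrable (P j) (\<lambda>y. (d k j y)\<^sup>2)"
    "var j (d k j) \<le> (r k)\<^sup>2 * (\<integral>y. (h y)\<^sup>2 \<partial>P j)" "(\<integral>y. d k j y \<partial>P j) = (\<integral>y. fk k j y \<partial>P j)" 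
    if "j \<in> J" for k j
  proof -
    interpret P: prob_space "P j" by (rule prob_space_P[OF that])
    have i: "integrable (P j) (u k j)" using square_integrable_P[OF that u(1,2)[OF that]] .
    have i2: "integrable (P j) (f j)" using square_integrable_P[OF that f[OF that]] .
    show "d k j \<in> borel_measurable borel" unfolding d_def using u(1)[OF that] by simp
    show "integrable (P j) (\<lambda>y. (d k j y)\<^sup>2)"
      using i u(2)[OF that, of k] by (simp add: d_def power2_sum)
    show "var j (d k j) \<le> (r k)\<^sup>2 * (\<integral>y. (h y)\<^sup>2 \<partial>P j)"
      unfolding d_def[abs_def] using var_le[OF that u(1,2)[OF that]] u(3)[OF that] by (rule order_trans)
    have "(\<integral>y. fk k j y \<partial>P j) = (\<integral>y. u k j y + f j y \<partial>P j)" by (simp add: u_def)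
    also have "\<dots> = (\<integral>y. d k j y \<partial>P j)" unfolding d_def using i i2 by (simp add: m_def P.prob_space)
    finally show "(\<integral>y. d k j y \<partial>P j) = (\<integral>y. fk k j y \<partial>P j)" by simp
  qed
  \<comment> \<open>The total mean vanishes only eventually, whereas the mean-square criteria ask
    for moments at every stage; at the remaining stages the difference is set to zero.\<close>
  define good where "good k \<longleftrightarrow> (\<Sum>j\<in>J. real (n k j) * (\<integral>y. d k j y \<partial>P j)) = 0" for k
  have ev_good: "eventually good sequentially"
    using mean by eventually_elim (use d(4) in \<open>simp add: good_def\<close>)
  define D where "D k \<omega> = (if good k then nsum (d k) (k, \<omega>) else 0)" for k \<omega>
  define C where "C = (\<Sum>j\<in>J. \<integral>y. (h y)\<^sup>2 \<partial>P j)"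
  have D: "D k \<in> borel_measurable M" "integrable M (\<lambda>\<omega>. (D k \<omega>)\<^sup>2)"
    "expectation (\<lambda>\<omega>. (D k \<omega>)\<^sup>2) \<le> (\<Sum>j\<in>J. real (n k j) / real (N k) * ((r k)\<^sup>2 * (\<integral>y. (h y)\<^sup>2 \<partial>P j)))" for k
  proof -
    have "(\<lambda>\<omega>. nsum (d k) (k, \<omega>)) \<in> borel_measurable M" by (rule nsum_measurable[OF d(1)])
    then show "D k \<in> borel_measurable M" by (cases "good k") (simp_all add: D_def[abs_def])
    show "integrable M (\<lambda>\<omega>. (D k \<omega>)\<^sup>2)"
      using nsum_second_moment(1)[where f = "d k" and k = k, OF d(1,2)]
      by (cases "good k") (auto simp: D_def good_def)
    show "expectation (\<lambda>\<omega>. (D k \<omega>)\<^sup>2) \<le> (\<Sum>j\<in>J. real (n k j) / real (N k) * ((r k)\<^sup>2 * (\<integral>y. (h y)\<^sup>2 \<partial>P j)))"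
    proof (cases "good k")
      case True
      then have "expectation (\<lambda>\<omega>. (D k \<omega>)\<^sup>2) = (\<Sum>j\<in>J. real (n k j) / real (N k) * var j (d k j))"
        using nsum_second_moment(2)[where f = "d k" and k = k, OF d(1,2)] by (simp add: D_def good_def)
      also have "\<dots> \<le> (\<Sum>j\<in>J. real (n k j) / real (N k) * ((r k)\<^sup>2 * (\<integral>y. (h y)\<^sup>2 \<partial>P j)))"
        using d(3) by (intro sum_mono mult_left_mono) auto
      finally show ?thesis .
    qed (auto simp: D_def intro!: sum_nonneg)
  qed
  have "(\<lambda>k. \<Sum>j\<in>J. real (n k j) / real (N k) * ((r k)\<^sup>2 * (\<integral>y. (h y)\<^sup>2 \<partial>P j))) \<longlonglongrightarrow>
      (\<Sum>j\<in>J. \<eta> j * (0\<^sup>2 * (\<integral>y. (h y)\<^sup>2 \<partial>P j)))"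
    by (intro tendsto_intros proportions lip(2))
  then have "(\<lambda>k. expectation (\<lambda>\<omega>. (D k \<omega>)\<^sup>2)) \<longlonglongrightarrow> 0"
    by - (rule tendsto_sandwich[OF always_eventually always_eventually tendsto_const], use D(3) in auto)
  then have D0: "((\<lambda>(k, \<omega>). D k \<omega>) \<longlongrightarrow> 0) (wp1 M)" by (rule tendsto_wp1_L2[OF D(1,2)])
  have split: "nsum (fk k) (k, \<omega>) - nsum g (k, \<omega>) = D k \<omega>" if "good k" for k \<omega>
    using that by (simp add: D_def nsum_def g_def d_def u_def diff_divide_distrib[symmetric] sum_subtractf[symmetric] algebra_simps)
  have gm: "(\<Sum>j\<in>J. real (n k j) * (\<integral>y. g j y \<partial>P j)) = 0" for k using g(3) by simp
  note mom = nsum_second_moment[where f = g, OF g(1,2) gm]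
  have tg: "bounded_in_prob M (\<lambda>(k, \<omega>). nsum g (k, \<omega>))"
  proof (rule bounded_in_prob_L2)
    have "(\<lambda>k. \<Sum>j\<in>J. real (n k j) / real (N k) * var j (g j)) \<longlonglongrightarrow> (\<Sum>j\<in>J. \<eta> j * var j (g j))"
      by (intro tendsto_intros proportions)
    then have "\<forall>\<^sub>F k in sequentially. (\<Sum>j\<in>J. real (n k j) / real (N k) * var j (g j)) < (\<Sum>j\<in>J. \<eta> j * var j (g j)) + 1"
      by (rule order_tendstoD(2)) simp
    then show "\<forall>\<^sub>F k in sequentially. expectation (\<lambda>\<omega>. (nsum g (k, \<omega>))\<^sup>2) \<le> (\<Sum>j\<in>J. \<eta> j * var j (g j)) + 1"
    proof eventually_elim
      case (elim k)
      then show ?case using mom(2)[of k] by linarith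
    qed
  qed (use mom(1) nsum_measurable[OF g(1)] in auto)
  have tD: "bounded_in_prob M (\<lambda>(k, \<omega>). D k \<omega>)" unfolding bounded_in_prob_def using D0 by (auto intro!: tendsto_mult_zero)
  show "bounded_in_prob M (\<lambda>p. nsum (fk (fst p)) p)"
  proof (rule bounded_in_prob_dominated[OF bounded_in_prob_add[OF tg tD]])
    show "\<forall>\<^sub>F p in wp1 M. \<bar>nsum (fk (fst p)) p\<bar> \<le> \<bar>(case p of (k, \<omega>) \<Rightarrow> nsum g (k, \<omega>)) + (case p of (k, \<omega>) \<Rightarrow> D k \<omega>)\<bar>"
      using eventually_fst_wp1[OF ev_good]
    proof eventually_elim
      case (elim p)
      then show ?case using split[of "fst p" "snd p"] by (simp add: split_def)
    qed
  qed
  have "((\<lambda>(k, \<omega>). nsum (fk k) (k, \<omega>) - nsum g (k, \<omega>)) \<longlongrightarrow> 0) (wp1 M)"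
  proof (rule Lim_transform_eventually[OF D0])
    show "\<forall>\<^sub>F p in wp1 M. (case p of (k, \<omega>) \<Rightarrow> D k \<omega>) = (case p of (k, \<omega>) \<Rightarrow> nsum (fk k) (k, \<omega>) - nsum g (k, \<omega>))"
      using eventually_fst_wp1[OF ev_good] 
    proof eventually_elim
      case (elim p)
      then show ?case using split[of "fst p" "snd p"] by (simp add: split_def)
    qed
  qed
  then have "(\<lambda>k. expectation (\<lambda>\<omega>. cos (nsum (fk k) (k, \<omega>))) - expectation (\<lambda>\<omega>. cos (nsum g (k, \<omega>)))) \<longlonglongrightarrow> 0"
    by (intro expectation_cos_Slutsky nsum_measurable fk g(1))
  moreover have "(\<lambda>k. expectation (\<lambda>\<omega>. cos (nsum g (k, \<omega>)))) \<longlonglongrightarrow> exp (- (\<Sum>j\<in>J. \<eta> j * var j (f j)) / 2)"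
    using nsum_cos_centred[where f = g, OF g(1-3)] g(4) by simp
  ultimately show "(\<lambda>k. expectation (\<lambda>\<omega>. cos (nsum (fk k) (k, \<omega>)))) \<longlonglongrightarrow> exp (- (\<Sum>j\<in>J. \<eta> j * var j (f j)) / 2)"
    using tendsto_add by fastforce
qed

end

section \<open>Logistic scores\<close>

definition logistic :: "real \<Rightarrow> real" where "logistic t = exp t / (1 + exp t)"

definition logistic' :: "real \<Rightarrow> real" where "logistic' t = logistic t * (1 - logistic t)"

lemma one_plus_exp_pos: "0 < 1 + exp (t :: real)" "1 + exp t \<noteq> (0 :: real)"
  using exp_gt_zero[of t] by linarith+

lemma logistic_bounds: "0 < logistic t" "logistic t < 1"
  using one_plus_exp_pos[of t] by (auto simp: logistic_def divide_less_eq)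

lemma logistic'_bounds: "0 < logistic' t" "logistic' t \<le> 1"
  unfolding logistic'_def using logistic_bounds[of t] by (auto intro!: mult_le_one)

lemma DERIV_logistic: "(logistic has_real_derivative logistic' t) (at t)"
  unfolding logistic_def[abs_def] logistic'_def
  by (rule derivative_eq_intros refl one_plus_exp_pos)+ (use one_plus_exp_pos[of t] in \<open>simp add: field_simps power2_eq_square\<close>)

lemma DERIV_logistic': "(logistic' has_real_derivative logistic' t * (1 - 2 * logistic t)) (at t)"
  unfolding logistic'_def[abs_def]
  by (rule derivative_eq_intros DERIV_logistic refl)+ (simp add: logistic'_def algebra_simps)

lemma logistic_lipschitz: "\<bar>logistic x - logistic y\<bar> \<le> \<bar>x - y\<bar>"
proof -
  have "norm (logistic x - logistic y) \<le> 1 * norm (x - y)"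
    by (rule field_differentiable_bound[of UNIV _ logistic'])
      (auto simp: logistic'_bounds less_imp_le[OF logistic'_bounds(1)] intro: DERIV_logistic)
  then show ?thesis by simp
qed

lemma logistic'_lipschitz: "\<bar>logistic' x - logistic' y\<bar> \<le> \<bar>x - y\<bar>"
proof -
  have "\<bar>logistic' t * (1 - 2 * logistic t)\<bar> \<le> 1" for t
    using logistic'_bounds[of t] logistic_bounds[of t] by (auto simp: abs_mult intro!: mult_le_one)
  then have "norm (logistic' x - logistic' y) \<le> 1 * norm (x - y)"
    by (intro field_differentiable_bound[of UNIV _ "\<lambda>t. logistic' t * (1 - 2 * logistic t)"])
      (auto intro: DERIV_logistic')
  then show ?thesis by simp
qed

text \<open>The slope is frozen at a third point \<open>s\<close>, so the linear part has
  coefficients that do not move with \<open>x\<close> and \<open>y\<close>. Capping the error factor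
  at 1 makes the later remainders integrable under second moments of the features.\<close>

lemma logistic_Taylor:
  "\<bar>logistic x - logistic y - logistic' s * (x - y)\<bar> \<le> min 1 (\<bar>x - s\<bar> + \<bar>y - s\<bar>) * \<bar>x - y\<bar>"
proof -
  have *: "\<bar>logistic x - logistic y - logistic' s * (x - y)\<bar> \<le> min 1 (\<bar>x - s\<bar> + \<bar>y - s\<bar>) * \<bar>x - y\<bar>"
    if less: "y < x" for x y
  proof -
    obtain \<xi> where \<xi>: "y < \<xi>" "\<xi> < x" "logistic x - logistic y = (x - y) * logistic' \<xi>"
      using MVT2[OF less, of logistic logistic'] DERIV_logistic by blast
    have "logistic x - logistic y - logistic' s * (x - y) = (logistic' \<xi> - logistic' s) * (x - y)"
      using \<xi>(3) by (simp add: algebra_simps)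
    moreover have "\<bar>logistic' \<xi> - logistic' s\<bar> \<le> min 1 (\<bar>x - s\<bar> + \<bar>y - s\<bar>)"
      using logistic'_lipschitz[of \<xi> s] \<xi> logistic'_bounds[of \<xi>] logistic'_bounds[of s] by auto
    ultimately show ?thesis by (simp add: abs_mult mult_right_mono)
  qed
  consider "y < x" | "x < y" | "x = y" by linarith
  then show ?thesis
  proof cases
    case 2
    have "\<bar>logistic x - logistic y - logistic' s * (x - y)\<bar> = \<bar>logistic y - logistic x - logistic' s * (y - x)\<bar>"
      by (simp add: abs_minus_commute algebra_simps)
    then show ?thesis using *[OF 2] by (simp add: abs_minus_commute add.commute)
  qed (use * in auto)
qed

lemma logistic_measurable[measurable]: "logistic \<in> borel_measurable borel"
  unfolding logistic_def[abs_def] by measurable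

lemma logistic'_measurable[measurable]: "logistic' \<in> borel_measurable borel"
  unfolding logistic'_def[abs_def] by measurable

section \<open>Uniform linearization of logistic scores for square-integrable features\<close>

locale feature_samples = samples M J z P n N \<eta>
  for M :: "'w measure" and J and z :: "nat \<Rightarrow> nat \<Rightarrow> 'w \<Rightarrow> 'a::topological_space"
    and P n N \<eta> +
  fixes \<phi> :: "'a \<Rightarrow> 'e::euclidean_space"
  assumes \<phi>_measurable[measurable]: "\<phi> \<in> borel_measurable borel"
    and \<phi>_square_integrable: "j \<in> J \<Longrightarrow> integrable (P j) (\<lambda>y. (norm (\<phi> y))\<^sup>2)"
begin

text \<open>The Fisher information matrix of logistic regression at \<open>b\<close>, under the law
  of sample \<open>j\<close>, applied to \<open>c\<close>.\<close>

definition info :: "nat \<Rightarrow> 'e \<Rightarrow> 'e \<Rightarrow> 'e" where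
  "info j b c = (\<integral>y. (logistic' (b \<bullet> \<phi> y) * (c \<bullet> \<phi> y)) *\<^sub>R \<phi> y \<partial>P j)"

definition score :: "nat \<Rightarrow> 'e \<Rightarrow> 'e \<Rightarrow> nat \<times> 'w \<Rightarrow> real" where
  "score j b c p = emp j (\<lambda>y. logistic (b \<bullet> \<phi> y) * (c \<bullet> \<phi> y)) p"

lemma integrable_dominated_\<phi>:
  fixes g :: "'a \<Rightarrow> 'b::{banach, second_countable_topology}"
  assumes "j \<in> J" "g \<in> borel_measurable borel" "\<And>y. norm (g y) \<le> K * (norm (\<phi> y))\<^sup>2"
  shows "integrable (P j) g"
  by (rule Bochner_Integration.integrable_bound[OF integrable_mult_right[OF \<phi>_square_integrable[OF assms(1)], of K]])
    (use assms in \<open>auto simp: measurable_P intro: order_trans[OF _ abs_ge_self]\<close>)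

lemma inner_\<phi>_le: "\<bar>c \<bullet> \<phi> y\<bar> \<le> norm c * norm (\<phi> y)" by (rule Cauchy_Schwarz_ineq2)

lemma info_bound: "norm ((logistic' (b \<bullet> \<phi> y) * (c \<bullet> \<phi> y)) *\<^sub>R \<phi> y) \<le> norm c * (norm (\<phi> y))\<^sup>2"
proof -
  have "logistic' (b \<bullet> \<phi> y) * (\<bar>c \<bullet> \<phi> y\<bar> * norm (\<phi> y)) \<le> 1 * ((norm c * norm (\<phi> y)) * norm (\<phi> y))"
    using logistic'_bounds[of "b \<bullet> \<phi> y"] inner_\<phi>_le[of c y] by (intro mult_mono mult_right_mono) auto
  then show ?thesis using logistic'_bounds(1)[of "b \<bullet> \<phi> y"] by (simp add: abs_mult power2_eq_square mult_ac)
qed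

lemma info_integrable:
  assumes "j \<in> J"
  shows "integrable (P j) (\<lambda>y. (logistic' (b \<bullet> \<phi> y) * (c \<bullet> \<phi> y)) *\<^sub>R \<phi> y)"
  by (rule integrable_dominated_\<phi>[OF assms _ info_bound]) measurable

lemma info_inner_integrable:
  assumes "j \<in> J"
  shows "integrable (P j) (\<lambda>y. logistic' (b \<bullet> \<phi> y) * (c \<bullet> \<phi> y) * (d \<bullet> \<phi> y))"
  using integrable_inner_left[OF info_integrable[OF assms, of b c], of d] by (simp add: inner_commute)

lemma info_inner:
  assumes "j \<in> J"
  shows "info j b c \<bullet> d = (\<integral>y. logistic' (b \<bullet> \<phi> y) * (c \<bullet> \<phi> y) * (d \<bullet> \<phi> y) \<partial>P j)"
  unfolding info_def using integral_inner_left[OF info_integrable[OF assms, of b c], of d]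
  by (simp add: inner_commute)

text \<open>The radius \<open>r p\<close> is random and cannot enter the law of large numbers. It is
  replaced by a fixed \<open>s\<close>, so small by dominated convergence that the limiting mean is
  already below \<open>e\<close>; monotonicity in the radius does the rest.\<close>

lemma emp_\<phi>_remainder:
  assumes j: "j \<in> J" and r: "(r \<longlongrightarrow> 0) (wp1 M)"
  shows "((\<lambda>p. emp j (\<lambda>y. (norm (\<phi> y))\<^sup>2 * min 1 (\<bar>r p\<bar> * norm (\<phi> y))) p) \<longlongrightarrow> 0) (wp1 M)"
proof (rule order_tendstoI)
  note [simp] = measurable_P[OF j]
  fix e :: real assume "0 < e"
  define H where "H s = (\<integral>y. (norm (\<phi> y))\<^sup>2 * min 1 (s * norm (\<phi> y)) \<partial>P j)" for s
  have "(\<lambda>m. H (1 / Suc m)) \<longlonglongrightarrow> (\<integral>y. 0 \<partial>P j)"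
    unfolding H_def
  proof (rule integral_dominated_convergence[where w = "\<lambda>y. (norm (\<phi> y))\<^sup>2"])
    have "(\<lambda>m. (norm (\<phi> y))\<^sup>2 * min 1 (1 / real (Suc m) * norm (\<phi> y))) \<longlonglongrightarrow> (norm (\<phi> y))\<^sup>2 * min 1 (0 * norm (\<phi> y))" for y
      by (intro tendsto_intros LIMSEQ_Suc[OF lim_1_over_n])
    then show "AE y in P j. (\<lambda>m. (norm (\<phi> y))\<^sup>2 * min 1 (1 / real (Suc m) * norm (\<phi> y))) \<longlonglongrightarrow> 0" by simp
  qed (use \<phi>_square_integrable[OF j] in \<open>auto simp: abs_mult intro!: mult_left_le\<close>)
  then have "(\<lambda>m. \<eta> j * H (1 / Suc m)) \<longlonglongrightarrow> 0" using tendsto_mult_right_zero by fastforce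
  then have "\<forall>\<^sub>F m in sequentially. \<eta> j * H (1 / Suc m) < e"
    using \<open>0 < e\<close> by (rule order_tendstoD(2))
  then obtain m where m: "\<eta> j * H (1 / Suc m) < e" by (auto simp: eventually_sequentially)
  define s where "s = 1 / real (Suc m)"
  have "s > 0" by (simp add: s_def)
  have "integrable (P j) (\<lambda>y. (norm (\<phi> y))\<^sup>2 * min 1 (s * norm (\<phi> y)))"
    by (rule integrable_dominated_\<phi>[OF j, of _ 1]) (use \<open>s > 0\<close> in \<open>auto simp: abs_mult intro!: mult_left_le\<close>)
  from weak_law[OF j _ this] m
  have "\<forall>\<^sub>F p in wp1 M. emp j (\<lambda>y. (norm (\<phi> y))\<^sup>2 * min 1 (s * norm (\<phi> y))) p < e"
    by (auto simp: H_def s_def intro: order_tendstoD(2))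
  moreover have "\<forall>\<^sub>F p in wp1 M. \<bar>r p\<bar> < s" using tendstoD[OF r \<open>s > 0\<close>] by simp
  ultimately show "\<forall>\<^sub>F p in wp1 M. emp j (\<lambda>y. (norm (\<phi> y))\<^sup>2 * min 1 (\<bar>r p\<bar> * norm (\<phi> y))) p < e"
  proof eventually_elim
    case (elim p)
    have "emp j (\<lambda>y. (norm (\<phi> y))\<^sup>2 * min 1 (\<bar>r p\<bar> * norm (\<phi> y))) p \<le> emp j (\<lambda>y. (norm (\<phi> y))\<^sup>2 * min 1 (s * norm (\<phi> y))) p"
      using elim(2) by (intro emp_mono mult_left_mono min.mono mult_right_mono) auto
    with elim(1) show ?case by linarith
  qed
next
  fix e :: real assume "e < 0"
  have "0 \<le> emp j (\<lambda>y. (norm (\<phi> y))\<^sup>2 * min 1 (\<bar>r p\<bar> * norm (\<phi> y))) p" for p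
    unfolding emp_def by (intro divide_nonneg_nonneg sum_nonneg mult_nonneg_nonneg) auto
  with \<open>e < 0\<close> show "\<forall>\<^sub>F p in wp1 M. e < emp j (\<lambda>y. (norm (\<phi> y))\<^sup>2 * min 1 (\<bar>r p\<bar> * norm (\<phi> y))) p"
    by (auto intro!: always_eventually intro: less_le_trans)
qed

lemma emp_sum: "emp j (\<lambda>y. \<Sum>i\<in>I. g i y) p = (\<Sum>i\<in>I. emp j (g i) p)"
  unfolding emp_def by (subst sum.swap) (simp add: sum_divide_distrib)

text \<open>\<open>Y1\<close> collects the law of large numbers for the information along each basis
  vector, \<open>Y2\<close> the Taylor remainder. Because the error is a factor tending to zero
  times \<open>norm (b p - b' p)\<close>, it stays negligible after multiplication by root N
  whenever that scaled difference is tight.\<close>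

lemma score_expansion:
  assumes j: "j \<in> J" and lim: "(b \<longlongrightarrow> b0) (wp1 M)" "(b' \<longlongrightarrow> b0) (wp1 M)"
  obtains Y where "(Y \<longlongrightarrow> 0) (wp1 M)"
    "\<And>p. \<bar>score j (b p) c p - score j (b' p) c p - \<eta> j * (info j b0 c \<bullet> (b p - b' p))\<bar> \<le> Y p * norm (b p - b' p)"
proof -
  define W where "W d p = emp j (\<lambda>y. logistic' (b0 \<bullet> \<phi> y) * (c \<bullet> \<phi> y) * (d \<bullet> \<phi> y)) p" for d p
  define Y1 where "Y1 p = (\<Sum>i\<in>Basis. \<bar>W i p - \<eta> j * (info j b0 c \<bullet> i)\<bar>)" for p
  define r where "r p = norm (b p - b0) + norm (b' p - b0)" for p
  define Y2 where "Y2 p = norm c * emp j (\<lambda>y. (norm (\<phi> y))\<^sup>2 * min 1 (\<bar>r p\<bar> * norm (\<phi> y))) p" for p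
  have W_lim: "(W d \<longlongrightarrow> \<eta> j * (info j b0 c \<bullet> d)) (wp1 M)" for d
    unfolding W_def info_inner[OF j] by (rule weak_law[OF j _ info_inner_integrable[OF j]]) measurable
  have "(Y1 \<longlongrightarrow> (\<Sum>i\<in>Basis. \<bar>\<eta> j * (info j b0 c \<bullet> i) - \<eta> j * (info j b0 c \<bullet> i)\<bar>)) (wp1 M)"
    unfolding Y1_def[abs_def] by (intro tendsto_intros W_lim)
  then have Y1: "(Y1 \<longlongrightarrow> 0) (wp1 M)" by simp
  have "((\<lambda>p. norm (b p - b0) + norm (b' p - b0)) \<longlongrightarrow> norm (b0 - b0) + norm (b0 - b0)) (wp1 M)"
    by (intro tendsto_intros lim)
  then have "(r \<longlongrightarrow> 0) (wp1 M)" by (simp add: r_def[abs_def])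
  then have "((\<lambda>p. Y2 p) \<longlongrightarrow> norm c * 0) (wp1 M)"
    unfolding Y2_def by (intro tendsto_intros emp_\<phi>_remainder j)
  then have Y: "((\<lambda>p. Y1 p + Y2 p) \<longlongrightarrow> 0) (wp1 M)" using tendsto_add_zero[OF Y1] by simp
  moreover have "\<bar>score j (b p) c p - score j (b' p) c p - \<eta> j * (info j b0 c \<bullet> (b p - b' p))\<bar> \<le> (Y1 p + Y2 p) * norm (b p - b' p)" for p
  proof -
    define d where "d = b p - b' p"
    have "W d p = (\<Sum>i\<in>Basis. (d \<bullet> i) * W i p)"
    proof -
      have "d \<bullet> \<phi> y = (\<Sum>i\<in>Basis. (d \<bullet> i) * (i \<bullet> \<phi> y))" for y
        by (subst euclidean_inner) (simp add: inner_commute)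
      then have "W d p = emp j (\<lambda>y. \<Sum>i\<in>Basis. (d \<bullet> i) * (logistic' (b0 \<bullet> \<phi> y) * (c \<bullet> \<phi> y) * (i \<bullet> \<phi> y))) p"
        by (simp add: W_def sum_distrib_left mult_ac)
      then show ?thesis unfolding emp_sum emp_cmult W_def .
    qed
    moreover have "info j b0 c \<bullet> d = (\<Sum>i\<in>Basis. (d \<bullet> i) * (info j b0 c \<bullet> i))"
      by (subst euclidean_inner) (simp add: mult.commute)
    ultimately have "W d p - \<eta> j * (info j b0 c \<bullet> d) = (\<Sum>i\<in>Basis. (d \<bullet> i) * (W i p - \<eta> j * (info j b0 c \<bullet> i)))"
      by (simp add: sum_distrib_left sum_subtractf[symmetric] algebra_simps)
    also have "\<bar>\<dots>\<bar> \<le> (\<Sum>i\<in>Basis. \<bar>W i p - \<eta> j * (info j b0 c \<bullet> i)\<bar> * norm d)"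
      by (rule order_trans[OF sum_abs sum_mono])
        (auto simp: abs_mult mult.commute intro!: mult_right_mono Basis_le_norm)
    finally have 1: "\<bar>W d p - \<eta> j * (info j b0 c \<bullet> d)\<bar> \<le> Y1 p * norm d"
      by (simp add: Y1_def sum_distrib_right)
    have "\<bar>logistic (b p \<bullet> \<phi> y) * (c \<bullet> \<phi> y) - logistic (b' p \<bullet> \<phi> y) * (c \<bullet> \<phi> y) - logistic' (b0 \<bullet> \<phi> y) * (c \<bullet> \<phi> y) * (d \<bullet> \<phi> y)\<bar>
        \<le> (norm c * norm d) * ((norm (\<phi> y))\<^sup>2 * min 1 (\<bar>r p\<bar> * norm (\<phi> y)))" for y
    proof -
      have "\<bar>b p \<bullet> \<phi> y - b0 \<bullet> \<phi> y\<bar> + \<bar>b' p \<bullet> \<phi> y - b0 \<bullet> \<phi> y\<bar> \<le> \<bar>r p\<bar> * norm (\<phi> y)"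
        using inner_\<phi>_le[of "b p - b0" y] inner_\<phi>_le[of "b' p - b0" y]
        by (simp add: r_def inner_diff_left distrib_right)
      then have m: "min 1 (\<bar>b p \<bullet> \<phi> y - b0 \<bullet> \<phi> y\<bar> + \<bar>b' p \<bullet> \<phi> y - b0 \<bullet> \<phi> y\<bar>) \<le> min 1 (\<bar>r p\<bar> * norm (\<phi> y))"
        by linarith
      have dd: "\<bar>b p \<bullet> \<phi> y - b' p \<bullet> \<phi> y\<bar> \<le> norm d * norm (\<phi> y)"
        using inner_\<phi>_le[of d y] by (simp add: d_def inner_diff_left)
      have "\<bar>logistic (b p \<bullet> \<phi> y) - logistic (b' p \<bullet> \<phi> y) - logistic' (b0 \<bullet> \<phi> y) * (b p \<bullet> \<phi> y - b' p \<bullet> \<phi> y)\<bar> 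
          \<le> min 1 (\<bar>r p\<bar> * norm (\<phi> y)) * (norm d * norm (\<phi> y))"
        by (rule order_trans[OF logistic_Taylor]) (use m dd in \<open>auto intro!: mult_mono\<close>)
      then have "\<bar>logistic (b p \<bullet> \<phi> y) - logistic (b' p \<bullet> \<phi> y) - logistic' (b0 \<bullet> \<phi> y) * (b p \<bullet> \<phi> y - b' p \<bullet> \<phi> y)\<bar> * \<bar>c \<bullet> \<phi> y\<bar>
          \<le> min 1 (\<bar>r p\<bar> * norm (\<phi> y)) * (norm d * norm (\<phi> y)) * (norm c * norm (\<phi> y))"
        by (intro mult_mono inner_\<phi>_le) auto
      then show ?thesis
        by (simp add: abs_mult[symmetric] d_def inner_diff_left power2_eq_square algebra_simps)
    qed
    then have "\<bar>score j (b p) c p - score j (b' p) c p - W d p\<bar> \<le> emp j (\<lambda>y. (norm c * norm d) * ((norm (\<phi> y))\<^sup>2 * min 1 (\<bar>r p\<bar> * norm (\<phi> y)))) p"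
      unfolding score_def W_def emp_diff[symmetric] by (intro order_trans[OF emp_abs] emp_mono)
    then have 2: "\<bar>score j (b p) c p - score j (b' p) c p - W d p\<bar> \<le> Y2 p * norm d"
      unfolding emp_cmult by (simp add: Y2_def mult_ac)
    from 1 2 show ?thesis unfolding d_def[symmetric] distrib_right by linarith
  qed
  ultimately show ?thesis by (rule that)
qed

lemma score_consistent:
  assumes j: "j \<in> J" and lim: "(b \<longlongrightarrow> b0) (wp1 M)"
  shows "((\<lambda>p. score j (b p) c p) \<longlongrightarrow> \<eta> j * (\<integral>y. logistic (b0 \<bullet> \<phi> y) * (c \<bullet> \<phi> y) \<partial>P j)) (wp1 M)"
proof -
  obtain Y where Y: "(Y \<longlongrightarrow> 0) (wp1 M)"
    "\<And>p. \<bar>score j (b p) c p - score j b0 c p - \<eta> j * (info j b0 c \<bullet> (b p - b0))\<bar> \<le> Y p * norm (b p - b0)"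
    using score_expansion[OF j lim tendsto_const, of c] by blast
  have "((\<lambda>p. norm (b p - b0)) \<longlongrightarrow> norm (b0 - b0)) (wp1 M)" by (intro tendsto_intros lim)
  then have n0: "((\<lambda>p. norm (b p - b0)) \<longlongrightarrow> 0) (wp1 M)" by simp
  have "((\<lambda>p. Y p * norm (b p - b0)) \<longlongrightarrow> 0) (wp1 M)" using tendsto_mult[OF Y(1) n0] by simp
  then have 1: "((\<lambda>p. score j (b p) c p - score j b0 c p - \<eta> j * (info j b0 c \<bullet> (b p - b0))) \<longlongrightarrow> 0) (wp1 M)"
    by (rule Lim_null_comparison[rotated]) (use Y(2) in simp)
  have 2: "((\<lambda>p. \<eta> j * (info j b0 c \<bullet> (b p - b0))) \<longlongrightarrow> \<eta> j * (info j b0 c \<bullet> (b0 - b0))) (wp1 M)"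
    by (intro tendsto_intros lim)
  have sq: "integrable (P j) (\<lambda>y. (logistic (b0 \<bullet> \<phi> y) * (c \<bullet> \<phi> y))\<^sup>2)"
  proof (rule integrable_dominated_\<phi>[OF j, of _ "(norm c)\<^sup>2"])
    fix y
    have "\<bar>logistic (b0 \<bullet> \<phi> y) * (c \<bullet> \<phi> y)\<bar> \<le> 1 * (norm c * norm (\<phi> y))"
      unfolding abs_mult using logistic_bounds[of "b0 \<bullet> \<phi> y"] inner_\<phi>_le[of c y] by (intro mult_mono) auto
    then show "norm ((logistic (b0 \<bullet> \<phi> y) * (c \<bullet> \<phi> y))\<^sup>2) \<le> (norm c)\<^sup>2 * (norm (\<phi> y))\<^sup>2"
      using power_mono[OF _ abs_ge_zero, of _ _ 2] by (fastforce simp: power_mult_distrib)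
  qed measurable
  have "integrable (P j) (\<lambda>y. logistic (b0 \<bullet> \<phi> y) * (c \<bullet> \<phi> y))"
    by (rule square_integrable_P[OF j _ sq]) measurable
  then have 3: "((\<lambda>p. score j b0 c p) \<longlongrightarrow> \<eta> j * (\<integral>y. logistic (b0 \<bullet> \<phi> y) * (c \<bullet> \<phi> y) \<partial>P j)) (wp1 M)"
    unfolding score_def by (rule weak_law[OF j, rotated]) measurable
  from tendsto_add[OF tendsto_add[OF 1 2] 3] show ?thesis by simp
qed

end

section \<open>First-order conditions of the two estimators\<close>

definition design :: "real ^ 'p::finite \<Rightarrow> real ^ 'p option" where
  "design y = (\<chi> i. case i of None \<Rightarrow> 1 | Some j \<Rightarrow> y $ j)"

lemma linpred_eq_inner: "linpred \<beta> y = \<beta> \<bullet> design y"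
proof -
  have "\<beta> \<bullet> design y = \<beta> $ None * 1 + (\<Sum>i\<in>range Some. \<beta> $ i * design y $ i)"
    unfolding inner_vec_def UNIV_option_conv by (subst sum.insert) (auto simp: design_def)
  also have "(\<Sum>i\<in>range Some. \<beta> $ i * design y $ i) = (\<Sum>j\<in>UNIV. \<beta> $ Some j * y $ j)"
    by (subst sum.reindex) (auto simp: design_def)
  finally show ?thesis by (simp add: linpred_def intercept_def slope_def inner_vec_def)
qed

lemma axis_None_inner_design: "axis None 1 \<bullet> design y = 1"
  by (simp add: inner_axis' design_def)

lemma norm_design_sq: "(norm (design y))\<^sup>2 = 1 + (norm y)\<^sup>2"
proof -
  have "design y \<bullet> design y = 1 + (\<Sum>i\<in>range Some. design y $ i * design y $ i)"
    unfolding inner_vec_def UNIV_option_conv by (subst sum.insert) (auto simp: design_def)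
  also have "(\<Sum>i\<in>range Some. design y $ i * design y $ i) = (\<Sum>j\<in>UNIV. y $ j * y $ j)"
    by (subst sum.reindex) (auto simp: design_def)
  finally show ?thesis by (simp add: power2_norm_eq_inner inner_vec_def)
qed

lemma design_measurable[measurable]: "design \<in> borel_measurable borel"
proof (rule borel_measurable_continuous_onI)
  show "continuous_on UNIV (design :: real ^ 'p \<Rightarrow> _)"
    unfolding design_def[abs_def]
  proof (rule continuous_on_vec_lambda)
    show "continuous_on UNIV (\<lambda>y :: real ^ 'p. case i of None \<Rightarrow> 1 | Some j \<Rightarrow> y $ j)" for i
      by (cases i) (auto intro!: continuous_intros)
  qed
qed

section \<open>Mixture densities as functions of the linear predictor\<close>

definition tilt_density :: "real \<Rightarrow> real \<Rightarrow> real" where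
  "tilt_density a t = 1 - a + a * exp t"

text \<open>The derivative of \<open>ln (tilt_density a t)\<close> in \<open>a\<close>, that is, the
  score of one observation for a mixing proportion.\<close>

definition tilt_score :: "real \<Rightarrow> real \<Rightarrow> real" where
  "tilt_score a t = (exp t - 1) / tilt_density a t"

definition logit :: "real \<Rightarrow> real" where "logit a = ln (a / (1 - a))"

lemma tilt_density_pos: "0 \<le> a \<Longrightarrow> a < 1 \<Longrightarrow> 0 < tilt_density a t"
  unfolding tilt_density_def by (intro add_pos_nonneg) auto

lemma exp_logit: "0 < a \<Longrightarrow> a < 1 \<Longrightarrow> exp (logit a) = a / (1 - a)"
  unfolding logit_def by simp

text \<open>Bayes' formula: under prior probability \<open>a\<close> the posterior probability of
  the tilted component is logistic in the linear predictor, with intercept shifted by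
  \<open>logit a\<close>.\<close>

lemma logistic_logit_add:
  assumes "0 < a" "a < 1"
  shows "logistic (t + logit a) = a * exp t / tilt_density a t"
proof -
  have "1 + exp t * (a / (1 - a)) = tilt_density a t / (1 - a)"
    using assms by (simp add: tilt_density_def field_simps)
  then show ?thesis
    using assms by (simp add: logistic_def exp_add exp_logit)
qed

lemma logistic_logit: "0 < a \<Longrightarrow> a < 1 \<Longrightarrow> logistic (logit a) = a"
  using logistic_logit_add[of a 0] by (simp add: tilt_density_def)

text \<open>The bridge between the parametrizations: up to an affine change, the score for a
  proportion is the logistic score in the intercept direction. Root equations for proportions become
  score equations to which the logistic expansion applies.\<close>

lemma logistic_tilt_score:
  assumes "0 < a" "a < 1"
  shows "logistic (t + logit a) = a + a * (1 - a) * tilt_score a t"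
  using tilt_density_pos[of a t] assms
  unfolding logistic_logit_add[OF assms] tilt_score_def
  by (simp add: field_simps) (simp add: tilt_density_def algebra_simps)

lemma tilt_score_diff:
  assumes "0 < a" "a < 1" "0 < b" "b < 1"
  shows "tilt_score a t - tilt_score b t = (b - a) * (exp t - 1)\<^sup>2 / (tilt_density a t * tilt_density b t)"
  using tilt_density_pos[of a t] tilt_density_pos[of b t] assms
  unfolding tilt_score_def by (simp add: field_simps) (simp add: tilt_density_def algebra_simps power2_eq_square)

lemma tilt_score_antimono:
  assumes "0 < a" "a \<le> b" "b < 1"
  shows "tilt_score b t \<le> tilt_score a t"
proof -
  have "0 \<le> (b - a) * (exp t - 1)\<^sup>2 / (tilt_density a t * tilt_density b t)"
    using assms tilt_density_pos[of a t] tilt_density_pos[of b t]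
    by (intro divide_nonneg_nonneg mult_nonneg_nonneg) auto
  then show ?thesis using tilt_score_diff[of a b t] assms by linarith
qed

lemma tilt_score_strict_antimono:
  assumes "0 < a" "a < b" "b < 1" "t \<noteq> 0"
  shows "tilt_score b t < tilt_score a t"
proof -
  have "0 < (b - a) * (exp t - 1)\<^sup>2 / (tilt_density a t * tilt_density b t)"
    using assms tilt_density_pos[of a t] tilt_density_pos[of b t]
    by (intro divide_pos_pos mult_pos_pos) auto
  then show ?thesis using tilt_score_diff[of a b t] assms by linarith
qed

text \<open>Concavity of \<open>\<alpha> \<mapsto> ln (1 - \<alpha> + \<alpha> e\<^sup>t)\<close> in the form of its tangent line.\<close>

lemma ln_tilt_density_tangent:
  assumes "0 < a" "a < 1" "0 < b" "b < 1"
  shows "ln (tilt_density b t) \<le> ln (tilt_density a t) + (b - a) * tilt_score a t"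
proof -
  have pos: "tilt_density a t > 0" "tilt_density b t > 0" using assms by (auto intro: tilt_density_pos)
  have "ln (tilt_density b t / tilt_density a t) \<le> tilt_density b t / tilt_density a t - 1"
    using pos by (intro ln_le_minus_one) auto
  also have "\<dots> = (b - a) * tilt_score a t"
    using pos by (simp add: tilt_score_def field_simps) (simp add: tilt_density_def algebra_simps)
  finally show ?thesis using pos by (simp add: ln_div)
qed

text \<open>The unnormalized criterion for interior \<open>\<rho>\<close> and
  \<open>\<alpha>\<close>, where the logarithm of the quotient splits. The two proportions then
  occur in different sums, so at fixed \<open>\<beta>\<close> optimizing over one does not disturb
  the other.\<close>

definition kappa_sum :: "(nat \<Rightarrow> nat) \<Rightarrow> (nat \<Rightarrow> nat \<Rightarrow> real ^ 'p::finite) \<Rightarrow>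
    real \<Rightarrow> real ^ 'p option \<Rightarrow> real \<Rightarrow> real" where
  "kappa_sum n d \<rho> \<beta> \<alpha> = (\<Sum>i<n 2. linpred \<beta> (d 2 i)) + (\<Sum>i<n 3. ln (tilt_density \<rho> (linpred \<beta> (d 3 i))))
     - (\<Sum>j = 1..3. \<Sum>i<n j. ln (tilt_density \<alpha> (linpred \<beta> (d j i))))"

lemma kappa_eq_kappa_sum:
  assumes "\<rho> \<in> {0<..<1}" "\<alpha> \<in> {0<..<1}"
  shows "kappa n d \<rho> \<beta> \<alpha> = 1 / real (total_size n) * kappa_sum n d \<rho> \<beta> \<alpha> - ln (real (total_size n))"
proof -
  have pos: "tilt_density \<rho> t > 0" "tilt_density \<alpha> t > 0" for t
    using assms by (auto intro: tilt_density_pos)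
  have s: "{1..3::nat} = {1, 2, 3}" by auto
  have "(\<Sum>j = 1..3. \<Sum>i < n j.
        ln ((1 - mixprop \<rho> j + mixprop \<rho> j * exp (linpred \<beta> (d j i))) /
            (1 - \<alpha> + \<alpha> * exp (linpred \<beta> (d j i))))) = kappa_sum n d \<rho> \<beta> \<alpha>"
    unfolding kappa_sum_def s tilt_density_def[symmetric]
    using pos[THEN less_imp_neq, THEN not_sym]
    by (simp add: mixprop_def ln_div sum_subtractf sum_negf tilt_density_def[of 0] tilt_density_def[of 1])
  then show ?thesis by (simp add: kappa_def)
qed

lemma is_MLE_le:
  assumes "is_MLE n d (\<rho>, \<beta>)" "\<rho>' \<in> {0<..<1}"
  shows "(INF \<alpha>\<in>{0<..<1}. kappa n d \<rho>' \<beta>' \<alpha>) \<le> (INF \<alpha>\<in>{0<..<1}. kappa n d \<rho> \<beta> \<alpha>)"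
proof -
  have "\<forall>\<theta>. (case \<theta> of (\<rho>, \<beta>) \<Rightarrow> \<rho> \<in> {0<..<1}) \<longrightarrow> \<not> (INF \<alpha>\<in>{0<..<1}. kappa n d \<rho> \<beta> \<alpha>)
      < (case \<theta> of (\<rho>, \<beta>) \<Rightarrow> INF \<alpha>\<in>{0<..<1}. kappa n d \<rho> \<beta> \<alpha>)"
    using assms(1) unfolding is_MLE_def is_arg_max_def by simp
  from this[rule_format, of "(\<rho>', \<beta>')"] assms(2) show ?thesis by simp
qed

lemma is_MLE_range: "is_MLE n d (\<rho>, \<beta>) \<Longrightarrow> 0 < \<rho> \<and> \<rho> < 1"
  unfolding is_MLE_def is_arg_max_def by auto

lemma DERIV_ln_tilt_density:
  assumes "0 < a" "a < 1"
  shows "((\<lambda>a. ln (tilt_density a t)) has_real_derivative tilt_score a t) (at a)"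
  using tilt_density_pos[of a t] assms unfolding tilt_density_def tilt_score_def
  by (auto intro!: derivative_eq_intros simp: divide_inverse)

text \<open>The part of the criterion containing \<open>\<rho>\<close> is free of
  \<open>\<alpha>\<close> and can be pulled out of the infimum. It is thus itself maximal at the
  estimated \<open>\<rho>\<close>, an interior point, and its derivative vanishes there.\<close>

lemma is_MLE_tilt_score_rho:
  assumes mle: "is_MLE n d (\<rho>, \<beta>)" and N: "total_size n > 0"
  shows "(\<Sum>i<n 3. tilt_score \<rho> (linpred \<beta> (d 3 i))) = 0"
proof -
  note \<rho> = is_MLE_range[OF mle]
  let ?C = "\<lambda>\<rho>. \<Sum>i<n 3. ln (tilt_density \<rho> (linpred \<beta> (d 3 i)))"
  have le: "?C \<rho>' \<le> ?C \<rho>" if \<rho>': "\<rho>' \<in> {0<..<1}" for \<rho>'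
  proof -
    have "(INF \<alpha>\<in>{0<..<1}. kappa n d \<rho> \<beta> \<alpha>) + 1 / real (total_size n) * (?C \<rho>' - ?C \<rho>)
        \<le> (INF \<alpha>\<in>{0<..<1}. kappa n d \<rho>' \<beta> \<alpha>)"
    proof (rule cINF_greatest)
      fix \<alpha> :: real assume \<alpha>: "\<alpha> \<in> {0<..<1}"
      have "(INF \<alpha>\<in>{0<..<1}. kappa n d \<rho> \<beta> \<alpha>) \<le> kappa n d \<rho> \<beta> \<alpha>"
        by (rule cINF_lower[OF kappa_bdd_below \<alpha>]) (use \<rho> in auto)
      moreover have "kappa n d \<rho>' \<beta> \<alpha> = kappa n d \<rho> \<beta> \<alpha> + 1 / real (total_size n) * (?C \<rho>' - ?C \<rho>)"
        using \<rho> \<rho>' \<alpha> by (simp add: kappa_eq_kappa_sum kappa_sum_def diff_divide_distrib add_divide_distrib)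
      ultimately show "(INF \<alpha>\<in>{0<..<1}. kappa n d \<rho> \<beta> \<alpha>) + 1 / real (total_size n) * (?C \<rho>' - ?C \<rho>) \<le> kappa n d \<rho>' \<beta> \<alpha>"
        by linarith
    qed auto
    with is_MLE_le[OF mle \<rho>', of \<beta>] have "1 / real (total_size n) * (?C \<rho>' - ?C \<rho>) \<le> 0" by linarith
    then show ?thesis using N by (simp add: divide_le_0_iff)
  qed
  show ?thesis
  proof (rule DERIV_local_max)
    show "(?C has_real_derivative (\<Sum>i<n 3. tilt_score \<rho> (linpred \<beta> (d 3 i)))) (at \<rho>)"
      using \<rho> by (intro DERIV_sum DERIV_ln_tilt_density) auto
    show "0 < min \<rho> (1 - \<rho>)" using \<rho> by simp
    show "\<forall>y. \<bar>\<rho> - y\<bar> < min \<rho> (1 - \<rho>) \<longrightarrow> ?C y \<le> ?C \<rho>"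
      using \<rho> by (auto intro!: le)
  qed
qed

text \<open>The derivative of \<open>kappa_sum\<close> in \<open>\<beta>\<close> along
  \<open>c\<close> with both proportions held fixed; the weights are the posterior probabilities of
  the tilted component.\<close>

definition beta_score :: "(nat \<Rightarrow> nat) \<Rightarrow> (nat \<Rightarrow> nat \<Rightarrow> real ^ 'p::finite) \<Rightarrow>
    real \<Rightarrow> real ^ 'p option \<Rightarrow> real \<Rightarrow> real ^ 'p option \<Rightarrow> real" where
  "beta_score n d \<rho> \<beta> \<alpha> c = (\<Sum>i<n 2. linpred c (d 2 i)) +
     (\<Sum>i<n 3. \<rho> * exp (linpred \<beta> (d 3 i)) / tilt_density \<rho> (linpred \<beta> (d 3 i)) * linpred c (d 3 i))
     - (\<Sum>j = 1..3. \<Sum>i<n j. \<alpha> * exp (linpred \<beta> (d j i)) / tilt_density \<alpha> (linpred \<beta> (d j i)) * linpred c (d j i))"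

lemma linpred_line: "linpred (\<beta> + s *\<^sub>R c) y = linpred \<beta> y + s * linpred c y"
  by (simp add: linpred_eq_inner inner_add_left)

lemma DERIV_kappa_sum:
  assumes "0 < \<rho>" "\<rho> < 1" "0 < \<alpha>" "\<alpha> < 1"
  shows "((\<lambda>s. kappa_sum n d \<rho> (\<beta> + s *\<^sub>R c) \<alpha>) has_real_derivative beta_score n d \<rho> (\<beta> + s *\<^sub>R c) \<alpha> c) (at s)"
proof -
  have D: "((\<lambda>s. ln (tilt_density a (linpred (\<beta> + s *\<^sub>R c) y))) has_real_derivative
      a * exp (linpred (\<beta> + s *\<^sub>R c) y) / tilt_density a (linpred (\<beta> + s *\<^sub>R c) y) * linpred c y) (at s)"
    if "0 < a" "a < 1" for a y
    using tilt_density_pos[of a "linpred (\<beta> + s *\<^sub>R c) y"] that unfolding tilt_density_def linpred_line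
    by (auto intro!: derivative_eq_intros simp: divide_inverse)
  have D2: "((\<lambda>s. linpred (\<beta> + s *\<^sub>R c) y) has_real_derivative linpred c y) (at s)" for y
    unfolding linpred_line by (auto intro!: derivative_eq_intros)
  show ?thesis
    unfolding kappa_sum_def beta_score_def
    by (intro DERIV_add DERIV_diff DERIV_sum D D2 assms)
qed

text \<open>Continuity is joint in the position on the line and in \<open>\<alpha>\<close>, because
  perturbing \<open>\<beta>\<close> also moves the inner minimizer.\<close>

lemma isCont_beta_score:
  assumes "0 < \<rho>" "\<rho> < 1" "0 < \<alpha>" "\<alpha> < 1"
  shows "isCont (\<lambda>q. beta_score n d \<rho> (\<beta> + fst q *\<^sub>R c) (snd q) c) (0, \<alpha>)"
proof -
  have "tilt_density \<rho> t \<noteq> 0" "tilt_density \<alpha> t \<noteq> 0" for t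
    using tilt_density_pos[of \<rho> t] tilt_density_pos[of \<alpha> t] assms by auto
  then show ?thesis
    unfolding beta_score_def linpred_line
    by (intro continuous_intros) (auto simp: tilt_density_def intro!: continuous_intros)
qed

text \<open>Minus the derivative of \<open>kappa_sum\<close> in \<open>\<alpha>\<close>; the inner
  minimizer is found as its root.\<close>

definition total_tilt_score :: "(nat \<Rightarrow> nat) \<Rightarrow> (nat \<Rightarrow> nat \<Rightarrow> real ^ 'p::finite) \<Rightarrow>
    real \<Rightarrow> real ^ 'p option \<Rightarrow> real" where
  "total_tilt_score n d a \<beta> = (\<Sum>j = 1..3. \<Sum>i<n j. tilt_score a (linpred \<beta> (d j i)))"

lemma continuous_on_total_tilt_score: "continuous_on {0<..<1} (\<lambda>a. total_tilt_score n d a \<beta>)"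
proof -
  have "tilt_density a t \<noteq> 0" if "a \<in> {0<..<1}" for a t
    using tilt_density_pos[of a t] that by auto
  then show ?thesis
    unfolding total_tilt_score_def tilt_score_def
    by (intro continuous_intros) (auto simp: tilt_density_def intro!: continuous_intros)
qed

lemma isCont_total_tilt_score_line:
  assumes "0 < a" "a < 1"
  shows "isCont (\<lambda>s. total_tilt_score n d a (\<beta> + s *\<^sub>R c)) 0"
proof -
  have "tilt_density a t \<noteq> 0" for t
    using tilt_density_pos[of a t] assms by auto
  then show ?thesis
    unfolding total_tilt_score_def tilt_score_def linpred_line
    by (intro continuous_intros) (auto simp: tilt_density_def intro!: continuous_intros)
qed

lemma total_tilt_score_root:
  assumes "0 < a" "a \<le> b" "b < 1" "0 \<le> total_tilt_score n d a \<beta>" "total_tilt_score n d b \<beta> \<le> 0"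
  obtains \<alpha> where "a \<le> \<alpha>" "\<alpha> \<le> b" "total_tilt_score n d \<alpha> \<beta> = 0"
proof -
  have "continuous_on {a..b} (\<lambda>a. total_tilt_score n d a \<beta>)"
    by (rule continuous_on_subset[OF continuous_on_total_tilt_score]) (use assms in auto)
  from IVT2'[OF assms(5,4,2) this] that show ?thesis by auto
qed

text \<open>By convexity in \<open>\<alpha>\<close> a stationary point is a global minimizer: the
  tangents at \<open>\<alpha>\<close> have total slope zero.\<close>

lemma kappa_sum_minimal:
  assumes "0 < \<alpha>" "\<alpha> < 1" "0 < a" "a < 1" "total_tilt_score n d \<alpha> \<beta> = 0"
  shows "kappa_sum n d \<rho> \<beta> \<alpha> \<le> kappa_sum n d \<rho> \<beta> a"
proof -
  have "(\<Sum>j = 1..3. \<Sum>i<n j. ln (tilt_density a (linpred \<beta> (d j i)))) \<le>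
    (\<Sum>j = 1..3. \<Sum>i<n j. ln (tilt_density \<alpha> (linpred \<beta> (d j i))) + (a - \<alpha>) * tilt_score \<alpha> (linpred \<beta> (d j i)))"
    using assms by (intro sum_mono ln_tilt_density_tangent)
  also have "\<dots> = (\<Sum>j = 1..3. \<Sum>i<n j. ln (tilt_density \<alpha> (linpred \<beta> (d j i)))) + (a - \<alpha>) * total_tilt_score n d \<alpha> \<beta>"
    by (simp add: total_tilt_score_def sum.distrib sum_distrib_left)
  finally show ?thesis using assms(5) by (simp add: kappa_sum_def)
qed

text \<open>Danskin's argument: for \<open>\<beta>\<close> near the estimator the inner minimizer stays near \<open>\<alpha>\<close>, so a nonzero
  partial derivative of \<open>\<kappa>\<close> in \<open>\<beta>\<close> at the saddle point would allow the profile to be increased.\<close>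

lemma is_MLE_beta_score_nonpos:
  fixes d :: "nat \<Rightarrow> nat \<Rightarrow> real ^ 'p::finite"
  assumes mle: "is_MLE n d (\<rho>, \<beta>)" and N: "total_size n > 0"
    and \<alpha>: "0 < \<alpha>" "\<alpha> < 1" "total_tilt_score n d \<alpha> \<beta> = 0"
    and nonzero: "j0 \<in> {1..3}" "i0 < n j0" "linpred \<beta> (d j0 i0) \<noteq> 0"
  shows "beta_score n d \<rho> \<beta> \<alpha> c \<le> 0"
proof (rule ccontr)
  note \<rho> = is_MLE_range[OF mle]
  assume "\<not> beta_score n d \<rho> \<beta> \<alpha> c \<le> 0"
  moreover have "((\<lambda>q. beta_score n d \<rho> (\<beta> + fst q *\<^sub>R c) (snd q) c) \<longlongrightarrow> beta_score n d \<rho> \<beta> \<alpha> c) (nhds (0, \<alpha>))"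
    using isCont_beta_score[of \<rho> \<alpha> n d \<beta> c] \<rho> \<alpha> by (simp add: isCont_def tendsto_nhds_iff)
  ultimately have "\<forall>\<^sub>F q in nhds (0, \<alpha>). beta_score n d \<rho> (\<beta> + fst q *\<^sub>R c) (snd q) c > 0"
    by (intro order_tendstoD(1)) auto
  then obtain e0 where e0: "e0 > 0" "\<And>q. dist q (0, \<alpha>) < e0 \<Longrightarrow> beta_score n d \<rho> (\<beta> + fst q *\<^sub>R c) (snd q) c > 0"
    by (auto simp: eventually_nhds_metric)
  \<comment> \<open>Keeps both ends \<open>\<alpha> - e\<close> and \<open>\<alpha> + e\<close>
    inside the unit interval, and two coordinate errors of size \<open>e\<close> inside the ball of
    radius \<open>e0\<close>.\<close>
  define e where "e = min (e0 / 2) (min (\<alpha> / 2) ((1 - \<alpha>) / 2))"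
  have e: "e > 0" "e \<le> e0 / 2" "e < \<alpha>" "e < 1 - \<alpha>" using e0 \<alpha> by (auto simp: e_def min_less_iff_disj)
  have G: "beta_score n d \<rho> (\<beta> + s *\<^sub>R c) a c > 0" if "\<bar>s\<bar> < e" "\<bar>a - \<alpha>\<bar> \<le> e" for s a
  proof -
    have "dist (s, a) (0, \<alpha>) \<le> \<bar>s\<bar> + \<bar>a - \<alpha>\<bar>"
      unfolding dist_Pair_Pair dist_real_def using sqrt_sum_squares_le_sum_abs[of "s - 0" "a - \<alpha>"] by simp
    then show ?thesis using e0(2)[of "(s, a)"] that e by simp
  qed
  \<comment> \<open>One nonzero linear predictor makes the total score strictly decreasing in the
    proportion. It therefore has opposite strict signs at \<open>\<alpha> - e\<close> and
    \<open>\<alpha> + e\<close>, and these signs persist under small changes of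
    \<open>\<beta>\<close>.\<close>
  have strict: "total_tilt_score n d b \<beta> < total_tilt_score n d a \<beta>" if "0 < a" "a < b" "b < 1" for a b
    unfolding total_tilt_score_def
  proof (rule sum_strict_mono_ex1)
    show "\<exists>j\<in>{1..3}. (\<Sum>i<n j. tilt_score b (linpred \<beta> (d j i))) < (\<Sum>i<n j. tilt_score a (linpred \<beta> (d j i)))"
    proof (rule bexI[OF _ nonzero(1)], rule sum_strict_mono_ex1)
      show "\<exists>i\<in>{..<n j0}. tilt_score b (linpred \<beta> (d j0 i)) < tilt_score a (linpred \<beta> (d j0 i))"
        using nonzero that by (auto intro!: bexI[of _ i0] tilt_score_strict_antimono)
    qed (use that in \<open>auto intro!: tilt_score_antimono\<close>)
  qed (use that in \<open>auto intro!: sum_mono tilt_score_antimono\<close>)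
  have "total_tilt_score n d (\<alpha> - e) \<beta> > 0" "total_tilt_score n d (\<alpha> + e) \<beta> < 0"
    using strict[of "\<alpha> - e" \<alpha>] strict[of \<alpha> "\<alpha> + e"] e \<alpha> by auto
  then have "\<forall>\<^sub>F s in nhds 0. total_tilt_score n d (\<alpha> - e) (\<beta> + s *\<^sub>R c) > 0" 
     "\<forall>\<^sub>F s in nhds 0. total_tilt_score n d (\<alpha> + e) (\<beta> + s *\<^sub>R c) < 0"
    using isCont_total_tilt_score_line[of "\<alpha> - e" n d \<beta> c] isCont_total_tilt_score_line[of "\<alpha> + e" n d \<beta> c] e \<alpha>
    by (auto simp: isCont_def tendsto_nhds_iff intro: order_tendstoD)
  then obtain e1 where e1: "e1 > 0" "\<And>s. dist s 0 < e1 \<Longrightarrow> 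
      total_tilt_score n d (\<alpha> - e) (\<beta> + s *\<^sub>R c) > 0 \<and> total_tilt_score n d (\<alpha> + e) (\<beta> + s *\<^sub>R c) < 0"
    using eventually_conj unfolding eventually_nhds_metric by (smt (verit, ccfv_threshold))
  define s where "s = min (e / 2) (e1 / 2)"
  have s: "0 < s" "s < e" "s < e1" using e e1 by (auto simp: s_def min_less_iff_disj)
  have "total_tilt_score n d (\<alpha> - e) (\<beta> + s *\<^sub>R c) > 0 \<and> total_tilt_score n d (\<alpha> + e) (\<beta> + s *\<^sub>R c) < 0"
    using e1(2)[of s] s by simp
  then obtain a where a: "\<alpha> - e \<le> a" "a \<le> \<alpha> + e" "total_tilt_score n d a (\<beta> + s *\<^sub>R c) = 0"
    using total_tilt_score_root[of "\<alpha> - e" "\<alpha> + e" n d "\<beta> + s *\<^sub>R c"] e \<alpha> by auto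
  have a01: "0 < a" "a < 1" using a e \<alpha> by auto
  \<comment> \<open>The root \<open>a\<close> belonging to the moved \<open>\<beta>\<close> is held
    fixed in both values. The infimum at \<open>\<beta>\<close> is at most the value at
    \<open>a\<close>, which is strictly below the value at \<open>a\<close> after the move, and this
    is the infimum there. That contradicts maximality.\<close>
  have "\<exists>t>0. t < s \<and> kappa_sum n d \<rho> (\<beta> + s *\<^sub>R c) a - kappa_sum n d \<rho> (\<beta> + 0 *\<^sub>R c) a
      = (s - 0) * beta_score n d \<rho> (\<beta> + t *\<^sub>R c) a c"
    by (rule MVT2) (use s DERIV_kappa_sum \<rho> a01 in auto)
  then obtain t where t: "0 < t" "t < s" "kappa_sum n d \<rho> (\<beta> + s *\<^sub>R c) a - kappa_sum n d \<rho> \<beta> a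
      = s * beta_score n d \<rho> (\<beta> + t *\<^sub>R c) a c" by auto
  have "beta_score n d \<rho> (\<beta> + t *\<^sub>R c) a c > 0" using t s a by (intro G) auto
  with t s have "kappa_sum n d \<rho> \<beta> a < kappa_sum n d \<rho> (\<beta> + s *\<^sub>R c) a"
    by (smt (verit) mult_pos_pos)
  then have "kappa n d \<rho> \<beta> a < kappa n d \<rho> (\<beta> + s *\<^sub>R c) a"
    using N \<rho> a01 by (simp add: kappa_eq_kappa_sum divide_strict_right_mono)
  moreover have "(INF \<alpha>\<in>{0<..<1}. kappa n d \<rho> \<beta> \<alpha>) \<le> kappa n d \<rho> \<beta> a"
    by (rule cINF_lower[OF kappa_bdd_below]) (use \<rho> a01 in auto)
  moreover have "kappa n d \<rho> (\<beta> + s *\<^sub>R c) a \<le> (INF \<alpha>\<in>{0<..<1}. kappa n d \<rho> (\<beta> + s *\<^sub>R c) \<alpha>)"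
  proof (rule cINF_greatest)
    fix b :: real assume "b \<in> {0<..<1}"
    then show "kappa n d \<rho> (\<beta> + s *\<^sub>R c) a \<le> kappa n d \<rho> (\<beta> + s *\<^sub>R c) b"
      using kappa_sum_minimal[OF a01 _ _ a(3), of b \<rho>] \<rho> a01
      by (simp add: kappa_eq_kappa_sum divide_right_mono)
  qed auto
  moreover have "(INF \<alpha>\<in>{0<..<1}. kappa n d \<rho> (\<beta> + s *\<^sub>R c) \<alpha>) \<le> (INF \<alpha>\<in>{0<..<1}. kappa n d \<rho> \<beta> \<alpha>)"
    by (rule is_MLE_le[OF mle]) (use \<rho> in auto)
  ultimately show False by linarith
qed

lemma beta_score_minus: "beta_score n d \<rho> \<beta> \<alpha> (- c) = - beta_score n d \<rho> \<beta> \<alpha> c"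
  by (simp add: beta_score_def linpred_eq_inner sum_negf)

lemma is_MLE_beta_score:
  fixes d :: "nat \<Rightarrow> nat \<Rightarrow> real ^ 'p::finite"
  assumes "is_MLE n d (\<rho>, \<beta>)" "total_size n > 0"
    "0 < \<alpha>" "\<alpha> < 1" "total_tilt_score n d \<alpha> \<beta> = 0"
    "j0 \<in> {1..3}" "i0 < n j0" "linpred \<beta> (d j0 i0) \<noteq> 0"
  shows "beta_score n d \<rho> \<beta> \<alpha> c = 0"
  using is_MLE_beta_score_nonpos[where c = c, OF assms] is_MLE_beta_score_nonpos[where c = "- c", OF assms]
  unfolding beta_score_minus by simp

lemma labeled_estimator_stationary:
  fixes d :: "nat \<Rightarrow> nat \<Rightarrow> real ^ 'p::finite"
  assumes "is_labeled_estimator n d \<beta>" "n 1 > 0" "n 2 > 0"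
  defines "b \<equiv> \<beta> + ln (real (n 2) / real (n 1)) *\<^sub>R axis None 1"
  shows "(\<Sum>i<n 2. linpred c (d 2 i)) - (\<Sum>i<n 1. logistic (linpred b (d 1 i)) * linpred c (d 1 i))
    - (\<Sum>i<n 2. logistic (linpred b (d 2 i)) * linpred c (d 2 i)) = 0"
proof -
  have b: "shift_intercept (ln (real (n 2) / real (n 1))) \<beta> = b"
    by (simp add: b_def shift_intercept_def axis_def vec_eq_iff)
  have max: "logistic_loglik n d b' \<le> logistic_loglik n d b" for b'
    using assms(1) is_labeled_estimator_iff_logistic[OF assms(2,3), of d \<beta>] unfolding b
    by (auto simp: is_arg_max_def not_less)
  have eq: "logistic_loglik n d b = (\<Sum>i<n 2. linpred b (d 2 i)) - (\<Sum>i<n 1. ln (1 + exp (linpred b (d 1 i))))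
     - (\<Sum>i<n 2. ln (1 + exp (linpred b (d 2 i))))" for b
    unfolding logistic_loglik_def using one_plus_exp_pos by (simp add: ln_div sum_subtractf sum_negf)
  have D: "((\<lambda>s. ln (1 + exp (linpred (b + s *\<^sub>R c) y))) has_real_derivative
      logistic (linpred b y) * linpred c y) (at 0)" for y
    using one_plus_exp_pos[of "linpred b y"] unfolding linpred_line logistic_def
    by (auto intro!: derivative_eq_intros simp: divide_inverse)
  have D2: "((\<lambda>s. linpred (b + s *\<^sub>R c) y) has_real_derivative linpred c y) (at 0)" for y
    unfolding linpred_line by (auto intro!: derivative_eq_intros)
  show ?thesis
  proof (rule DERIV_local_max)
    show "((\<lambda>s. logistic_loglik n d (b + s *\<^sub>R c)) has_real_derivative ((\<Sum>i<n 2. linpred c (d 2 i)) - (\<Sum>i<n 1. logistic (linpred b (d 1 i)) * linpred c (d 1 i))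
    - (\<Sum>i<n 2. logistic (linpred b (d 2 i)) * linpred c (d 2 i)))) (at 0)"
      unfolding eq by (intro DERIV_add DERIV_diff DERIV_sum D D2)
    show "0 < (1::real)" by simp
  qed (use max in simp)
qed

section \<open>Identification of asymptotic variances\<close>

lemma integral_cos_normal_law:
  assumes "v \<ge> 0"
  shows "(\<integral>x. cos x \<partial>normal_law v) = exp (- v / 2)"
proof (cases "v = 0")
  case True
  then show ?thesis by (simp add: normal_law_def integral_return)
next
  case False
  define \<sigma> where "\<sigma> = sqrt v"
  have \<sigma>: "\<sigma> > 0" "\<sigma>\<^sup>2 = v" using assms False by (auto simp: \<sigma>_def)
  define D where "D = density lborel (normal_density 0 \<sigma>)"
  interpret D: prob_space D unfolding D_def by (rule prob_space_normal_density[OF \<sigma>(1)])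
  have s[measurable_cong]: "sets D = sets borel" by (simp add: D_def)
  have "distributed D lborel (\<lambda>x. x) (normal_density 0 \<sigma>)"
    unfolding distributed_def by (auto simp: D_def distr_id2)
  then have "distributed D lborel (\<lambda>x. (x - 0) / \<sigma>) std_normal_density"
    by (rule D.normal_standard_normal_convert[OF \<sigma>(1), THEN iffD1])
  then have std: "distr D lborel (\<lambda>x. x / \<sigma>) = std_normal_distribution"
    unfolding distributed_def by simp
  have "complex_of_real (exp (- (\<sigma>\<^sup>2) / 2)) = char std_normal_distribution \<sigma>"
    by (simp add: char_std_normal_distribution)
  also have "\<dots> = (CLINT x|D. iexp (\<sigma> * (x / \<sigma>)))"
    unfolding char_def std[symmetric] by (subst integral_distr) auto
  also have "\<dots> = (CLINT x|D. iexp x)" using \<sigma> by simp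
  finally have "exp (- v / 2) = Re (CLINT x|D. iexp x)"
    using \<sigma> by (metis Re_complex_of_real)
  also have "\<dots> = (\<integral>x. Re (iexp x) \<partial>D)"
    by (rule integral_Re[symmetric]) (rule D.integrable_iexp, simp_all)
  also have "\<dots> = (\<integral>x. cos x \<partial>D)" by (simp add: cis_conv_exp[symmetric])
  finally show ?thesis using False by (simp add: normal_law_def D_def \<sigma>_def)
qed

lemma mvnormal_integral_cos:
  assumes "mvnormal V \<mu>"
  shows "(\<integral>y. cos (c \<bullet> y) \<partial>\<mu>) = exp (- (c \<bullet> (V *v c)) / 2)"
proof -
  have [measurable_cong]: "sets \<mu> = sets borel" and d: "distr \<mu> borel (\<lambda>y. c \<bullet> y) = normal_law (c \<bullet> (V *v c))"
    and p: "0 \<le> c \<bullet> (V *v c)"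
    using assms by (auto simp: mvnormal_def psd_def)
  have "(\<integral>y. cos (c \<bullet> y) \<partial>\<mu>) = (\<integral>x. cos x \<partial>distr \<mu> borel (\<lambda>y. c \<bullet> y))"
    by (subst integral_distr) auto
  then show ?thesis unfolding d using integral_cos_normal_law[OF p] by simp
qed

context prob_space
begin

text \<open>\<open>f m\<close> is bounded and continuous and equals 1 exactly where the norm is at
  least \<open>Suc m\<close>. Its integral under the limit law is small for large \<open>m\<close>,
  and Markov's inequality at level 1 turns this into a tail bound for \<open>X k\<close>.\<close>

lemma bounded_in_prob_converges_in_distribution:
  fixes X :: "nat \<Rightarrow> 'a \<Rightarrow> 'b::euclidean_space"
  assumes conv: "converges_in_distribution M X \<mu>" and \<mu>: "prob_space \<mu>" "sets \<mu> = sets borel"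
    and [measurable]: "\<And>k. X k \<in> borel_measurable M"
  shows "bounded_in_prob M (\<lambda>p. norm (X (fst p) (snd p)))"
proof (rule bounded_in_probI)
  interpret \<mu>: prob_space \<mu> by (rule \<mu>(1))
  note [measurable_cong] = \<mu>(2)
  fix \<delta> :: real assume "\<delta> > 0"
  define f where "f m y = min 1 (norm (y :: 'b) / real (Suc m))" for m y
  have f01: "0 \<le> f m y" "f m y \<le> 1" for m y by (auto simp: f_def)
  have f_cont: "continuous_on UNIV (f m)" for m unfolding f_def by (intro continuous_intros) auto
  have [measurable]: "f m \<in> borel_measurable borel" for m
    using f_cont by (rule borel_measurable_continuous_onI)
  have "(\<lambda>m. \<integral>y. f m y \<partial>\<mu>) \<longlonglongrightarrow> (\<integral>y. 0 \<partial>\<mu>)"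
  proof (rule integral_dominated_convergence[where w = "\<lambda>_. 1"])
    have "(\<lambda>m. min 1 (norm y * (1 / real (Suc m)))) \<longlonglongrightarrow> min 1 (norm y * 0)" for y :: 'b
      by (intro tendsto_intros LIMSEQ_Suc[OF lim_1_over_n])
    then show "AE y in \<mu>. (\<lambda>m. f m y) \<longlonglongrightarrow> 0" by (simp add: f_def)
  qed (use f01 in auto)
  then have "\<forall>\<^sub>F m in sequentially. (\<integral>y. f m y \<partial>\<mu>) < \<delta>" using \<open>\<delta> > 0\<close> by (auto dest: order_tendstoD(2))
  then obtain m where m: "(\<integral>y. f m y \<partial>\<mu>) < \<delta>" by (auto simp: eventually_sequentially)
  have "bounded (range (f m))" using f01 by (auto simp: bounded_iff intro!: exI[of _ 1])
  with conv f_cont have "(\<lambda>k. expectation (\<lambda>\<omega>. f m (X k \<omega>))) \<longlonglongrightarrow> (\<integral>y. f m y \<partial>\<mu>)"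
    unfolding converges_in_distribution_def by blast
  then have "\<forall>\<^sub>F k in sequentially. expectation (\<lambda>\<omega>. f m (X k \<omega>)) < \<delta>" using m by (rule order_tendstoD(2))
  then have "\<forall>\<^sub>F k in sequentially. \<exists>A\<in>events. 1 - \<delta> \<le> prob A \<and> (\<forall>\<omega>\<in>A. \<bar>norm (X k \<omega>)\<bar> \<le> real (Suc m))"
  proof eventually_elim
    case (elim k)
    have int: "integrable M (\<lambda>\<omega>. f m (X k \<omega>))" by (rule integrable_const_bound[of _ 1]) (use f01 in auto)
    have "prob {\<omega>\<in>space M. 1 \<le> f m (X k \<omega>)} \<le> expectation (\<lambda>\<omega>. f m (X k \<omega>)) / 1"
      by (rule integral_Markov_inequality_measure[of M _ "{}"]) (use int f01 in auto)
    moreover have "prob (space M - {\<omega>\<in>space M. 1 \<le> f m (X k \<omega>)}) = 1 - prob {\<omega>\<in>space M. 1 \<le> f m (X k \<omega>)}"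
      by (rule prob_compl) measurable
    ultimately have "1 - \<delta> \<le> prob (space M - {\<omega>\<in>space M. 1 \<le> f m (X k \<omega>)})" using elim by simp
    then show ?case
      by (intro bexI[of _ "space M - {\<omega>\<in>space M. 1 \<le> f m (X k \<omega>)}"])
        (auto simp: f_def min_def divide_le_eq le_divide_eq split: if_splits)
  qed
  then show "\<exists>K. \<forall>\<^sub>F k in sequentially. \<exists>A\<in>events. 1 - \<delta> \<le> prob A \<and> 
      (\<forall>\<omega>\<in>A. \<bar>norm (X (fst (k, \<omega>)) (snd (k, \<omega>)))\<bar> \<le> K)" by auto
qed

lemma asymptotic_variance_bounded_in_prob:
  assumes "asymptotic_variance M N \<theta>_hat \<theta> V" "\<And>k. \<theta>_hat k \<in> borel_measurable M"
  shows "bounded_in_prob M (\<lambda>p. sqrt (real (N (fst p))) * norm (\<theta>_hat (fst p) (snd p) - \<theta>))"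
proof -
  obtain \<mu> where \<mu>: "mvnormal V \<mu>" 
      "converges_in_distribution M (\<lambda>k \<omega>. sqrt (real (N k)) *\<^sub>R (\<theta>_hat k \<omega> - \<theta>)) \<mu>"
    using assms(1) unfolding asymptotic_variance_def by blast
  have "bounded_in_prob M (\<lambda>p. norm (sqrt (real (N (fst p))) *\<^sub>R (\<theta>_hat (fst p) (snd p) - \<theta>)))"
    by (rule bounded_in_prob_converges_in_distribution[OF \<mu>(2)]) (use \<mu>(1) assms(2) in \<open>auto simp: mvnormal_def\<close>)
  then show ?thesis by simp
qed

text \<open>The cosine of a linear functional is an admissible test function, and under a centred
  normal law its integral determines the variance, as \<open>exp (- v / 2)\<close> is injective in
  \<open>v\<close>. The variance of the estimator along \<open>d\<close> can thus be computed from
  the score that linearizes it.\<close>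

lemma asymptotic_variance_eq:
  fixes \<theta> :: "real ^ 'm::finite"
  assumes av: "asymptotic_variance M N \<theta>_hat \<theta> V" and \<theta>_hat[measurable]: "\<And>k. \<theta>_hat k \<in> borel_measurable M"
    and T[measurable]: "\<And>k. T k \<in> borel_measurable M"
    and lin: "((\<lambda>(k, \<omega>). T k \<omega> - sqrt (real (N k)) * (d \<bullet> (\<theta>_hat k \<omega> - \<theta>))) \<longlongrightarrow> 0) (wp1 M)"
    and T_cos: "(\<lambda>k. expectation (\<lambda>\<omega>. cos (T k \<omega>))) \<longlonglongrightarrow> exp (- v / 2)"
  shows "d \<bullet> (V *v d) = v"
proof -
  obtain \<mu> where \<mu>: "mvnormal V \<mu>" 
      "converges_in_distribution M (\<lambda>k \<omega>. sqrt (real (N k)) *\<^sub>R (\<theta>_hat k \<omega> - \<theta>)) \<mu>"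
    using av unfolding asymptotic_variance_def by blast
  have "continuous_on UNIV (\<lambda>y. cos (d \<bullet> y))" by (intro continuous_intros)
  moreover have "bounded (range (\<lambda>y. cos (d \<bullet> y)))" by (auto simp: bounded_iff intro!: exI[of _ 1])
  ultimately have "(\<lambda>k. expectation (\<lambda>\<omega>. cos (d \<bullet> (sqrt (real (N k)) *\<^sub>R (\<theta>_hat k \<omega> - \<theta>))))) \<longlonglongrightarrow> (\<integral>y. cos (d \<bullet> y) \<partial>\<mu>)"
    using \<mu>(2) unfolding converges_in_distribution_def by (elim allE[of _ "\<lambda>y. cos (d \<bullet> y)"]) auto
  then have 1: "(\<lambda>k. expectation (\<lambda>\<omega>. cos (sqrt (real (N k)) * (d \<bullet> (\<theta>_hat k \<omega> - \<theta>))))) \<longlonglongrightarrow> exp (- (d \<bullet> (V *v d)) / 2)"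
    unfolding mvnormal_integral_cos[OF \<mu>(1)] by simp
  have "(\<lambda>k. expectation (\<lambda>\<omega>. cos (T k \<omega>)) - expectation (\<lambda>\<omega>. cos (sqrt (real (N k)) * (d \<bullet> (\<theta>_hat k \<omega> - \<theta>))))) \<longlonglongrightarrow> 0"
  proof (rule expectation_cos_Slutsky[OF _ _ lin])
    show "(\<lambda>\<omega>. sqrt (real (N k)) * (d \<bullet> (\<theta>_hat k \<omega> - \<theta>))) \<in> borel_measurable M" for k
      by measurable
  qed (rule T)
  from tendsto_add[OF this 1]
  have "(\<lambda>k. expectation (\<lambda>\<omega>. cos (T k \<omega>))) \<longlonglongrightarrow> exp (- (d \<bullet> (V *v d)) / 2)" by simp
  from LIMSEQ_unique[OF this T_cos] show ?thesis by simp
qed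

text \<open>An absorption argument: the error bound contains the unknown \<open>G\<close> itself,
  but with a factor tending to zero, so this part is absorbed by \<open>k * G\<close>. That yields
  tightness of \<open>G\<close>, after which the whole error tends to zero.\<close>

lemma bounded_in_prob_linear_root:
  assumes S: "bounded_in_prob M S" and D: "bounded_in_prob M D" and D': "bounded_in_prob M D'" and k: "k > 0"
    and Y: "(Y \<longlongrightarrow> 0) (wp1 M)"
    and le: "\<forall>\<^sub>F p in wp1 M. \<bar>S p + D p - k * G p\<bar> \<le> Y p * (D' p + \<bar>G p\<bar>)"
  shows "bounded_in_prob M G" "((\<lambda>p. S p + D p - k * G p) \<longlongrightarrow> 0) (wp1 M)"
proof -
  have abs: "bounded_in_prob M (\<lambda>p. \<bar>X p\<bar>)" if "bounded_in_prob M X" for X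
    using that by (rule bounded_in_prob_dominated) simp
  \<comment> \<open>\<open>k / 2\<close> permits absorption of the term in \<open>G\<close> on the
    left; 1 bounds the factor of \<open>D'\<close>.\<close>
  have "\<forall>\<^sub>F p in wp1 M. \<bar>Y p\<bar> < min 1 (k / 2)"
    using tendstoD[OF Y, of "min 1 (k / 2)"] k by simp
  with le have "\<forall>\<^sub>F p in wp1 M. \<bar>G p\<bar> \<le> \<bar>2 / k * (\<bar>S p\<bar> + \<bar>D p\<bar> + \<bar>D' p\<bar>)\<bar>"
  proof eventually_elim
    case (elim p)
    have "Y p * (D' p + \<bar>G p\<bar>) \<le> \<bar>Y p\<bar> * (\<bar>D' p\<bar> + \<bar>G p\<bar>)"
      by (rule order_trans[OF abs_ge_self]) (auto simp: abs_mult intro!: mult_left_mono)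
    also have "\<dots> = \<bar>Y p\<bar> * \<bar>D' p\<bar> + \<bar>Y p\<bar> * \<bar>G p\<bar>" by (simp add: algebra_simps)
    also have "\<dots> \<le> 1 * \<bar>D' p\<bar> + (k / 2) * \<bar>G p\<bar>"
      using elim by (intro add_mono mult_right_mono) auto
    finally have "\<bar>S p + D p - k * G p\<bar> \<le> \<bar>D' p\<bar> + (k / 2) * \<bar>G p\<bar>" using elim by linarith
    moreover have "k * \<bar>G p\<bar> = \<bar>k * G p\<bar>" using k by (simp add: abs_mult)
    ultimately have "k * \<bar>G p\<bar> \<le> \<bar>S p\<bar> + \<bar>D p\<bar> + \<bar>D' p\<bar> + (k / 2) * \<bar>G p\<bar>" by linarith
    then have "(k / 2) * \<bar>G p\<bar> \<le> \<bar>S p\<bar> + \<bar>D p\<bar> + \<bar>D' p\<bar>" by (simp add: algebra_simps)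
    then show ?case using k by (simp add: field_simps)
  qed
  then show G: "bounded_in_prob M G"
    by (rule bounded_in_prob_dominated[OF bounded_in_prob_cmult[OF bounded_in_prob_add[OF bounded_in_prob_add[OF abs[OF S] abs[OF D]] abs[OF D']]]])
  have "((\<lambda>p. Y p * (D' p + \<bar>G p\<bar>)) \<longlongrightarrow> 0) (wp1 M)"
    by (rule bounded_in_probD[OF bounded_in_prob_add[OF D' abs[OF G]] Y])
  then show "((\<lambda>p. S p + D p - k * G p) \<longlongrightarrow> 0) (wp1 M)"
    by (rule Lim_null_comparison[rotated]) (use le in simp)
qed

end

section \<open>Moments under the exponential tilt mixture model\<close>

lemma norm_design_ge_1: "1 \<le> norm (design y)"
proof -
  have "1\<^sup>2 \<le> (norm (design y))\<^sup>2" unfolding norm_design_sq by simp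
  then show ?thesis by (rule power2_le_imp_le) simp
qed

text \<open>The two relations in the assumptions hold for \<open>E = e\<^sup>t\<close>, \<open>X = E / (1 - a + a E)\<close>,
  \<open>Z = E / (1 - r + r E)\<close>; they make the quadratic expression linear in \<open>X\<close>, \<open>Z\<close> and \<open>E\<close>.\<close>

lemma efficient_score_square_linear:
  fixes E X Z w A B a r \<eta>1 \<eta>2 \<eta>3 :: real
  assumes X: "a * E * X = E - (1 - a) * X" and Z: "r * E * Z = E - (1 - r) * Z"
    and \<eta>: "\<eta>2 + \<eta>3 * r = a" "\<eta>1 + \<eta>3 * (1 - r) = 1 - a"
  defines "h \<equiv> - a * X * w - B * (a * X - a)"
    and "l \<equiv> r * Z * w + A * (r * Z - r)"
    and "K \<equiv> \<eta>3 * r * (1 - r)"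
  shows "\<eta>1 * h\<^sup>2 + \<eta>2 * E * (w + h)\<^sup>2 + \<eta>3 * (1 - r + r * E) * (l + h)\<^sup>2 =
    a * (1 - a) * (X * (w * w)) + (- K) * (Z * (w * w)) + 2 * K * A * (X * w) + (2 * K * A - B * a * (1 - a)) * B * X
    + (- 2 * K * A) * (Z * w) + (K * A\<^sup>2 * (1 - r) - (2 * K * A - B * a * (1 - a)) * B * (1 - a)) * E
    + (- K * A\<^sup>2) * Z + (K * A\<^sup>2 * r - (2 * K * A - B * a * (1 - a)) * B * a)"
proof -
  \<comment> \<open>Products with \<open>E\<close> are eliminated first. \<open>Dh\<close> and
    \<open>Rl\<close> then clear the denominators of the pooled density and of the density of sample
    3, so that in each square one of the two equal factors becomes polynomial in \<open>E\<close>
    and \<open>w\<close>.\<close>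
  have Eh: "E * h = - E * w + (1 - a) * X * w - B * (1 - a) * (E - X)"
  proof -
    have "E * h = - (a * E * X) * w - B * (a * E * X - a * E)" by (simp add: h_def algebra_simps)
    then show ?thesis unfolding X by (simp add: algebra_simps)
  qed
  have El: "E * l = (E - (1 - r) * Z) * w + A * (1 - r) * (E - Z)"
  proof -
    have "E * l = (r * E * Z) * w + A * (r * E * Z - r * E)" by (simp add: l_def algebra_simps)
    then show ?thesis unfolding Z by (simp add: algebra_simps)
  qed
  have Dh: "(1 - a + a * E) * h = - a * E * w - B * a * (1 - a) * (E - 1)"
  proof -
    have "(1 - a + a * E) * h = (1 - a) * h + a * (E * h)" by (simp add: algebra_simps)
    then show ?thesis unfolding Eh by (simp add: h_def algebra_simps)
  qed
  have Rl: "(1 - r + r * E) * l = r * E * w + A * r * (1 - r) * (E - 1)"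
  proof -
    have "(1 - r + r * E) * l = (1 - r) * l + r * (E * l)" by (simp add: algebra_simps)
    then show ?thesis unfolding El by (simp add: l_def algebra_simps)
  qed
  have weights: "\<eta>1 + \<eta>2 * E + \<eta>3 * (1 - r + r * E) = 1 - a + a * E"
  proof -
    have e: "\<eta>1 = 1 - a - \<eta>3 * (1 - r)" "\<eta>2 = a - \<eta>3 * r" using \<eta> by linarith+
    show ?thesis unfolding e by (simp add: algebra_simps)
  qed
  have "\<eta>1 * h\<^sup>2 + \<eta>2 * E * (w + h)\<^sup>2 + \<eta>3 * (1 - r + r * E) * (l + h)\<^sup>2 =
     (\<eta>1 + \<eta>2 * E + \<eta>3 * (1 - r + r * E)) * h * h + 2 * h * (\<eta>2 * E * w + \<eta>3 * ((1 - r + r * E) * l))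
     + \<eta>2 * E * w * w + \<eta>3 * ((1 - r + r * E) * l) * l"
    by (simp add: power2_eq_square algebra_simps)
  also have "\<dots> = (- a * E * w - B * a * (1 - a) * (E - 1)) * h + 2 * h * (\<eta>2 * E * w + \<eta>3 * (r * E * w + A * r * (1 - r) * (E - 1)))
     + \<eta>2 * E * w * w + \<eta>3 * (r * E * w + A * r * (1 - r) * (E - 1)) * l"
    unfolding weights Rl Dh ..
  also have "\<dots> = (- a + 2 * (\<eta>2 + \<eta>3 * r)) * w * (E * h) + (2 * K * A - B * a * (1 - a)) * (E * h - h)
     + \<eta>2 * E * w * w + \<eta>3 * (r * w * (E * l) + A * r * (1 - r) * (E * l - l))"
    by (simp add: K_def algebra_simps)
  also have "\<dots> = a * w * (E * h) + (2 * K * A - B * a * (1 - a)) * (E * h - h)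
     + \<eta>2 * E * w * w + \<eta>3 * (r * w * (E * l) + A * r * (1 - r) * (E * l - l))"
    unfolding \<eta>(1) by simp
  also have "\<dots> = (\<eta>2 + \<eta>3 * r - a) * E * w * w +
    (a * (1 - a) * (X * (w * w)) + (- K) * (Z * (w * w)) + 2 * K * A * (X * w) + (2 * K * A - B * a * (1 - a)) * B * X
    + (- 2 * K * A) * (Z * w) + (K * A\<^sup>2 * (1 - r) - (2 * K * A - B * a * (1 - a)) * B * (1 - a)) * E
    + (- K * A\<^sup>2) * Z + (K * A\<^sup>2 * r - (2 * K * A - B * a * (1 - a)) * B * a))"
    unfolding Eh El by (simp add: h_def l_def K_def power2_eq_square algebra_simps)
  finally show ?thesis unfolding \<eta>(1) by simp
qed

text \<open>With zero slope the mass constraint would force \<open>\<beta> = 0\<close>; the two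
  components would coincide and \<open>\<rho>\<close> would not be identified. Nondegeneracy of the
  linear predictor makes the information matrices definite.\<close>

locale ETM_asymptotics = ETM M x G0 \<rho> \<beta>
  for M :: "'w measure" and x :: "nat \<Rightarrow> nat \<Rightarrow> 'w \<Rightarrow> real ^ 'p::finite"
    and G0 :: "(real ^ 'p) measure" and \<rho> :: real and \<beta> :: "real ^ 'p option" +
  fixes n :: "nat \<Rightarrow> nat \<Rightarrow> nat" and \<eta> :: "nat \<Rightarrow> real"
  assumes sizes: "filterlim (\<lambda>k. total_size (n k)) at_top sequentially"
      "\<And>j. j \<in> {1, 2, 3} \<Longrightarrow> (\<lambda>k. real (n k j) / real (total_size (n k))) \<longlonglongrightarrow> \<eta> j"
      "\<And>j. j \<in> {1, 2, 3} \<Longrightarrow> 0 < \<eta> j \<and> \<eta> j < 1"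
    and identifiable: "slope \<beta> \<noteq> 0"
    and nondegenerate: "\<And>b. b \<noteq> 0 \<Longrightarrow> \<not> (AE y in G0. linpred b y = 0)"
    and moments: "integrable G0 (\<lambda>y. (norm y)\<^sup>2)"
      "integrable (tilt G0 \<beta>) (\<lambda>y. (norm y)\<^sup>2)"
begin

abbreviation tilt_ratio :: "real ^ 'p \<Rightarrow> real" where
  "tilt_ratio y \<equiv> exp (linpred \<beta> y)"

definition P :: "nat \<Rightarrow> (real ^ 'p) measure" where
  "P j = density G0 (\<lambda>y. ennreal (tilt_density (mixprop \<rho> j) (linpred \<beta> y)))"

lemma measurable_G0: "borel_measurable G0 = borel_measurable borel"
  using measurable_cong_sets[OF sets_G0 refl] by blast

lemma linpred_measurable[measurable]: "linpred b \<in> borel_measurable borel"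
  unfolding linpred_eq_inner[abs_def] by measurable

lemma tilt_density_measurable[measurable]: "tilt_density a \<in> borel_measurable borel"
  unfolding tilt_density_def[abs_def] by measurable

lemma mixprop_range: "0 \<le> mixprop \<rho> j" "mixprop \<rho> j \<le> 1"
  using mixing_proportion by (auto simp: mixprop_def)

lemma tilt_density_nonneg: "0 \<le> a \<Longrightarrow> a \<le> 1 \<Longrightarrow> 0 \<le> tilt_density a t"
  unfolding tilt_density_def by simp

lemma distr_x: assumes "j \<in> {1, 2, 3}" shows "distr M borel (x j i) = P j"
proof (rule measure_eqI)
  show "sets (distr M borel (x j i)) = sets (P j)" by (simp add: P_def sets_G0)
  fix A assume "A \<in> sets (distr M borel (x j i))"
  then have A[measurable]: "A \<in> sets borel" by simp
  then have [measurable]: "A \<in> sets G0" by (simp add: sets_G0)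
  note [simp] = measurable_G0
  define a where "a = mixprop \<rho> j"
  have a: "0 \<le> a" "a \<le> 1" using mixprop_range by (auto simp: a_def)
  have [measurable]: "x j i \<in> borel_measurable M"
    using independent assms unfolding indep_vars_def2 by auto
  have "emeasure (P j) A = (\<integral>\<^sup>+y. ennreal (1 - a + a * tilt_ratio y) * indicator A y \<partial>G0)"
    unfolding P_def a_def tilt_density_def by (subst emeasure_density) auto
  also have "\<dots> = (\<integral>\<^sup>+y. ennreal (1 - a) * indicator A y + ennreal a * (ennreal (tilt_ratio y) * indicator A y) \<partial>G0)"
    using a by (intro nn_integral_cong) (auto simp: ennreal_plus ennreal_mult indicator_def)
  also have "\<dots> = ennreal (1 - a) * emeasure G0 A + ennreal a * emeasure (tilt G0 \<beta>) A"
    unfolding tilt_def by (subst nn_integral_add) (auto simp: nn_integral_cmult emeasure_density)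
  also have "\<dots> = ennreal ((1 - a) * measure G0 A + a * measure (tilt G0 \<beta>) A)"
    using a by (simp add: G0.emeasure_eq_measure G1.emeasure_eq_measure ennreal_mult ennreal_plus)
  also have "\<dots> = emeasure (distr M borel (x j i)) A"
  proof -
    interpret D: prob_space "distr M borel (x j i)" by (rule prob_space_distr) simp
    show ?thesis unfolding D.emeasure_eq_measure a_def mixture[OF assms A] ..
  qed
  finally show "emeasure (distr M borel (x j i)) A = emeasure (P j) A" by simp
qed

lemma tilt_ratio_integral: "integrable G0 tilt_ratio" "(\<integral>y. tilt_ratio y \<partial>G0) = 1"
proof -
  note [simp] = measurable_G0
  have "integrable (tilt G0 \<beta>) (\<lambda>_. 1 :: real)" by simp
  then show "integrable G0 tilt_ratio"
    unfolding tilt_def by (subst (asm) integrable_density) auto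
  have "(\<integral>y. 1 \<partial>tilt G0 \<beta>) = (1::real)" using G1.prob_space by simp
  then show "(\<integral>y. tilt_ratio y \<partial>G0) = 1"
    unfolding tilt_def by (subst (asm) integral_density) auto
qed

lemma design_moments: "integrable G0 (\<lambda>y. (norm (design y))\<^sup>2)"
  "integrable G0 (\<lambda>y. tilt_ratio y * (norm (design y))\<^sup>2)"
proof -
  note [simp] = measurable_G0
  show "integrable G0 (\<lambda>y. (norm (design y))\<^sup>2)" unfolding norm_design_sq using moments(1) by simp
  have "integrable G0 (\<lambda>y. tilt_ratio y * (norm y)\<^sup>2)"
    using moments(2) unfolding tilt_def by (subst (asm) integrable_density) auto
  then show "integrable G0 (\<lambda>y. tilt_ratio y * (norm (design y))\<^sup>2)"
    unfolding norm_design_sq using tilt_ratio_integral(1) by (simp add: distrib_left)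
qed

lemma integrable_G0_dominated:
  fixes g :: "real ^ 'p \<Rightarrow> real"
  assumes "g \<in> borel_measurable borel" "\<And>y. \<bar>g y\<bar> \<le> K * ((1 + tilt_ratio y) * (norm (design y))\<^sup>2)"
  shows "integrable G0 g"
proof (rule Bochner_Integration.integrable_bound)
  show "integrable G0 (\<lambda>y. K * ((1 + tilt_ratio y) * (norm (design y))\<^sup>2))"
    using design_moments by (simp add: distrib_right)
qed (use assms in \<open>auto simp: measurable_G0 intro: order_trans[OF _ abs_ge_self]\<close>)

lemma integral_P:
  assumes "f \<in> borel_measurable borel"
  shows "integrable (P j) f \<longleftrightarrow> integrable G0 (\<lambda>y. tilt_density (mixprop \<rho> j) (linpred \<beta> y) * f y :: real)"
    "(\<integral>y. f y \<partial>P j) = (\<integral>y. tilt_density (mixprop \<rho> j) (linpred \<beta> y) * f y \<partial>G0)"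
  unfolding P_def using assms tilt_density_nonneg[OF mixprop_range]
  by (auto simp: integrable_density integral_density measurable_G0)

lemma tilt_density_le: "0 \<le> a \<Longrightarrow> a \<le> 1 \<Longrightarrow> tilt_density a (linpred \<beta> y) \<le> 1 + tilt_ratio y"
  unfolding tilt_density_def by (simp add: add_mono mult_left_le_one_le)

sublocale feature_samples M "{1, 2, 3}" x P n "\<lambda>k. total_size (n k)" \<eta> design
proof
  fix j :: nat assume "j \<in> {1, 2, 3}"
  show "integrable (P j) (\<lambda>y. (norm (design y))\<^sup>2)"
  proof (subst integral_P(1))
    show "integrable G0 (\<lambda>y. tilt_density (mixprop \<rho> j) (linpred \<beta> y) * (norm (design y))\<^sup>2)"
      by (rule integrable_G0_dominated[of _ 1])
        (auto simp: abs_mult tilt_density_nonneg mixprop_range tilt_density_le intro!: mult_right_mono)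
  qed measurable
qed (use distr_x independent sizes in auto)

lemma sum_eta: "\<eta> 1 + \<eta> 2 + \<eta> 3 = 1"
proof -
  have "(\<lambda>k. real (n k 1) / real (total_size (n k)) + real (n k 2) / real (total_size (n k)) + real (n k 3) / real (total_size (n k)))
     \<longlonglongrightarrow> \<eta> 1 + \<eta> 2 + \<eta> 3"
    by (intro tendsto_add sizes(2)) auto
  moreover have "(\<lambda>k. real (n k 1) / real (total_size (n k)) + real (n k 2) / real (total_size (n k)) + real (n k 3) / real (total_size (n k))) \<longlonglongrightarrow> 1"
  proof (rule tendsto_eventually)
    show "\<forall>\<^sub>F k in sequentially. real (n k 1) / real (total_size (n k)) + real (n k 2) / real (total_size (n k)) + real (n k 3) / real (total_size (n k)) = 1"
    using N_pos
  proof eventually_elim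
    case (elim k)
    have "{1..3::nat} = {1, 2, 3}" by auto
    then have "real (total_size (n k)) = real (n k 1) + real (n k 2) + real (n k 3)"
      by (simp add: total_size_def)
    then show ?case using elim by (simp add: add_divide_distrib[symmetric])
  qed
  qed
  ultimately show ?thesis by (rule LIMSEQ_unique)
qed

text \<open>The mixing proportion of the pooled population, to which the inner minimizer
  converges.\<close>

definition \<alpha> :: real where "\<alpha> = \<eta> 2 + \<eta> 3 * \<rho>"

definition a_lab :: real where "a_lab = \<eta> 2 / (\<eta> 1 + \<eta> 2)"

lemma eta_pos: "\<eta> 1 > 0" "\<eta> 2 > 0" "\<eta> 3 > 0" using sizes(3) by auto

lemma alpha_range: "0 < \<alpha>" "\<alpha> < 1"
proof -
  have "\<eta> 3 * \<rho> < \<eta> 3" "0 < \<eta> 3 * \<rho>" using eta_pos mixing_proportion by auto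
  then show "0 < \<alpha>" "\<alpha> < 1" using eta_pos sum_eta unfolding \<alpha>_def by linarith+
qed

lemma a_lab_range: "0 < a_lab" "a_lab < 1" using eta_pos by (auto simp: a_lab_def)

text \<open>The density of the tilted component relative to the mixture with proportion
  \<open>s\<close>.\<close>

definition ratio :: "real \<Rightarrow> real ^ 'p \<Rightarrow> real" where
  "ratio s y = tilt_ratio y / tilt_density s (linpred \<beta> y)"

lemma ratio_measurable[measurable]: "ratio s \<in> borel_measurable borel"
  unfolding ratio_def[abs_def] by measurable

text \<open>The second identity eliminates products of \<open>tilt_ratio\<close> and
  \<open>ratio\<close>, which is what makes quadratic score expressions linear under
  \<open>G0\<close>. The last one turns the logistic information weight under the
  \<open>s\<close>-mixture into \<open>ratio s\<close> under \<open>G0\<close>.\<close>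

lemma ratio_eq:
  assumes "0 < s" "s < 1"
  shows "tilt_density s (linpred \<beta> y) * ratio s y = tilt_ratio y"
    "s * tilt_ratio y * ratio s y = tilt_ratio y - (1 - s) * ratio s y"
    "0 < ratio s y" "ratio s y \<le> 1 / s"
    "logistic (linpred \<beta> y + logit s) = s * ratio s y"
    "tilt_density s (linpred \<beta> y) * logistic' (linpred \<beta> y + logit s) = s * (1 - s) * ratio s y"
proof -
  have pos: "tilt_density s (linpred \<beta> y) > 0" using tilt_density_pos assms by simp
  show 1: "tilt_density s (linpred \<beta> y) * ratio s y = tilt_ratio y" using pos by (simp add: ratio_def)
  then have 2: "(1 - s + s * tilt_ratio y) * ratio s y = tilt_ratio y" by (simp add: tilt_density_def)
  then show "s * tilt_ratio y * ratio s y = tilt_ratio y - (1 - s) * ratio s y" by (simp add: algebra_simps)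
  show "0 < ratio s y" using pos by (simp add: ratio_def)
  have "s * tilt_ratio y \<le> tilt_density s (linpred \<beta> y)" using assms by (simp add: tilt_density_def)
  then show "ratio s y \<le> 1 / s" using pos assms by (simp add: ratio_def field_simps)
  show 3: "logistic (linpred \<beta> y + logit s) = s * ratio s y"
    using logistic_logit_add[OF assms] by (simp add: ratio_def)
  have "tilt_density s (linpred \<beta> y) * logistic' (linpred \<beta> y + logit s) =
      s * (tilt_density s (linpred \<beta> y) * ratio s y) * (1 - s * ratio s y)"
    unfolding logistic'_def 3 by simp
  also have "\<dots> = s * (tilt_ratio y - s * tilt_ratio y * ratio s y)" unfolding 1 by (simp add: algebra_simps)
  also have "s * tilt_ratio y * ratio s y = tilt_ratio y - (1 - s) * ratio s y" using 2 by (simp add: algebra_simps)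
  also have "s * (tilt_ratio y - (tilt_ratio y - (1 - s) * ratio s y)) = s * (1 - s) * ratio s y" by simp
  finally show "tilt_density s (linpred \<beta> y) * logistic' (linpred \<beta> y + logit s) = s * (1 - s) * ratio s y" .
qed

lemma inner_design_le: "\<bar>c \<bullet> design y\<bar> \<le> norm c * norm (design y)" by (rule Cauchy_Schwarz_ineq2)

lemma inner_design_le2: "\<bar>c \<bullet> design y\<bar> \<le> norm c * (norm (design y))\<^sup>2"
proof -
  have "norm c * norm (design y) * 1 \<le> norm c * norm (design y) * norm (design y)"
    using norm_design_ge_1[of y] by (intro mult_left_mono) auto
  then show ?thesis using inner_design_le[of c y] by (simp add: power2_eq_square mult_ac)
qed

lemma one_le_design: "1 \<le> (norm (design y))\<^sup>2" by (simp add: norm_design_sq)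

lemma inner_design_product_le: "\<bar>(c \<bullet> design y) * (d \<bullet> design y)\<bar> \<le> norm c * norm d * (norm (design y))\<^sup>2"
  unfolding abs_mult power2_eq_square
  using mult_mono[OF inner_design_le[of c y] inner_design_le[of d y]] by (simp add: mult_ac)

lemma ratio_weighted_integrable:
  fixes g :: "real ^ 'p \<Rightarrow> real"
  assumes s: "0 < s" "s < 1" and [measurable]: "g \<in> borel_measurable borel" and g: "\<And>y. \<bar>g y\<bar> \<le> K * (norm (design y))\<^sup>2"
  shows "integrable G0 (\<lambda>y. ratio s y * g y)"
proof (rule integrable_G0_dominated[of _ "1 / s * K"])
  fix y :: "real ^ 'p"
  have "0 < (norm (design y))\<^sup>2" using one_le_design[of y] by linarith
  then have "0 \<le> K" using order_trans[OF abs_ge_zero g[of y]] by (simp add: zero_le_mult_iff)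
  have "\<bar>ratio s y * g y\<bar> \<le> 1 / s * (K * (norm (design y))\<^sup>2)"
    unfolding abs_mult using ratio_eq(3,4)[OF s, of y] s g by (intro mult_mono) auto
  also have "\<dots> = 1 / s * K * (1 * (norm (design y))\<^sup>2)" by simp
  also have "\<dots> \<le> 1 / s * K * ((1 + tilt_ratio y) * (norm (design y))\<^sup>2)"
    using s \<open>0 \<le> K\<close> by (intro mult_left_mono mult_right_mono) auto
  finally show "\<bar>ratio s y * g y\<bar> \<le> 1 / s * K * ((1 + tilt_ratio y) * (norm (design y))\<^sup>2)" .
qed measurable

lemma ratio_integrable:
  assumes s: "0 < s" "s < 1"
  shows "integrable G0 (ratio s)" "integrable G0 (\<lambda>y. ratio s y * (c \<bullet> design y))"
    "integrable G0 (\<lambda>y. ratio s y * ((c \<bullet> design y) * (d \<bullet> design y)))"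
proof -
  have "integrable G0 (\<lambda>y. ratio s y * 1)"
    by (rule ratio_weighted_integrable[OF s, of _ 1]) (use one_le_design in auto)
  then show "integrable G0 (ratio s)" by simp
  show "integrable G0 (\<lambda>y. ratio s y * (c \<bullet> design y))"
    by (rule ratio_weighted_integrable[OF s _ inner_design_le2]) measurable
  show "integrable G0 (\<lambda>y. ratio s y * ((c \<bullet> design y) * (d \<bullet> design y)))"
    by (rule ratio_weighted_integrable[OF s _ inner_design_product_le]) measurable
qed

text \<open>The moments to which all information quantities at proportion \<open>s\<close> reduce;
  \<open>I1\<close> and \<open>I0\<close> arise from \<open>I2\<close> when one or both arguments
  are the intercept vector.\<close>

definition I0 :: "real \<Rightarrow> real" where "I0 s = (\<integral>y. ratio s y \<partial>G0)"
definition I1 :: "real \<Rightarrow> real ^ 'p option \<Rightarrow> real" where "I1 s c = (\<integral>y. ratio s y * (c \<bullet> design y) \<partial>G0)"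
definition I2 :: "real \<Rightarrow> real ^ 'p option \<Rightarrow> real ^ 'p option \<Rightarrow> real" where
  "I2 s c d = (\<integral>y. ratio s y * ((c \<bullet> design y) * (d \<bullet> design y)) \<partial>G0)"

abbreviation e0 :: "real ^ 'p option" where "e0 \<equiv> axis None 1"

lemma e0_inner[simp]: "e0 \<bullet> design y = 1" by (rule axis_None_inner_design)

lemma I2_e0: "I2 s c e0 = I1 s c" "I2 s e0 c = I1 s c" "I1 s e0 = I0 s"
  by (simp_all add: I2_def I1_def I0_def)

text \<open>Here \<open>nondegenerate\<close> enters: the strict positivity of every information
  quantity goes back to this lemma.\<close>

lemma integral_pos_of_AE:
  assumes "integrable G0 f" "\<And>y. 0 \<le> (f y :: real)" "\<And>y. f y = 0 \<Longrightarrow> linpred b y = 0" "b \<noteq> 0"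
  shows "0 < (\<integral>y. f y \<partial>G0)"
proof -
  have "(\<integral>y. f y \<partial>G0) \<noteq> 0"
  proof
    assume "(\<integral>y. f y \<partial>G0) = 0"
    then have "AE y in G0. f y = 0"
      using integral_nonneg_eq_0_iff_AE[OF assms(1)] assms(2) by simp
    then have "AE y in G0. linpred b y = 0" by eventually_elim (rule assms(3))
    with nondegenerate[OF assms(4)] show False by simp
  qed
  moreover have "0 \<le> (\<integral>y. f y \<partial>G0)" using assms(2) by simp
  ultimately show ?thesis by linarith
qed

lemma beta_nonzero: "\<beta> \<noteq> 0" using identifiable by (auto simp: slope_def vec_eq_iff)

text \<open>\<open>1 - I0 s\<close> is \<open>s * (1 - s)\<close> times the Fisher information for a
  mixing proportion at \<open>s\<close>, an integral of a square that vanishes only where the linear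
  predictor does.\<close>

lemma I0_less_1:
  assumes s: "0 < s" "s < 1"
  shows "I0 s < 1"
proof -
  \<comment> \<open>The multiple of \<open>tilt_ratio y - 1\<close> integrates to zero; adding it
    turns \<open>1 - ratio s y\<close> into a nonnegative integrand.\<close>
  define g where "g y = (1 - s) * (tilt_ratio y - 1) + 1 - ratio s y" for y
  have eq: "g y = s * (1 - s) * (tilt_ratio y - 1)\<^sup>2 / tilt_density s (linpred \<beta> y)" for y
    using tilt_density_pos[of s "linpred \<beta> y"] s
    by (simp add: g_def ratio_def field_simps power2_eq_square) (simp add: tilt_density_def algebra_simps)
  have g0: "0 \<le> g y" "g y = 0 \<Longrightarrow> linpred \<beta> y = 0" for y
    unfolding eq using tilt_density_pos[of s "linpred \<beta> y"] s by auto
  have int: "integrable G0 g"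
    unfolding g_def[abs_def] using ratio_integrable(1)[OF s] tilt_ratio_integral(1) by simp
  have "0 < (\<integral>y. g y \<partial>G0)" by (rule integral_pos_of_AE[OF int g0 beta_nonzero])
  also have "(\<integral>y. g y \<partial>G0) = 1 - I0 s"
    unfolding g_def[abs_def] I0_def using ratio_integrable(1)[OF s] tilt_ratio_integral
    by (simp add: G0.prob_space)
  finally show ?thesis by simp
qed

lemma I2_pos:
  assumes s: "0 < s" "s < 1" and c: "c \<noteq> 0"
  shows "0 < I2 s c c"
  unfolding I2_def
proof (rule integral_pos_of_AE[OF ratio_integrable(3)[OF s] _ _ c])
  fix y show "0 \<le> ratio s y * ((c \<bullet> design y) * (c \<bullet> design y))" using ratio_eq(3)[OF s, of y] by simp
  show "ratio s y * ((c \<bullet> design y) * (c \<bullet> design y)) = 0 \<Longrightarrow> linpred c y = 0"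
    using ratio_eq(3)[OF s, of y] by (simp add: linpred_eq_inner)
qed

text \<open>The regression coefficient of the \<open>\<beta>\<close>-score in direction \<open>c\<close> on the score for the mixing proportion.\<close>

definition proj :: "real \<Rightarrow> real ^ 'p option \<Rightarrow> real" where "proj s c = I1 s c / (1 - I0 s)"

lemma proj_eq: "0 < s \<Longrightarrow> s < 1 \<Longrightarrow> proj s c * (1 - I0 s) = I1 s c"
  using I0_less_1[of s] by (simp add: proj_def)

end

section \<open>Influence functions\<close>

context ETM_asymptotics
begin

definition Q :: "real \<Rightarrow> real ^ 'p \<Rightarrow> real" where "Q \<zeta> y = logistic (linpred \<beta> y + \<zeta>)"

lemma inner_shift: "(b + \<zeta> *\<^sub>R e0) \<bullet> design y = linpred b y + \<zeta>"
  by (simp add: inner_add_left linpred_eq_inner)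

lemma Q_measurable[measurable]: "Q \<zeta> \<in> borel_measurable borel"
  unfolding Q_def[abs_def] by measurable

lemma Q_bounds: "0 < Q \<zeta> y" "Q \<zeta> y < 1" by (simp_all add: Q_def logistic_bounds)

lemma Q_logit: "0 < s \<Longrightarrow> s < 1 \<Longrightarrow> Q (logit s) y = s * ratio s y"
  unfolding Q_def by (rule ratio_eq(5))

lemma Q_lipschitz: "\<bar>Q \<zeta> y - Q \<zeta>' y\<bar> \<le> \<bar>\<zeta> - \<zeta>'\<bar>"
  using logistic_lipschitz[of "linpred \<beta> y + \<zeta>" "linpred \<beta> y + \<zeta>'"] by (simp add: Q_def)

text \<open>
  The contributions of an observation \<open>y\<close> of sample \<open>j\<close> to the efficient score and to the score of the
  labeled data; the tilts in the denominators are parametrized by \<open>\<zeta> = logit \<alpha>\<close>.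
\<close>

definition eff :: "real \<Rightarrow> real ^ 'p option \<Rightarrow> nat \<Rightarrow> real ^ 'p \<Rightarrow> real" where
  "eff \<zeta> c j y = (if j = 2 then c \<bullet> design y
     else if j = 3 then Q (logit \<rho>) y * (c \<bullet> design y) + proj \<rho> c * (Q (logit \<rho>) y - \<rho>) else 0)
     - Q \<zeta> y * (c \<bullet> design y) - proj \<alpha> c * (Q \<zeta> y - logistic \<zeta>)"

definition lab :: "real \<Rightarrow> real ^ 'p option \<Rightarrow> nat \<Rightarrow> real ^ 'p \<Rightarrow> real" where
  "lab \<zeta> c j y = (if j = 1 then - Q \<zeta> y * (c \<bullet> design y)
     else if j = 2 then (1 - Q \<zeta> y) * (c \<bullet> design y) else 0)"

lemma eff_measurable[measurable]: "eff \<zeta> c j \<in> borel_measurable borel"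
  unfolding eff_def[abs_def] by measurable

lemma lab_measurable[measurable]: "lab \<zeta> c j \<in> borel_measurable borel"
  unfolding lab_def[abs_def] by measurable

lemma Q_inner_le: "\<bar>Q \<zeta> y * (c \<bullet> design y)\<bar> \<le> norm c * norm (design y)"
  using mult_mono[of "\<bar>Q \<zeta> y\<bar>" 1 "\<bar>c \<bullet> design y\<bar>" "norm c * norm (design y)"] Q_bounds[of \<zeta> y] inner_design_le[of c y]
  by (simp add: abs_mult)

lemma abs_le_mult_design: "\<bar>t\<bar> \<le> 1 \<Longrightarrow> \<bar>k' * t\<bar> \<le> \<bar>k'\<bar> * norm (design (y :: real ^ 'q::finite))"
  unfolding abs_mult using norm_design_ge_1[of y] by (intro mult_left_mono) linarith+

lemma eff_bound: "\<bar>eff \<zeta> c j y\<bar> \<le> (3 * norm c + \<bar>proj \<rho> c\<bar> + \<bar>proj \<alpha> c\<bar>) * norm (design y)"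
proof -
  have 1: "\<bar>proj \<alpha> c * (Q \<zeta> y - logistic \<zeta>)\<bar> \<le> \<bar>proj \<alpha> c\<bar> * norm (design y)"
    using Q_bounds[of \<zeta> y] logistic_bounds[of \<zeta>] by (intro abs_le_mult_design) auto
  have 2: "\<bar>proj \<rho> c * (Q (logit \<rho>) y - \<rho>)\<bar> \<le> \<bar>proj \<rho> c\<bar> * norm (design y)"
    using Q_bounds[of "logit \<rho>" y] mixing_proportion by (intro abs_le_mult_design) auto
  have 0: "0 \<le> norm c * norm (design y)" by simp
  note * = 0 1 2 inner_design_le[of c y] Q_inner_le[of \<zeta> y c] Q_inner_le[of "logit \<rho>" y c]
  consider "j = 2" | "j = 3" | "j \<noteq> 2" "j \<noteq> 3" by blast
  then show ?thesis
  proof cases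
    case 1
    then have "eff \<zeta> c j y = c \<bullet> design y - Q \<zeta> y * (c \<bullet> design y) - proj \<alpha> c * (Q \<zeta> y - logistic \<zeta>)"
      by (simp add: eff_def)
    then show ?thesis using * unfolding distrib_right by linarith
  next
    case 2
    then have "eff \<zeta> c j y = Q (logit \<rho>) y * (c \<bullet> design y) + proj \<rho> c * (Q (logit \<rho>) y - \<rho>)
        - Q \<zeta> y * (c \<bullet> design y) - proj \<alpha> c * (Q \<zeta> y - logistic \<zeta>)"
      by (simp add: eff_def)
    then show ?thesis using * unfolding distrib_right by linarith
  next
    case 3
    then have "eff \<zeta> c j y = - (Q \<zeta> y * (c \<bullet> design y)) - proj \<alpha> c * (Q \<zeta> y - logistic \<zeta>)"
      by (simp add: eff_def)
    then show ?thesis using * unfolding distrib_right by linarith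
  qed
qed

lemma lab_bound: "\<bar>lab \<zeta> c j y\<bar> \<le> norm c * norm (design y)"
proof -
  have "\<bar>(1 - Q \<zeta> y) * (c \<bullet> design y)\<bar> \<le> 1 * (norm c * norm (design y))"
    unfolding abs_mult using Q_bounds[of \<zeta> y] inner_design_le[of c y] by (intro mult_mono) auto
  then show ?thesis using Q_inner_le[of \<zeta> y c] by (auto simp: lab_def)
qed

lemma square_integrable_of_bound:
  fixes g :: "real ^ 'p \<Rightarrow> real"
  assumes "j \<in> {1, 2, 3}" "g \<in> borel_measurable borel" "\<And>y. \<bar>g y\<bar> \<le> K * norm (design y)"
  shows "integrable (P j) (\<lambda>y. (g y)\<^sup>2)"
proof (rule integrable_dominated_\<phi>[OF assms(1), of _ "K\<^sup>2"])
  show "norm ((g y)\<^sup>2) \<le> K\<^sup>2 * (norm (design y))\<^sup>2" for y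
    using power_mono[OF assms(3) abs_ge_zero, of y 2] by (simp add: power_mult_distrib)
qed (use assms(2) in simp)

lemmas eff_square_integrable = square_integrable_of_bound[OF _ eff_measurable eff_bound]
lemmas lab_square_integrable = square_integrable_of_bound[OF _ lab_measurable lab_bound]

lemma eff_integrable: "j \<in> {1, 2, 3} \<Longrightarrow> integrable (P j) (eff \<zeta> c j)"
  by (rule square_integrable_P[OF _ eff_measurable eff_square_integrable])

lemma lab_integrable: "j \<in> {1, 2, 3} \<Longrightarrow> integrable (P j) (lab \<zeta> c j)"
  by (rule square_integrable_P[OF _ lab_measurable lab_square_integrable])

lemma eff_lipschitz: "\<bar>eff \<zeta> c j y - eff \<zeta>' c j y\<bar> \<le> \<bar>\<zeta> - \<zeta>'\<bar> * ((norm c + 2 * \<bar>proj \<alpha> c\<bar>) * norm (design y))"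
proof -
  have "eff \<zeta> c j y - eff \<zeta>' c j y = (Q \<zeta>' y - Q \<zeta> y) * (c \<bullet> design y) 
      + proj \<alpha> c * ((Q \<zeta>' y - Q \<zeta> y) + (logistic \<zeta> - logistic \<zeta>'))"
    by (simp add: eff_def algebra_simps)
  also have "\<bar>\<dots>\<bar> \<le> \<bar>\<zeta> - \<zeta>'\<bar> * (norm c * norm (design y)) + \<bar>proj \<alpha> c\<bar> * (2 * \<bar>\<zeta> - \<zeta>'\<bar>)"
  proof (rule order_trans[OF abs_triangle_ineq add_mono])
    show "\<bar>(Q \<zeta>' y - Q \<zeta> y) * (c \<bullet> design y)\<bar> \<le> \<bar>\<zeta> - \<zeta>'\<bar> * (norm c * norm (design y))"
      unfolding abs_mult using Q_lipschitz[of \<zeta>' y \<zeta>] inner_design_le[of c y]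
      by (intro mult_mono) (auto simp: abs_minus_commute)
    show "\<bar>proj \<alpha> c * ((Q \<zeta>' y - Q \<zeta> y) + (logistic \<zeta> - logistic \<zeta>'))\<bar> \<le> \<bar>proj \<alpha> c\<bar> * (2 * \<bar>\<zeta> - \<zeta>'\<bar>)"
      unfolding abs_mult using Q_lipschitz[of \<zeta>' y \<zeta>] logistic_lipschitz[of \<zeta> \<zeta>']
        abs_minus_commute[of \<zeta> \<zeta>'] abs_triangle_ineq[of "Q \<zeta>' y - Q \<zeta> y" "logistic \<zeta> - logistic \<zeta>'"]
      by (intro mult_left_mono) auto
  qed
  also have "\<dots> \<le> \<bar>\<zeta> - \<zeta>'\<bar> * (norm c * norm (design y)) + \<bar>proj \<alpha> c\<bar> * (2 * \<bar>\<zeta> - \<zeta>'\<bar>) * norm (design y)"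
    using mult_left_mono[OF norm_design_ge_1[of y], of "\<bar>proj \<alpha> c\<bar> * (2 * \<bar>\<zeta> - \<zeta>'\<bar>)"] by simp
  finally show ?thesis by (simp add: algebra_simps)
qed

lemma lab_lipschitz: "\<bar>lab \<zeta> c j y - lab \<zeta>' c j y\<bar> \<le> \<bar>\<zeta> - \<zeta>'\<bar> * (norm c * norm (design y))"
proof -
  have "\<bar>lab \<zeta> c j y - lab \<zeta>' c j y\<bar> \<le> \<bar>Q \<zeta>' y - Q \<zeta> y\<bar> * \<bar>c \<bullet> design y\<bar>"
    by (simp add: lab_def abs_mult[symmetric] algebra_simps)
  also have "\<dots> \<le> \<bar>\<zeta> - \<zeta>'\<bar> * (norm c * norm (design y))"
    using Q_lipschitz[of \<zeta>' y \<zeta>] inner_design_le[of c y] by (intro mult_mono) (auto simp: abs_minus_commute)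
  finally show ?thesis .
qed

lemma tilt_density_mixprop:
  "tilt_density (mixprop \<rho> (Suc 0)) t = 1" "tilt_density (mixprop \<rho> 2) t = exp t" "tilt_density (mixprop \<rho> 3) t = tilt_density \<rho> t"
  by (simp_all add: mixprop_def tilt_density_def)

text \<open>If \<open>s\<close> is the mixing proportion of the samples pooled with arbitrary
  weights, the combined integrand under \<open>G0\<close> collapses to a multiple of
  \<open>tilt_ratio y - 1\<close>. The score is thus exactly centred at a size-dependent
  \<open>s\<close>, although \<open>proj \<alpha> c\<close> stays at the limiting
  proportion.\<close>

lemma eff_mean_total:
  assumes s: "0 < s" "s < 1" and a: "a2 + a3 * \<rho> = s * (a1 + a2 + a3)"
  shows "a1 * (\<integral>y. eff (logit s) c 1 y \<partial>P 1) + a2 * (\<integral>y. eff (logit s) c 2 y \<partial>P 2) + a3 * (\<integral>y. eff (logit s) c 3 y \<partial>P 3) = 0"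
proof -
  let ?f = "\<lambda>j y. tilt_density (mixprop \<rho> j) (linpred \<beta> y) * eff (logit s) c j y"
  have int: "integrable G0 (?f j)" if "j \<in> {1, 2, 3}" for j
    by (rule iffD1[OF integral_P(1)[OF eff_measurable] eff_integrable[OF that]])
  have pt: "a1 * ?f 1 y + a2 * ?f 2 y + a3 * ?f 3 y = 
     (proj \<rho> c * a3 * \<rho> * (1 - \<rho>) - (a1 + a2 + a3) * proj \<alpha> c * s * (1 - s)) * (tilt_ratio y - 1)" for y
  proof -
    define E X Z w A B where "E = tilt_ratio y" and "X = ratio s y" and "Z = ratio \<rho> y" and "w = c \<bullet> design y" and "A = proj \<rho> c" and "B = proj \<alpha> c"
    have X: "s * E * X = E - (1 - s) * X" and Z: "\<rho> * E * Z = E - (1 - \<rho>) * Z"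
      using ratio_eq(2)[OF s, of y] ratio_eq(2)[OF mixing_proportion, of y] by (simp_all add: E_def X_def Z_def)
    define h where "h = - s * X * w - B * (s * X - s)"
    have "a1 * ?f 1 y + a2 * ?f 2 y + a3 * ?f 3 y = a1 * h + a2 * (E * (w + h)) + a3 * ((1 - \<rho> + \<rho> * E) * (\<rho> * Z * w + A * (\<rho> * Z - \<rho>) + h))"
      by (simp add: eff_def mixprop_def h_def Q_logit s mixing_proportion E_def X_def Z_def w_def A_def B_def
          logistic_logit tilt_density_def) (simp add: algebra_simps)
    also have "\<dots> = (a1 + a2 + a3 - (a2 + a3 * \<rho>)) * h + (a2 + a3 * \<rho>) * (E * h) + a2 * E * w + a3 * ((1 - \<rho>) * (\<rho> * Z * w + A * (\<rho> * Z - \<rho>)) + \<rho> * (\<rho> * E * Z) * w + \<rho> * A * (\<rho> * E * Z - \<rho> * E))"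
      by (simp add: algebra_simps)
    also have "\<dots> = (a1 + a2 + a3) * ((1 - s) * h - (s * E * X) * s * w - s * B * (s * E * X - s * E)) + (a2 + a3 * \<rho>) * E * w
       + a3 * A * \<rho> * (1 - \<rho>) * (E - 1)"
      unfolding a Z using arg_cong[OF a, of "\<lambda>t. t * E * w"] by (simp add: h_def algebra_simps)
    also have "\<dots> = (a3 * A * \<rho> * (1 - \<rho>) - (a1 + a2 + a3) * B * s * (1 - s)) * (E - 1)"
      unfolding a X by (simp add: h_def algebra_simps)
    finally show ?thesis by (simp add: E_def A_def B_def mult_ac)
  qed
  have "a1 * (\<integral>y. ?f 1 y \<partial>G0) + a2 * (\<integral>y. ?f 2 y \<partial>G0) + a3 * (\<integral>y. ?f 3 y \<partial>G0) = (\<integral>y. a1 * ?f 1 y + a2 * ?f 2 y + a3 * ?f 3 y \<partial>G0)"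
    using int[of 1] int[of 2] int[of 3] by simp
  also have "\<dots> = 0"
    unfolding pt using tilt_ratio_integral by (simp add: G0.prob_space)
  finally show ?thesis by (simp add: integral_P(2)[OF eff_measurable])
qed

text \<open>The coefficient \<open>proj \<alpha> c\<close> is exactly the one for which the means in
  samples 1 and 2 vanish separately; sample 3 follows from the pooled identity because
  \<open>\<eta> 3\<close> is positive.\<close>

lemma eff_mean:
  assumes "j \<in> {1, 2, 3}"
  shows "(\<integral>y. eff (logit \<alpha>) c j y \<partial>P j) = 0"
proof -
  note s = alpha_range
  note int = ratio_integrable(1)[OF s] ratio_integrable(2)[OF s, of c] tilt_ratio_integral
  have eqB: "proj \<alpha> c * I0 \<alpha> = proj \<alpha> c - I1 \<alpha> c" using proj_eq[OF s, of c] by (simp add: algebra_simps)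
  have m1: "(\<integral>y. eff (logit \<alpha>) c 1 y \<partial>P 1) = 0"
  proof -
    have "(\<integral>y. eff (logit \<alpha>) c 1 y \<partial>P 1) = (\<integral>y. (- \<alpha>) * (ratio \<alpha> y * (c \<bullet> design y)) + (- \<alpha> * proj \<alpha> c) * ratio \<alpha> y + \<alpha> * proj \<alpha> c \<partial>G0)"
      unfolding integral_P(2)[OF eff_measurable]
      by (rule Bochner_Integration.integral_cong) (auto simp: eff_def tilt_density_mixprop Q_logit s logistic_logit algebra_simps)
    also have "\<dots> = - \<alpha> * I1 \<alpha> c - \<alpha> * (proj \<alpha> c * I0 \<alpha>) + \<alpha> * proj \<alpha> c"
      using int by (simp add: I1_def I0_def G0.prob_space)
    finally show ?thesis unfolding eqB by (simp add: algebra_simps)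
  qed
  have m2: "(\<integral>y. eff (logit \<alpha>) c 2 y \<partial>P 2) = 0"
  proof -
    have "(\<integral>y. eff (logit \<alpha>) c 2 y \<partial>P 2) = (\<integral>y. (1 - \<alpha>) * (ratio \<alpha> y * (c \<bullet> design y)) + (proj \<alpha> c * (1 - \<alpha>)) * ratio \<alpha> y + (- proj \<alpha> c * (1 - \<alpha>)) * tilt_ratio y \<partial>G0)"
      unfolding integral_P(2)[OF eff_measurable]
    proof (rule Bochner_Integration.integral_cong[OF refl])
      fix y
      have "tilt_density (mixprop \<rho> 2) (linpred \<beta> y) * eff (logit \<alpha>) c 2 y = 
         tilt_ratio y * (c \<bullet> design y) - (\<alpha> * tilt_ratio y * ratio \<alpha> y) * (c \<bullet> design y) - proj \<alpha> c * (\<alpha> * tilt_ratio y * ratio \<alpha> y - \<alpha> * tilt_ratio y)"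
        by (simp add: eff_def tilt_density_mixprop Q_logit s logistic_logit algebra_simps)
      then show "tilt_density (mixprop \<rho> 2) (linpred \<beta> y) * eff (logit \<alpha>) c 2 y = (1 - \<alpha>) * (ratio \<alpha> y * (c \<bullet> design y)) + (proj \<alpha> c * (1 - \<alpha>)) * ratio \<alpha> y + (- proj \<alpha> c * (1 - \<alpha>)) * tilt_ratio y"
        unfolding ratio_eq(2)[OF s] by (simp add: algebra_simps)
    qed
    also have "\<dots> = (1 - \<alpha>) * I1 \<alpha> c + (1 - \<alpha>) * (proj \<alpha> c * I0 \<alpha>) - proj \<alpha> c * (1 - \<alpha>)"
      using int by (simp add: I1_def I0_def)
    finally show ?thesis unfolding eqB by (simp add: algebra_simps)
  qed
  have "\<eta> 1 * (\<integral>y. eff (logit \<alpha>) c 1 y \<partial>P 1) + \<eta> 2 * (\<integral>y. eff (logit \<alpha>) c 2 y \<partial>P 2) + \<eta> 3 * (\<integral>y. eff (logit \<alpha>) c 3 y \<partial>P 3) = 0"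
    by (rule eff_mean_total[OF s]) (simp only: sum_eta \<alpha>_def mult_1_right)
  then have "(\<integral>y. eff (logit \<alpha>) c 3 y \<partial>P 3) = 0" using eta_pos m1 m2 by simp
  with m1 m2 assms show ?thesis by auto
qed

text \<open>\<open>Av\<close>, \<open>Bv\<close> and \<open>Lv\<close> are the logistic information
  operators of the unlabeled sample at \<open>\<rho>\<close>, of all samples at
  \<open>\<alpha>\<close> and of the labeled samples at \<open>a_lab\<close>. Each is taken at the
  logit of the true proportion of the samples involved, which makes it a multiple of a single moment
  \<open>I2\<close>.\<close>

definition Av :: "real ^ 'p option \<Rightarrow> real ^ 'p option" where
  "Av c = \<eta> 3 *\<^sub>R info 3 (\<beta> + logit \<rho> *\<^sub>R e0) c"

definition Bv :: "real ^ 'p option \<Rightarrow> real ^ 'p option" where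
  "Bv c = (\<Sum>j\<in>{1, 2, 3}. \<eta> j *\<^sub>R info j (\<beta> + logit \<alpha> *\<^sub>R e0) c)"

definition Lv :: "real ^ 'p option \<Rightarrow> real ^ 'p option" where
  "Lv c = (\<Sum>j\<in>{1, 2}. \<eta> j *\<^sub>R info j (\<beta> + logit a_lab *\<^sub>R e0) c)"

text \<open>The curvature in \<open>\<beta>\<close> after eliminating both proportions, a Schur
  complement with the signs of a saddle point: profiling the maximized \<open>\<rho>\<close>
  subtracts information, profiling the minimized \<open>\<alpha>\<close> adds some.\<close>

definition Jv :: "real ^ 'p option \<Rightarrow> real ^ 'p option" where
  "Jv c = Bv c - Av c - proj \<rho> c *\<^sub>R Av e0 + proj \<alpha> c *\<^sub>R Bv e0"

text \<open>The hypothesis \<open>w\<close> says that the weighted samples pool to a mixture with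
  proportion \<open>s\<close>; under its density the logistic weights at shift
  \<open>logit s\<close> simplify by the last identity of \<open>ratio_eq\<close>.\<close>

lemma info_sum_inner:
  assumes s: "0 < s" "s < 1" and J: "J' \<subseteq> {1, 2, 3}"
    and w: "\<And>t. (\<Sum>j\<in>J'. a j * tilt_density (mixprop \<rho> j) t) = K * tilt_density s t"
  shows "(\<Sum>j\<in>J'. a j *\<^sub>R info j (\<beta> + logit s *\<^sub>R e0) c) \<bullet> d = K * s * (1 - s) * I2 s c d"
proof -
  let ?b = "\<beta> + logit s *\<^sub>R e0"
  let ?g = "\<lambda>y. logistic' (?b \<bullet> design y) * (c \<bullet> design y) * (d \<bullet> design y)"
  have int: "integrable G0 (\<lambda>y. tilt_density (mixprop \<rho> j) (linpred \<beta> y) * ?g y)" if "j \<in> J'" for j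
    using info_inner_integrable[of j ?b c d] that J integral_P(1)[of ?g j] by auto
  have "(\<Sum>j\<in>J'. a j *\<^sub>R info j ?b c) \<bullet> d = (\<Sum>j\<in>J'. a j * (info j ?b c \<bullet> d))"
    by (simp add: inner_sum_left)
  also have "\<dots> = (\<Sum>j\<in>J'. a j * (\<integral>y. tilt_density (mixprop \<rho> j) (linpred \<beta> y) * ?g y \<partial>G0))"
    using J by (intro sum.cong refl) (auto simp: info_inner integral_P(2)[of ?g])
  also have "\<dots> = (\<integral>y. (\<Sum>j\<in>J'. a j * (tilt_density (mixprop \<rho> j) (linpred \<beta> y) * ?g y)) \<partial>G0)"
    using int by simp
  also have "\<dots> = (\<integral>y. K * s * (1 - s) * (ratio s y * ((c \<bullet> design y) * (d \<bullet> design y))) \<partial>G0)"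
  proof (rule Bochner_Integration.integral_cong[OF refl])
    fix y
    have "(\<Sum>j\<in>J'. a j * (tilt_density (mixprop \<rho> j) (linpred \<beta> y) * ?g y)) = (\<Sum>j\<in>J'. a j * tilt_density (mixprop \<rho> j) (linpred \<beta> y)) * ?g y"
      by (simp add: sum_distrib_right mult.assoc)
    also have "\<dots> = K * (tilt_density s (linpred \<beta> y) * logistic' (linpred \<beta> y + logit s)) * ((c \<bullet> design y) * (d \<bullet> design y))"
      unfolding w inner_shift by (simp add: mult_ac)
    finally show "(\<Sum>j\<in>J'. a j * (tilt_density (mixprop \<rho> j) (linpred \<beta> y) * ?g y)) = K * s * (1 - s) * (ratio s y * ((c \<bullet> design y) * (d \<bullet> design y)))"
      unfolding ratio_eq(6)[OF s] by (simp add: mult_ac)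
  qed
  finally show ?thesis by (simp add: I2_def)
qed

lemma Av_inner: "Av c \<bullet> d = \<eta> 3 * \<rho> * (1 - \<rho>) * I2 \<rho> c d"
  using info_sum_inner[OF mixing_proportion, of "{3}" \<eta> "\<eta> 3" c d] by (simp add: Av_def tilt_density_mixprop)

lemma Bv_inner: "Bv c \<bullet> d = \<alpha> * (1 - \<alpha>) * I2 \<alpha> c d"
proof -
  have "(\<Sum>j\<in>{1, 2, 3}. \<eta> j * tilt_density (mixprop \<rho> j) t) = 1 * tilt_density \<alpha> t" for t
  proof -
    have e1: "\<eta> 1 = 1 - \<eta> 2 - \<eta> 3" using sum_eta by linarith
    show ?thesis using e1 by (simp add: mixprop_def tilt_density_def \<alpha>_def algebra_simps)
  qed
  from info_sum_inner[OF alpha_range _ this] show ?thesis by (simp add: Bv_def)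
qed

lemma Lv_inner: "Lv c \<bullet> d = (\<eta> 1 + \<eta> 2) * a_lab * (1 - a_lab) * I2 a_lab c d"
proof -
  have h: "\<eta> 2 = (\<eta> 1 + \<eta> 2) * a_lab" "\<eta> 1 = (\<eta> 1 + \<eta> 2) * (1 - a_lab)"
    using eta_pos by (auto simp: a_lab_def field_simps)
  have "(\<Sum>j\<in>{1, 2}. \<eta> j * tilt_density (mixprop \<rho> j) t) = (\<eta> 1 + \<eta> 2) * tilt_density a_lab t" for t
  proof -
    have "(\<Sum>j\<in>{1, 2}. \<eta> j * tilt_density (mixprop \<rho> j) t) = \<eta> 1 + \<eta> 2 * exp t"
      by (simp add: tilt_density_mixprop)
    also have "\<dots> = (\<eta> 1 + \<eta> 2) * (1 - a_lab) + (\<eta> 1 + \<eta> 2) * a_lab * exp t"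
      by (rule arg_cong2[where f = "\<lambda>u v. u + v * exp t", OF h(2,1)])
    finally show ?thesis by (simp add: tilt_density_def algebra_simps)
  qed
  from info_sum_inner[OF a_lab_range _ this] show ?thesis by (simp add: Lv_def)
qed

lemma Jv_inner: "Jv c \<bullet> d = \<alpha> * (1 - \<alpha>) * I2 \<alpha> c d - \<eta> 3 * \<rho> * (1 - \<rho>) * I2 \<rho> c d
   - \<eta> 3 * \<rho> * (1 - \<rho>) * proj \<rho> c * I1 \<rho> d + \<alpha> * (1 - \<alpha>) * proj \<alpha> c * I1 \<alpha> d"
  by (simp add: Jv_def inner_diff_left inner_add_left Av_inner Bv_inner I2_e0 mult_ac)

text \<open>The information identity for the efficient score, variance equal to curvature. The
  squares become linear in moments under \<open>G0\<close>, and
  \<open>proj s c * (1 - I0 s) = I1 s c\<close> for both proportions merges the remaining terms into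
  \<open>Jv\<close>.\<close>

lemma sum_eff_square:
  "(\<Sum>j\<in>{1, 2, 3}. \<eta> j * (\<integral>y. (eff (logit \<alpha>) c j y)\<^sup>2 \<partial>P j)) = Jv c \<bullet> c"
proof -
  note s = alpha_range and r = mixing_proportion
  define A B K where "A = proj \<rho> c" and "B = proj \<alpha> c" and "K = \<eta> 3 * \<rho> * (1 - \<rho>)"
  define C where "C = 2 * K * A - B * \<alpha> * (1 - \<alpha>)"
  let ?f = "\<lambda>j y. tilt_density (mixprop \<rho> j) (linpred \<beta> y) * (eff (logit \<alpha>) c j y)\<^sup>2"
  have meas: "(\<lambda>y. (eff (logit \<alpha>) c j y)\<^sup>2) \<in> borel_measurable borel" for j by measurable
  have int: "integrable G0 (?f j)" if "j \<in> {1, 2, 3}" for j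
    by (rule iffD1[OF integral_P(1)[OF meas] eff_square_integrable[OF that]])
  have pt: "(\<Sum>j\<in>{1, 2, 3}. \<eta> j * ?f j y) = 
    \<alpha> * (1 - \<alpha>) * (ratio \<alpha> y * ((c \<bullet> design y) * (c \<bullet> design y))) + (- K) * (ratio \<rho> y * ((c \<bullet> design y) * (c \<bullet> design y))) 
    + 2 * K * A * (ratio \<alpha> y * (c \<bullet> design y)) + C * B * ratio \<alpha> y
    + (- 2 * K * A) * (ratio \<rho> y * (c \<bullet> design y)) + (K * A\<^sup>2 * (1 - \<rho>) - C * B * (1 - \<alpha>)) * tilt_ratio y
    + (- K * A\<^sup>2) * ratio \<rho> y + (K * A\<^sup>2 * \<rho> - C * B * \<alpha>)" for y
  proof -
    have "(\<Sum>j\<in>{1, 2, 3}. \<eta> j * ?f j y) = \<eta> 1 * (- \<alpha> * ratio \<alpha> y * (c \<bullet> design y) - B * (\<alpha> * ratio \<alpha> y - \<alpha>))\<^sup>2 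
       + \<eta> 2 * tilt_ratio y * ((c \<bullet> design y) + (- \<alpha> * ratio \<alpha> y * (c \<bullet> design y) - B * (\<alpha> * ratio \<alpha> y - \<alpha>)))\<^sup>2
       + \<eta> 3 * (1 - \<rho> + \<rho> * tilt_ratio y) * (\<rho> * ratio \<rho> y * (c \<bullet> design y) + A * (\<rho> * ratio \<rho> y - \<rho>) + (- \<alpha> * ratio \<alpha> y * (c \<bullet> design y) - B * (\<alpha> * ratio \<alpha> y - \<alpha>)))\<^sup>2"
      by (simp add: eff_def mixprop_def Q_logit s r logistic_logit A_def B_def tilt_density_def) (simp add: algebra_simps)
    also note efficient_score_square_linear[OF ratio_eq(2)[OF s, of y] ratio_eq(2)[OF r, of y], of "\<eta> 2" "\<eta> 3" "\<eta> 1" "c \<bullet> design y" B A]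
    finally show ?thesis using sum_eta by (simp add: C_def K_def \<alpha>_def algebra_simps)
  qed
  have "(\<Sum>j\<in>{1, 2, 3}. \<eta> j * (\<integral>y. (eff (logit \<alpha>) c j y)\<^sup>2 \<partial>P j)) = (\<integral>y. (\<Sum>j\<in>{1, 2, 3}. \<eta> j * ?f j y) \<partial>G0)"
    using int[of 1] int[of 2] int[of 3] by (simp add: integral_P(2)[OF meas])
  also have "\<dots> = \<alpha> * (1 - \<alpha>) * I2 \<alpha> c c - K * I2 \<rho> c c + 2 * K * A * I1 \<alpha> c + C * B * I0 \<alpha>
     - 2 * K * A * I1 \<rho> c + (K * A\<^sup>2 * (1 - \<rho>) - C * B * (1 - \<alpha>)) - K * A\<^sup>2 * I0 \<rho> + (K * A\<^sup>2 * \<rho> - C * B * \<alpha>)"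
    unfolding pt using ratio_integrable(1)[OF s] ratio_integrable(2,3)[OF s, of c] ratio_integrable(1)[OF r] ratio_integrable(2,3)[OF r, of c] tilt_ratio_integral
    by (simp add: I2_def I1_def I0_def G0.prob_space)
  also have "\<dots> = \<alpha> * (1 - \<alpha>) * I2 \<alpha> c c - K * I2 \<rho> c c + 2 * K * A * I1 \<alpha> c - C * (B * (1 - I0 \<alpha>))
     - 2 * K * A * I1 \<rho> c + K * A * (A * (1 - I0 \<rho>))"
    by (simp add: power2_eq_square algebra_simps)
  also have "\<dots> = Jv c \<bullet> c"
    unfolding A_def B_def proj_eq[OF s] proj_eq[OF r] Jv_inner C_def K_def by (simp add: algebra_simps)
  finally show ?thesis .
qed

text \<open>In sample 2 the efficient score exceeds its value \<open>h\<close> in sample 1 by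
  \<open>c \<bullet> design y\<close>. The weighted labeled scores of the two samples are pointwise
  opposite under \<open>G0\<close>, so \<open>h\<close> cancels, and sample 3 contributes nothing.
  The result depends on the efficient score only through that difference.\<close>

lemma sum_lab_eff: "(\<Sum>j\<in>{1, 2, 3}. \<eta> j * (\<integral>y. lab (logit a_lab) u j y * eff (logit \<alpha>) c j y \<partial>P j)) = Lv u \<bullet> c"
proof -
  note s = a_lab_range
  let ?f = "\<lambda>j y. tilt_density (mixprop \<rho> j) (linpred \<beta> y) * (lab (logit a_lab) u j y * eff (logit \<alpha>) c j y)"
  have meas: "(\<lambda>y. lab (logit a_lab) u j y * eff (logit \<alpha>) c j y) \<in> borel_measurable borel" for j by measurable
  have int: "integrable G0 (?f j)" if "j \<in> {1, 2, 3}" for j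
  proof -
    have "integrable (P j) (\<lambda>y. lab (logit a_lab) u j y * eff (logit \<alpha>) c j y)"
    proof (rule integrable_dominated_\<phi>[OF that meas])
      fix y
      have "\<bar>lab (logit a_lab) u j y\<bar> * \<bar>eff (logit \<alpha>) c j y\<bar> \<le> (norm u * norm (design y)) * ((3 * norm c + \<bar>proj \<rho> c\<bar> + \<bar>proj \<alpha> c\<bar>) * norm (design y))"
        by (intro mult_mono lab_bound eff_bound) auto
      then show "norm (lab (logit a_lab) u j y * eff (logit \<alpha>) c j y) \<le> (norm u * (3 * norm c + \<bar>proj \<rho> c\<bar> + \<bar>proj \<alpha> c\<bar>)) * (norm (design y))\<^sup>2"
        by (simp add: abs_mult power2_eq_square mult_ac)
    qed
    then show ?thesis by (rule iffD1[OF integral_P(1)[OF meas]])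
  qed
  have \<eta>: "\<eta> 2 = (\<eta> 1 + \<eta> 2) * a_lab" "\<eta> 1 = (\<eta> 1 + \<eta> 2) * (1 - a_lab)"
    using eta_pos by (auto simp: a_lab_def field_simps)
  have pt: "(\<Sum>j\<in>{1, 2, 3}. \<eta> j * ?f j y) = (\<eta> 1 + \<eta> 2) * a_lab * (1 - a_lab) * (ratio a_lab y * ((u \<bullet> design y) * (c \<bullet> design y)))" for y
  proof -
    define h where "h = eff (logit \<alpha>) c 1 y"
    have e2: "eff (logit \<alpha>) c 2 y = c \<bullet> design y + h" by (simp add: h_def eff_def)
    have l1: "lab (logit a_lab) u 1 y = - a_lab * ratio a_lab y * (u \<bullet> design y)" by (simp add: lab_def Q_logit s)
    have l2: "tilt_ratio y * lab (logit a_lab) u 2 y = (1 - a_lab) * ratio a_lab y * (u \<bullet> design y)"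
    proof -
      have "tilt_ratio y * lab (logit a_lab) u 2 y = (tilt_ratio y - a_lab * tilt_ratio y * ratio a_lab y) * (u \<bullet> design y)"
        by (simp add: lab_def Q_logit s algebra_simps)
      then show ?thesis unfolding ratio_eq(2)[OF s] by simp
    qed
    have "(\<Sum>j\<in>{1, 2, 3}. \<eta> j * ?f j y) = \<eta> 1 * (lab (logit a_lab) u 1 y * h) + \<eta> 2 * ((tilt_ratio y * lab (logit a_lab) u 2 y) * (c \<bullet> design y + h))"
      using e2 by (simp add: tilt_density_mixprop h_def lab_def[of _ _ 3])
    also have "\<dots> = (\<eta> 2 * (1 - a_lab)) * (ratio a_lab y * ((u \<bullet> design y) * (c \<bullet> design y)))
        + (\<eta> 2 * (1 - a_lab) - \<eta> 1 * a_lab) * ratio a_lab y * (u \<bullet> design y) * h"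
      unfolding l1 l2 by (simp add: algebra_simps)
    also have "\<eta> 2 * (1 - a_lab) = (\<eta> 1 + \<eta> 2) * a_lab * (1 - a_lab)" using \<eta>(1) by simp
    also have "\<eta> 1 * a_lab = (\<eta> 1 + \<eta> 2) * a_lab * (1 - a_lab)" using \<eta>(2) by (simp add: mult_ac)
    finally show ?thesis by simp
  qed
  have "(\<Sum>j\<in>{1, 2, 3}. \<eta> j * (\<integral>y. lab (logit a_lab) u j y * eff (logit \<alpha>) c j y \<partial>P j)) = (\<integral>y. (\<Sum>j\<in>{1, 2, 3}. \<eta> j * ?f j y) \<partial>G0)"
    using int[of 1] int[of 2] int[of 3] by (simp add: integral_P(2)[OF meas])
  also have "\<dots> = Lv u \<bullet> c" unfolding pt Lv_inner by (simp add: I2_def)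
  finally show ?thesis .
qed

text \<open>The shift \<open>ln (n2 / n1)\<close> is the logit of the labeled proportion
  \<open>n2 / (n1 + n2)\<close>; with it the two labeled integrands cancel pointwise under
  \<open>G0\<close>.\<close>

lemma lab_mean_total:
  assumes "n1 > 0" "n2 > 0"
  shows "n1 * (\<integral>y. lab (ln (n2 / n1)) c 1 y \<partial>P 1) + n2 * (\<integral>y. lab (ln (n2 / n1)) c 2 y \<partial>P 2) + n3 * (\<integral>y. lab (ln (n2 / n1)) c 3 y \<partial>P 3) = 0"
proof -
  define s where "s = n2 / (n1 + n2)"
  have s: "0 < s" "s < 1" using assms by (auto simp: s_def)
  have l: "ln (n2 / n1) = logit s" 
  proof -
    have "1 - s = n1 / (n1 + n2)" using assms by (simp add: s_def field_simps)
    then have "s / (1 - s) = n2 / n1" using assms by (simp add: s_def)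
    then show ?thesis by (simp add: logit_def)
  qed
  have ns: "n1 * s = n2 * (1 - s)" using assms by (simp add: s_def field_simps)
  let ?f = "\<lambda>j y. tilt_density (mixprop \<rho> j) (linpred \<beta> y) * lab (logit s) c j y"
  have int: "integrable G0 (?f j)" if "j \<in> {1, 2, 3}" for j
    by (rule iffD1[OF integral_P(1)[OF lab_measurable] lab_integrable[OF that]])
  have pt: "n1 * ?f 1 y + n2 * ?f 2 y = 0" for y
  proof -
    have "n1 * ?f 1 y + n2 * ?f 2 y = - (n1 * s) * ratio s y * (c \<bullet> design y) + n2 * (tilt_ratio y - s * tilt_ratio y * ratio s y) * (c \<bullet> design y)"
      by (simp add: tilt_density_mixprop lab_def Q_logit s algebra_simps)
    then show ?thesis unfolding ratio_eq(2)[OF s] ns by (simp add: algebra_simps)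
  qed
  have "n1 * (\<integral>y. ?f 1 y \<partial>G0) + n2 * (\<integral>y. ?f 2 y \<partial>G0) = (\<integral>y. n1 * ?f 1 y + n2 * ?f 2 y \<partial>G0)"
    using int[of 1] int[of 2] by simp
  also have "\<dots> = 0" unfolding pt by simp
  finally show ?thesis unfolding l by (simp add: integral_P(2)[OF lab_measurable] lab_def[of _ _ 3])
qed

text \<open>Within-sample variances, since the labeled score is centred only after pooling its two
  samples; the comparison uses this quantity through \<open>variance_inequality\<close>
  alone.\<close>

definition lab_var :: "real ^ 'p option \<Rightarrow> real" where
  "lab_var u = (\<Sum>j\<in>{1, 2, 3}. \<eta> j * var j (lab (logit a_lab) u j))"

lemma sum_var_eff: "(\<Sum>j\<in>{1, 2, 3}. \<eta> j * var j (eff (logit \<alpha>) c j)) = Jv c \<bullet> c"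
proof -
  have "var j (eff (logit \<alpha>) c j) = (\<integral>y. (eff (logit \<alpha>) c j y)\<^sup>2 \<partial>P j)" if "j \<in> {1, 2, 3}" for j
    using eff_mean[OF that] by (simp add: var_def)
  then show ?thesis unfolding sum_eff_square[symmetric] by simp
qed

text \<open>Because \<open>eff\<close> is centred in every sample, each within-sample covariance is
  the plain integral of the product, and \<open>sum_lab_eff\<close> evaluates their weighted
  sum.\<close>

lemma variance_inequality: "0 \<le> lab_var u - 2 * (Lv u \<bullet> c) + Jv c \<bullet> c"
proof -
  have "var j (\<lambda>y. lab (logit a_lab) u j y - eff (logit \<alpha>) c j y) = 
      var j (lab (logit a_lab) u j) - 2 * (\<integral>y. lab (logit a_lab) u j y * eff (logit \<alpha>) c j y \<partial>P j)
       + (\<integral>y. (eff (logit \<alpha>) c j y)\<^sup>2 \<partial>P j)" if j: "j \<in> {1, 2, 3}" for j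
  proof -
    let ?l = "lab (logit a_lab) u j" and ?e = "eff (logit \<alpha>) c j"
    define K where "K = norm u + (3 * norm c + \<bar>proj \<rho> c\<bar> + \<bar>proj \<alpha> c\<bar>)"
    have b: "\<bar>?l y - ?e y\<bar> \<le> K * norm (design y)" for y
      using lab_bound[of "logit a_lab" u j y] eff_bound[of "logit \<alpha>" c j y] by (simp add: K_def distrib_right)
    have d: "integrable (P j) (\<lambda>y. (?l y - ?e y)\<^sup>2)"
      by (rule square_integrable_of_bound[OF j _ b]) measurable
    note i = lab_square_integrable[OF j, of "logit a_lab" u] eff_square_integrable[OF j, of "logit \<alpha>" c]
    \<comment> \<open>Polarization supplies the integrability of the product.\<close>
    have prod: "?l y * ?e y = ((?l y)\<^sup>2 + (?e y)\<^sup>2 - (?l y - ?e y)\<^sup>2) / 2" for y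
      by (simp add: power2_diff)
    have "integrable (P j) (\<lambda>y. ?l y * ?e y)" unfolding prod using i d by simp
    then have "(\<integral>y. (?l y - ?e y)\<^sup>2 \<partial>P j) = (\<integral>y. (?l y)\<^sup>2 \<partial>P j) - 2 * (\<integral>y. ?l y * ?e y \<partial>P j) + (\<integral>y. (?e y)\<^sup>2 \<partial>P j)"
      using i by (simp add: power2_diff mult.assoc)
    moreover have "(\<integral>y. ?l y - ?e y \<partial>P j) = (\<integral>y. ?l y \<partial>P j)"
      using lab_integrable[OF j, of "logit a_lab" u] eff_integrable[OF j, of "logit \<alpha>" c] eff_mean[OF j, of c] by simp
    ultimately show ?thesis
      using var_eq[OF j _ d] var_eq[OF j _ i(1)] by simp
  qed
  note v = this
  have "0 \<le> (\<Sum>j\<in>{1, 2, 3}. \<eta> j * var j (\<lambda>y. lab (logit a_lab) u j y - eff (logit \<alpha>) c j y))"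
    using sizes(3) by (intro sum_nonneg mult_nonneg_nonneg var_nonneg) (simp add: less_imp_le)
  also have "\<dots> = (\<Sum>j\<in>{1, 2, 3}. \<eta> j * var j (lab (logit a_lab) u j) - 2 * (\<eta> j * (\<integral>y. lab (logit a_lab) u j y * eff (logit \<alpha>) c j y \<partial>P j))
       + \<eta> j * (\<integral>y. (eff (logit \<alpha>) c j y)\<^sup>2 \<partial>P j))"
  proof (rule sum.cong[OF refl])
    fix j :: nat assume "j \<in> {1, 2, 3}"
    show "\<eta> j * var j (\<lambda>y. lab (logit a_lab) u j y - eff (logit \<alpha>) c j y) =
      \<eta> j * var j (lab (logit a_lab) u j) - 2 * (\<eta> j * (\<integral>y. lab (logit a_lab) u j y * eff (logit \<alpha>) c j y \<partial>P j))
       + \<eta> j * (\<integral>y. (eff (logit \<alpha>) c j y)\<^sup>2 \<partial>P j)"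
      unfolding v[OF \<open>j \<in> {1, 2, 3}\<close>] by (simp add: algebra_simps)
  qed
  also have "\<dots> = lab_var u - 2 * (Lv u \<bullet> c) + Jv c \<bullet> c"
    unfolding sum_lab_eff[symmetric] sum_eff_square[symmetric] lab_var_def sum.distrib sum_subtractf sum_distrib_left ..
  finally show ?thesis .
qed

lemma Lv_pos: "c \<noteq> 0 \<Longrightarrow> 0 < Lv c \<bullet> c"
  unfolding Lv_inner using eta_pos a_lab_range I2_pos[OF a_lab_range] by simp

end

section \<open>Linearization of the estimators\<close>

context samples
begin

lemma nsum_eq_emp: "nsum f p = sqrt (real (N (fst p))) * (\<Sum>j\<in>J. emp j (f j) p)"
proof -
  have *: "sqrt r * (s / r) = s / sqrt r" if "0 \<le> r" for r s :: real
    using that by (cases "r = 0") (simp_all add: field_simps)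
  show ?thesis unfolding nsum_def emp_def sum_divide_distrib[symmetric] by (rule *[symmetric]) simp
qed

lemma tendsto_of_bounded_in_prob:
  assumes "bounded_in_prob M (\<lambda>p. sqrt (real (N (fst p))) * g p)"
  shows "(g \<longlongrightarrow> 0) (wp1 M)"
proof -
  have "(\<lambda>k. sqrt (1 / real (N k))) \<longlonglongrightarrow> 0" using tendsto_real_sqrt[OF inverse_N] by simp
  then have "((\<lambda>p. sqrt (1 / real (N (fst p)))) \<longlongrightarrow> 0) (wp1 M)" by (rule tendsto_fst_wp1)
  from bounded_in_probD[OF assms this]
  have "((\<lambda>p. sqrt (1 / real (N (fst p))) * (sqrt (real (N (fst p))) * g p)) \<longlongrightarrow> 0) (wp1 M)" .
  then show ?thesis
  proof (rule Lim_transform_eventually)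
    show "\<forall>\<^sub>F p in wp1 M. sqrt (1 / real (N (fst p))) * (sqrt (real (N (fst p))) * g p) = g p"
      using eventually_fst_wp1[OF N_pos] by eventually_elim (simp add: real_sqrt_divide)
  qed
qed

end

context feature_samples
begin

lemma score_expansion_sum:
  assumes J': "J' \<subseteq> J" and lim: "(b \<longlongrightarrow> b0) (wp1 M)" "(b' \<longlongrightarrow> b0) (wp1 M)"
  obtains Y where "(Y \<longlongrightarrow> 0) (wp1 M)"
    "\<And>p. \<bar>(\<Sum>j\<in>J'. score j (b p) c p) - (\<Sum>j\<in>J'. score j (b' p) c p)
        - ((\<Sum>j\<in>J'. \<eta> j *\<^sub>R info j b0 c) \<bullet> (b p - b' p))\<bar> \<le> Y p * norm (b p - b' p)"
proof -
  have "\<exists>Y. (Y \<longlongrightarrow> 0) (wp1 M) \<and> (\<forall>p. \<bar>score j (b p) c p - score j (b' p) c p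
      - \<eta> j * (info j b0 c \<bullet> (b p - b' p))\<bar> \<le> Y p * norm (b p - b' p))" if "j \<in> J'" for j
    using score_expansion[OF _ lim, of j c] that J' by (metis subsetD)
  then obtain Y where Y: "\<And>j. j \<in> J' \<Longrightarrow> (Y j \<longlongrightarrow> 0) (wp1 M)"
    "\<And>j p. j \<in> J' \<Longrightarrow> \<bar>score j (b p) c p - score j (b' p) c p
      - \<eta> j * (info j b0 c \<bullet> (b p - b' p))\<bar> \<le> Y j p * norm (b p - b' p)"
    by metis
  have "((\<lambda>p. \<Sum>j\<in>J'. Y j p) \<longlongrightarrow> (\<Sum>j\<in>J'. 0)) (wp1 M)" by (intro tendsto_sum Y(1))
  moreover have "\<bar>(\<Sum>j\<in>J'. score j (b p) c p) - (\<Sum>j\<in>J'. score j (b' p) c p)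
        - ((\<Sum>j\<in>J'. \<eta> j *\<^sub>R info j b0 c) \<bullet> (b p - b' p))\<bar> \<le> (\<Sum>j\<in>J'. Y j p) * norm (b p - b' p)" for p
  proof -
    have "(\<Sum>j\<in>J'. score j (b p) c p) - (\<Sum>j\<in>J'. score j (b' p) c p)
        - ((\<Sum>j\<in>J'. \<eta> j *\<^sub>R info j b0 c) \<bullet> (b p - b' p))
      = (\<Sum>j\<in>J'. score j (b p) c p - score j (b' p) c p - \<eta> j * (info j b0 c \<bullet> (b p - b' p)))"
      by (simp add: inner_sum_left sum_subtractf)
    also have "\<bar>\<dots>\<bar> \<le> (\<Sum>j\<in>J'. Y j p * norm (b p - b' p))"
      by (rule order_trans[OF sum_abs sum_mono]) (rule Y(2))
    finally show ?thesis by (simp add: sum_distrib_right)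
  qed
  ultimately show ?thesis using that by simp
qed

end

section \<open>Consistency and linearization of the two mixing proportions\<close>

context ETM_asymptotics
begin

abbreviation rN :: "nat \<times> 'w \<Rightarrow> real" where "rN p \<equiv> sqrt (real (total_size (n (fst p))))"

lemma tilt_score_measurable[measurable]: "tilt_score a \<in> borel_measurable borel"
  unfolding tilt_score_def[abs_def] by measurable

lemma tilt_score_logistic: "0 < a \<Longrightarrow> a < 1 \<Longrightarrow> tilt_score a t = (logistic (t + logit a) - a) / (a * (1 - a))"
  by (simp add: logistic_tilt_score)

lemma emp_const: "emp j (\<lambda>_. c) p = c * (real (n (fst p) j) / real (total_size (n (fst p))))"
  by (simp add: emp_def)

lemma score_shift: "score j (b + \<zeta> *\<^sub>R e0) c p = emp j (\<lambda>y. logistic (linpred b y + \<zeta>) * (c \<bullet> design y)) p"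
  unfolding score_def inner_shift ..

text \<open>The random \<open>b p\<close> inside the summands is handled by passing to the logistic
  score in the intercept direction, where \<open>score_consistent\<close> applies.\<close>

lemma emp_tilt_score_tendsto:
  assumes j: "j \<in> {1, 2, 3}" and a: "0 < a" "a < 1" and b: "(b \<longlongrightarrow> \<beta>) (wp1 M)"
  shows "((\<lambda>p. emp j (\<lambda>y. tilt_score a (linpred (b p) y)) p) \<longlongrightarrow> \<eta> j * (\<integral>y. tilt_score a (linpred \<beta> y) \<partial>P j)) (wp1 M)"
proof -
  interpret Pj: prob_space "P j" by (rule prob_space_P[OF j])
  have eq: "emp j (\<lambda>y. tilt_score a (linpred b' y)) p = 
     (score j (b' + logit a *\<^sub>R e0) e0 p - a * (real (n (fst p) j) / real (total_size (n (fst p))))) / (a * (1 - a))" for b' p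
  proof -
    have "emp j (\<lambda>y. tilt_score a (linpred b' y)) p = emp j (\<lambda>y. 1 / (a * (1 - a)) * (logistic (linpred b' y + logit a) - a)) p"
      by (simp add: tilt_score_logistic[OF a])
    then show ?thesis unfolding emp_cmult emp_diff emp_const score_shift by simp
  qed
  have "((\<lambda>p. b p + logit a *\<^sub>R e0) \<longlongrightarrow> \<beta> + logit a *\<^sub>R e0) (wp1 M)" by (intro tendsto_intros b)
  from score_consistent[OF j this, of e0]
  have 1: "((\<lambda>p. score j (b p + logit a *\<^sub>R e0) e0 p) \<longlongrightarrow> \<eta> j * (\<integral>y. logistic (linpred \<beta> y + logit a) \<partial>P j)) (wp1 M)"
    unfolding inner_shift by simp
  have 2: "((\<lambda>p. real (n (fst p) j) / real (total_size (n (fst p)))) \<longlongrightarrow> \<eta> j) (wp1 M)"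
    by (rule tendsto_fst_wp1[OF proportions[OF j]])
  have "((\<lambda>p. emp j (\<lambda>y. tilt_score a (linpred (b p) y)) p) \<longlongrightarrow> 
      (\<eta> j * (\<integral>y. logistic (linpred \<beta> y + logit a) \<partial>P j) - a * \<eta> j) / (a * (1 - a))) (wp1 M)"
    unfolding eq using a by (intro tendsto_divide tendsto_diff tendsto_mult 1 2 tendsto_const) auto
  moreover
  have "(\<integral>y. tilt_score a (linpred \<beta> y) \<partial>P j) = ((\<integral>y. logistic (linpred \<beta> y + logit a) \<partial>P j) - a) / (a * (1 - a))"
  proof -
    have "integrable (P j) (\<lambda>y. logistic (linpred \<beta> y + logit a))"
      by (rule Pj.integrable_const_bound[of _ 1]) (auto simp: logistic_bounds less_imp_le measurable_P[OF j] abs_of_pos)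
    then show ?thesis unfolding tilt_score_logistic[OF a] by (simp add: Pj.prob_space)
  qed
  then have "(\<eta> j * (\<integral>y. logistic (linpred \<beta> y + logit a) \<partial>P j) - a * \<eta> j) / (a * (1 - a)) = \<eta> j * (\<integral>y. tilt_score a (linpred \<beta> y) \<partial>P j)"
    by (simp add: right_diff_distrib mult.commute)
  ultimately show ?thesis by simp
qed

text \<open>With weights \<open>a j\<close> of total \<open>K\<close>, pooling the samples in \<open>J'\<close> gives a mixture with proportion \<open>\<theta>\<close>.\<close>

definition pooled :: "nat set \<Rightarrow> (nat \<Rightarrow> real) \<Rightarrow> real \<Rightarrow> real \<Rightarrow> bool" where
  "pooled J' a K \<theta> \<longleftrightarrow> J' \<subseteq> {1, 2, 3} \<and> (\<forall>t. (\<Sum>j\<in>J'. a j * tilt_density (mixprop \<rho> j) t) = K * tilt_density \<theta> t)"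

lemma sum_integral_pooled:
  fixes g :: "real ^ 'p \<Rightarrow> real"
  assumes pool: "pooled J' a K \<theta>" and g: "g \<in> borel_measurable borel" "\<And>j. j \<in> J' \<Longrightarrow> integrable (P j) g"
  shows "(\<Sum>j\<in>J'. a j * (\<integral>y. g y \<partial>P j)) = (\<integral>y. K * (tilt_density \<theta> (linpred \<beta> y) * g y) \<partial>G0)"
proof -
  have int: "integrable G0 (\<lambda>y. tilt_density (mixprop \<rho> j) (linpred \<beta> y) * g y)" if "j \<in> J'" for j
    by (rule iffD1[OF integral_P(1)[OF g(1)] g(2)[OF that]])
  have "(\<Sum>j\<in>J'. a j * (\<integral>y. g y \<partial>P j)) = (\<integral>y. (\<Sum>j\<in>J'. a j * (tilt_density (mixprop \<rho> j) (linpred \<beta> y) * g y)) \<partial>G0)"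
    unfolding integral_P(2)[OF g(1)] using int by simp
  also have "\<dots> = (\<integral>y. K * (tilt_density \<theta> (linpred \<beta> y) * g y) \<partial>G0)"
  proof (rule Bochner_Integration.integral_cong[OF refl])
    fix y
    have "(\<Sum>j\<in>J'. a j * (tilt_density (mixprop \<rho> j) (linpred \<beta> y) * g y)) = (\<Sum>j\<in>J'. a j * tilt_density (mixprop \<rho> j) (linpred \<beta> y)) * g y"
      by (simp add: sum_distrib_right mult.assoc)
    then show "(\<Sum>j\<in>J'. a j * (tilt_density (mixprop \<rho> j) (linpred \<beta> y) * g y)) = K * (tilt_density \<theta> (linpred \<beta> y) * g y)"
      using pool by (simp add: pooled_def)
  qed
  finally show ?thesis .
qed

lemma bounded_integrable_P:
  fixes g :: "real ^ 'p \<Rightarrow> real"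
  assumes "j \<in> {1, 2, 3}" "g \<in> borel_measurable borel" "\<And>y. \<bar>g y\<bar> \<le> K"
  shows "integrable (P j) g"
proof -
  interpret Pj: prob_space "P j" by (rule prob_space_P[OF assms(1)])
  show ?thesis
    by (rule Pj.integrable_const_bound[of _ K]) (use assms in \<open>auto simp: measurable_P[OF assms(1)]\<close>)
qed

lemma tilt_score_bounded:
  assumes "0 < a" "a < 1"
  shows "\<bar>tilt_score a t\<bar> \<le> 1 / (a * (1 - a))"
proof -
  have "\<bar>logistic (t + logit a) - a\<bar> \<le> 1" using logistic_bounds[of "t + logit a"] assms by linarith
  then show ?thesis unfolding tilt_score_logistic[OF assms] using assms by (simp add: abs_divide divide_right_mono)
qed

text \<open>An exact value whose sign is visible: by \<open>I0_less_1\<close>, for positive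
  \<open>K\<close>, the pooled expected score at \<open>a\<close> has the sign of
  \<open>\<theta> - a\<close>.\<close>

lemma pooled_tilt_score_integral:
  assumes pool: "pooled J' \<eta> K \<theta>" and a: "0 < a" "a < 1"
  shows "(\<Sum>j\<in>J'. \<eta> j * (\<integral>y. tilt_score a (linpred \<beta> y) \<partial>P j)) = K * (\<theta> - a) * (1 - I0 a) / (a * (1 - a))"
proof -
  have "(\<Sum>j\<in>J'. \<eta> j * (\<integral>y. tilt_score a (linpred \<beta> y) \<partial>P j)) = (\<integral>y. K * (tilt_density \<theta> (linpred \<beta> y) * tilt_score a (linpred \<beta> y)) \<partial>G0)"
    by (rule sum_integral_pooled[OF pool])
      (use pool in \<open>auto simp: pooled_def intro!: bounded_integrable_P tilt_score_bounded[OF a]\<close>)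
  also have "\<dots> = (\<integral>y. K * (1 + (\<theta> - a) / a) * (tilt_ratio y - 1) + K * (\<theta> - a) / (a * (1 - a)) * (1 - ratio a y) \<partial>G0)"
  proof (rule Bochner_Integration.integral_cong[OF refl])
    fix y
    define E where "E = tilt_ratio y"
    define D where "D = tilt_density a (linpred \<beta> y)"
    have D: "D > 0" "D = 1 - a + a * E" using tilt_density_pos[of a] a by (auto simp: D_def E_def tilt_density_def)
    have "tilt_density \<theta> (linpred \<beta> y) = D + (\<theta> - a) * (E - 1)" by (simp add: D(2) tilt_density_def E_def algebra_simps)
    then have "tilt_density \<theta> (linpred \<beta> y) * tilt_score a (linpred \<beta> y) = (D + (\<theta> - a) * (E - 1)) * (E - 1) / D"
      by (simp add: tilt_score_def D_def E_def)
    also have "\<dots> = (E - 1) + (\<theta> - a) * ((E - 1)\<^sup>2 / D)"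
      using D(1) by (simp add: field_simps power2_eq_square)
    \<comment> \<open>The quadratic term is reduced to \<open>1 - E / D\<close> modulo multiples of
      \<open>E - 1\<close>, which integrate to zero under \<open>G0\<close>.\<close>
    also have "(E - 1)\<^sup>2 / D = (1 / a) * (E - 1) + (1 - E / D) / (a * (1 - a))"
    proof -
      define R where "R = (1 / a) * (E - 1) + (1 - E / D) / (a * (1 - a))"
      have "a * (1 - a) * (D * R) = D * (1 - a) * (E - 1) + (D - E)"
        using a D(1) by (simp add: R_def field_simps)
      also have "\<dots> = a * (1 - a) * (E - 1)\<^sup>2" unfolding D(2) by (simp add: power2_eq_square algebra_simps)
      finally have "D * R = (E - 1)\<^sup>2" using a by simp
      then show ?thesis unfolding R_def[symmetric] using D(1) by (simp add: field_simps)
    qed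
    finally have h: "tilt_density \<theta> (linpred \<beta> y) * tilt_score a (linpred \<beta> y) =
        (E - 1) + (\<theta> - a) * (1 / a * (E - 1) + (1 - E / D) / (a * (1 - a)))" .
    show "K * (tilt_density \<theta> (linpred \<beta> y) * tilt_score a (linpred \<beta> y)) = 
        K * (1 + (\<theta> - a) / a) * (tilt_ratio y - 1) + K * (\<theta> - a) / (a * (1 - a)) * (1 - ratio a y)"
      unfolding ratio_def E_def[symmetric] D_def[symmetric] h
      by (simp add: divide_inverse algebra_simps del: inverse_mult_distrib)
  qed
  also have "\<dots> = K * (\<theta> - a) * (1 - I0 a) / (a * (1 - a))"
    using ratio_integrable(1)[OF a] tilt_ratio_integral by (simp add: G0.prob_space I0_def)
  finally show ?thesis .
qed

lemma pooled_sign: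
  assumes pool: "pooled J' \<eta> K \<theta>" "K > 0" and b: "(b \<longlongrightarrow> \<beta>) (wp1 M)" and a: "0 < a" "a < 1"
  shows "a < \<theta> \<Longrightarrow> \<forall>\<^sub>F p in wp1 M. 0 < (\<Sum>j\<in>J'. emp j (\<lambda>y. tilt_score a (linpred (b p) y)) p)"
    "\<theta> < a \<Longrightarrow> \<forall>\<^sub>F p in wp1 M. (\<Sum>j\<in>J'. emp j (\<lambda>y. tilt_score a (linpred (b p) y)) p) < 0"
proof -
  have "((\<lambda>p. \<Sum>j\<in>J'. emp j (\<lambda>y. tilt_score a (linpred (b p) y)) p) \<longlongrightarrow> (\<Sum>j\<in>J'. \<eta> j * (\<integral>y. tilt_score a (linpred \<beta> y) \<partial>P j))) (wp1 M)"
    using pool(1) by (intro tendsto_sum emp_tilt_score_tendsto a b) (auto simp: pooled_def)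
  then have lim: "((\<lambda>p. \<Sum>j\<in>J'. emp j (\<lambda>y. tilt_score a (linpred (b p) y)) p) \<longlongrightarrow> K * (\<theta> - a) * (1 - I0 a) / (a * (1 - a))) (wp1 M)"
    unfolding pooled_tilt_score_integral[OF pool(1) a] .
  have I0: "0 < 1 - I0 a" using I0_less_1[OF a] by simp
  show "\<forall>\<^sub>F p in wp1 M. 0 < (\<Sum>j\<in>J'. emp j (\<lambda>y. tilt_score a (linpred (b p) y)) p)" if "a < \<theta>"
    by (rule order_tendstoD(1)[OF lim]) (use that pool(2) a I0 in \<open>intro divide_pos_pos mult_pos_pos, auto\<close>)
  show "\<forall>\<^sub>F p in wp1 M. (\<Sum>j\<in>J'. emp j (\<lambda>y. tilt_score a (linpred (b p) y)) p) < 0" if "\<theta> < a"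
    by (rule order_tendstoD(2)[OF lim]) (use that pool(2) a I0 in \<open>intro divide_neg_pos mult_neg_pos mult_pos_neg mult_pos_pos, auto\<close>)
qed

text \<open>The empirical score decreases in the proportion and, at a fixed point on either side of
  \<open>\<theta>\<close>, eventually has the sign of its limit. This traps every root near
  \<open>\<theta>\<close>.\<close>

lemma pooled_root_consistent:
  assumes pool: "pooled J' \<eta> K \<theta>" "K > 0" and \<theta>: "0 < \<theta>" "\<theta> < 1" and b: "(b \<longlongrightarrow> \<beta>) (wp1 M)"
    and root: "\<forall>\<^sub>F p in wp1 M. 0 < r p \<and> r p < 1 \<and> (\<Sum>j\<in>J'. emp j (\<lambda>y. tilt_score (r p) (linpred (b p) y)) p) = 0"
  shows "(r \<longlongrightarrow> \<theta>) (wp1 M)"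
proof (rule order_tendstoI)
  have mono: "(\<Sum>j\<in>J'. emp j (\<lambda>y. tilt_score a' (linpred (b p) y)) p) \<le> (\<Sum>j\<in>J'. emp j (\<lambda>y. tilt_score a (linpred (b p) y)) p)"
    if "0 < a" "a \<le> a'" "a' < 1" for a a' p
    using that by (intro sum_mono emp_mono tilt_score_antimono)
  fix y :: real
  {
    assume "y < \<theta>"
    \<comment> \<open>The maximum with \<open>\<theta> / 2\<close> keeps the comparison point
      positive when \<open>y\<close> is not.\<close>
    define a where "a = max y (\<theta> / 2)"
    have a: "0 < a" "a < 1" "a < \<theta>" "y \<le> a" using \<open>y < \<theta>\<close> \<theta> by (auto simp: a_def)
    from root pooled_sign(1)[OF pool b a(1-3)] show "\<forall>\<^sub>F p in wp1 M. y < r p"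
    proof eventually_elim
      case (elim p)
      then have "a < r p" using mono[of "r p" a p] a by (cases "a < r p") auto
      then show ?case using a by simp
    qed
  next
    assume "\<theta> < y"
    define a where "a = min y ((1 + \<theta>) / 2)"
    have a: "0 < a" "a < 1" "\<theta> < a" "a \<le> y" using \<open>\<theta> < y\<close> \<theta> by (auto simp: a_def min_less_iff_disj)
    from root pooled_sign(2)[OF pool b a(1-3)] show "\<forall>\<^sub>F p in wp1 M. r p < y"
    proof eventually_elim
      case (elim p)
      then have "r p < a" using mono[of a "r p" p] a by (cases "r p < a") auto
      then show ?case using a by simp
    qed
  }
qed

lemma isCont_logit: "0 < a \<Longrightarrow> a < 1 \<Longrightarrow> isCont logit a"
  unfolding logit_def[abs_def] by (intro continuous_intros) auto

lemma tendsto_logit: "(f \<longlongrightarrow> a) F \<Longrightarrow> 0 < a \<Longrightarrow> a < 1 \<Longrightarrow> ((\<lambda>p. logit (f p)) \<longlongrightarrow> logit a) F"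
  by (rule isCont_tendsto_compose[OF isCont_logit])

text \<open>Linearizes the equation for a nuisance intercept \<open>g\<close> about a centre
  \<open>g0\<close> with the same limit. Both sides of the equation vary with \<open>g\<close>,
  hence the coefficient \<open>\<mu> * logistic' \<zeta> - W \<bullet> e0\<close>; in the
  applications it is positive because \<open>I0\<close> is less than 1. Tightness of the scaled
  error comes out by absorption.\<close>

lemma pooled_root_expansion:
  assumes J': "J' \<subseteq> {1, 2, 3}"
    and m: "(m \<longlongrightarrow> \<mu>) (wp1 M)" and b: "bounded_in_prob M (\<lambda>p. rN p * norm (b p - \<beta>))"
    and g: "(g \<longlongrightarrow> \<zeta>) (wp1 M)" "(g0 \<longlongrightarrow> \<zeta>) (wp1 M)"
    and eq: "\<forall>\<^sub>F p in wp1 M. (\<Sum>j\<in>J'. score j (b p + g p *\<^sub>R e0) e0 p) = m p * logistic (g p)"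
    and S: "bounded_in_prob M (\<lambda>p. rN p * ((\<Sum>j\<in>J'. score j (\<beta> + g0 p *\<^sub>R e0) e0 p) - m p * logistic (g0 p)))"
  defines "W \<equiv> \<Sum>j\<in>J'. \<eta> j *\<^sub>R info j (\<beta> + \<zeta> *\<^sub>R e0) e0"
  assumes k: "0 < \<mu> * logistic' \<zeta> - W \<bullet> e0"
  shows "bounded_in_prob M (\<lambda>p. rN p * (g p - g0 p))"
    "((\<lambda>p. rN p * ((\<Sum>j\<in>J'. score j (\<beta> + g0 p *\<^sub>R e0) e0 p) - m p * logistic (g0 p)) + rN p * (W \<bullet> (b p - \<beta>))
        - (\<mu> * logistic' \<zeta> - W \<bullet> e0) * (rN p * (g p - g0 p))) \<longlongrightarrow> 0) (wp1 M)"
proof -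
  have "((\<lambda>p. norm (b p - \<beta>)) \<longlongrightarrow> 0) (wp1 M)" by (rule tendsto_of_bounded_in_prob[OF b])
  then have b_lim: "(b \<longlongrightarrow> \<beta>) (wp1 M)" by (simp add: LIM_zero_iff tendsto_norm_zero_iff)
  have l1: "((\<lambda>p. b p + g p *\<^sub>R e0) \<longlongrightarrow> \<beta> + \<zeta> *\<^sub>R e0) (wp1 M)" by (intro tendsto_intros b_lim g)
  have l2: "((\<lambda>p. \<beta> + g0 p *\<^sub>R e0) \<longlongrightarrow> \<beta> + \<zeta> *\<^sub>R e0) (wp1 M)" by (intro tendsto_intros g)
  obtain Y where Y: "(Y \<longlongrightarrow> 0) (wp1 M)"
    "\<And>p. \<bar>(\<Sum>j\<in>J'. score j (b p + g p *\<^sub>R e0) e0 p) - (\<Sum>j\<in>J'. score j (\<beta> + g0 p *\<^sub>R e0) e0 p)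
        - (W \<bullet> ((b p + g p *\<^sub>R e0) - (\<beta> + g0 p *\<^sub>R e0)))\<bar> \<le> Y p * norm ((b p + g p *\<^sub>R e0) - (\<beta> + g0 p *\<^sub>R e0))"
    using score_expansion_sum[OF J' l1 l2, of e0] unfolding W_def by blast
  define Y2 where "Y2 p = \<bar>g p - \<zeta>\<bar> + \<bar>g0 p - \<zeta>\<bar>" for p
  \<comment> \<open>Three sources of error: the expansion of the score, the Taylor remainder of
    \<open>logistic\<close>, and the fluctuation of the share \<open>m\<close>.\<close>
  define Z where "Z p = \<bar>Y p\<bar> + \<bar>m p\<bar> * Y2 p + \<bar>m p - \<mu>\<bar>" for p
  have "((\<lambda>p. \<bar>Y p\<bar> + \<bar>m p\<bar> * (\<bar>g p - \<zeta>\<bar> + \<bar>g0 p - \<zeta>\<bar>) + \<bar>m p - \<mu>\<bar>) \<longlongrightarrow> \<bar>0\<bar> + \<bar>\<mu>\<bar> * (\<bar>\<zeta> - \<zeta>\<bar> + \<bar>\<zeta> - \<zeta>\<bar>) + \<bar>\<mu> - \<mu>\<bar>) (wp1 M)"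
    by (intro tendsto_intros Y g m)
  then have Z: "(Z \<longlongrightarrow> 0) (wp1 M)" by (simp add: Z_def[abs_def] Y2_def)
  define k where "k = \<mu> * logistic' \<zeta> - W \<bullet> e0"
  let ?S = "\<lambda>p. rN p * ((\<Sum>j\<in>J'. score j (\<beta> + g0 p *\<^sub>R e0) e0 p) - m p * logistic (g0 p))"
  let ?D = "\<lambda>p. rN p * (W \<bullet> (b p - \<beta>))" and ?D' = "\<lambda>p. rN p * norm (b p - \<beta>)" and ?G = "\<lambda>p. rN p * (g p - g0 p)"
  have tD: "bounded_in_prob M ?D"
  proof (rule bounded_in_prob_dominated[OF bounded_in_prob_cmult[OF b, of "norm W"]], rule always_eventually, rule allI)
    fix p
    have "rN p * \<bar>W \<bullet> (b p - \<beta>)\<bar> \<le> rN p * (norm W * norm (b p - \<beta>))"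
      by (intro mult_left_mono Cauchy_Schwarz_ineq2) auto
    then show "\<bar>?D p\<bar> \<le> \<bar>norm W * ?D' p\<bar>" by (simp add: abs_mult mult_ac)
  qed
  have le: "\<forall>\<^sub>F p in wp1 M. \<bar>?S p + ?D p - k * ?G p\<bar> \<le> Z p * (?D' p + \<bar>?G p\<bar>)"
    using eq
  proof eventually_elim
    case (elim p)
    define \<delta> where "\<delta> = g p - g0 p"
    define s0 where "s0 = (\<Sum>j\<in>J'. score j (\<beta> + g0 p *\<^sub>R e0) e0 p)"
    define d where "d = b p - \<beta>"
    have d: "(b p + g p *\<^sub>R e0) - (\<beta> + g0 p *\<^sub>R e0) = d + \<delta> *\<^sub>R e0"
      by (simp add: d_def \<delta>_def scaleR_diff_left)
    have nd: "norm (d + \<delta> *\<^sub>R e0) \<le> norm d + \<bar>\<delta>\<bar>"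
      using norm_triangle_ineq[of d "\<delta> *\<^sub>R e0"] by (simp add: norm_axis_1)
    define R1 where "R1 = m p * logistic (g p) - s0 - W \<bullet> (d + \<delta> *\<^sub>R e0)"
    have "\<bar>R1\<bar> \<le> Y p * norm (d + \<delta> *\<^sub>R e0)" using Y(2)[of p] elim unfolding d R1_def s0_def by simp
    also have "\<dots> \<le> \<bar>Y p\<bar> * (norm d + \<bar>\<delta>\<bar>)" using nd by (intro mult_mono) auto
    finally have R1: "\<bar>R1\<bar> \<le> \<bar>Y p\<bar> * (norm d + \<bar>\<delta>\<bar>)" .
    define R2 where "R2 = logistic (g p) - logistic (g0 p) - logistic' \<zeta> * \<delta>"
    have "\<bar>R2\<bar> \<le> Y2 p * \<bar>\<delta>\<bar>"
      using order_trans[OF logistic_Taylor[of "g p" "g0 p" \<zeta>] mult_right_mono[of _ "Y2 p"]]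
      by (simp add: R2_def \<delta>_def Y2_def)
    then have "\<bar>m p\<bar> * \<bar>R2\<bar> \<le> \<bar>m p\<bar> * (Y2 p * \<bar>\<delta>\<bar>)" by (intro mult_left_mono) auto
    also have "\<dots> \<le> \<bar>m p\<bar> * (Y2 p * (norm d + \<bar>\<delta>\<bar>))" by (intro mult_left_mono) (auto simp: Y2_def)
    finally have R2: "\<bar>m p * R2\<bar> \<le> \<bar>m p\<bar> * Y2 p * (norm d + \<bar>\<delta>\<bar>)" by (simp add: abs_mult mult.assoc)
    have b3: "\<bar>(m p - \<mu>) * logistic' \<zeta> * \<delta>\<bar> \<le> \<bar>m p - \<mu>\<bar> * 1 * (norm d + \<bar>\<delta>\<bar>)"
      unfolding abs_mult using logistic'_bounds[of \<zeta>] by (intro mult_mono) auto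
    have eq3: "s0 - m p * logistic (g0 p) + W \<bullet> d - k * \<delta> = - R1 + m p * R2 + (m p - \<mu>) * logistic' \<zeta> * \<delta>"
      by (simp add: R1_def R2_def k_def inner_add_right algebra_simps)
    have tri: "\<bar>- R1 + m p * R2 + (m p - \<mu>) * logistic' \<zeta> * \<delta>\<bar> \<le> \<bar>R1\<bar> + \<bar>m p * R2\<bar> + \<bar>(m p - \<mu>) * logistic' \<zeta> * \<delta>\<bar>"
      using abs_triangle_ineq[of "- R1 + m p * R2" "(m p - \<mu>) * logistic' \<zeta> * \<delta>"] abs_triangle_ineq[of "- R1" "m p * R2"]
      unfolding abs_minus_cancel by (rule order_trans[OF _ add_right_mono])
    have "\<bar>s0 - m p * logistic (g0 p) + W \<bullet> d - k * \<delta>\<bar> \<le> 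
        \<bar>Y p\<bar> * (norm d + \<bar>\<delta>\<bar>) + \<bar>m p\<bar> * Y2 p * (norm d + \<bar>\<delta>\<bar>) + \<bar>m p - \<mu>\<bar> * 1 * (norm d + \<bar>\<delta>\<bar>)"
      unfolding eq3 by (rule order_trans[OF tri add_mono[OF add_mono[OF R1 R2] b3]])
    also have "\<dots> = Z p * (norm d + \<bar>\<delta>\<bar>)" by (simp add: Z_def algebra_simps)
    finally have "\<bar>s0 - m p * logistic (g0 p) + W \<bullet> d - k * \<delta>\<bar> \<le> Z p * (norm d + \<bar>\<delta>\<bar>)" .
    then have "rN p * \<bar>s0 - m p * logistic (g0 p) + W \<bullet> d - k * \<delta>\<bar> \<le> rN p * (Z p * (norm d + \<bar>\<delta>\<bar>))"
      by (intro mult_left_mono) auto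
    moreover have "rN p * \<bar>s0 - m p * logistic (g0 p) + W \<bullet> d - k * \<delta>\<bar> = \<bar>?S p + ?D p - k * ?G p\<bar>"
    proof -
      have "?S p + ?D p - k * ?G p = rN p * (s0 - m p * logistic (g0 p) + W \<bullet> d - k * \<delta>)"
        by (simp add: s0_def d_def \<delta>_def algebra_simps)
      then show ?thesis by (simp add: abs_mult)
    qed
    moreover have "rN p * (Z p * (norm d + \<bar>\<delta>\<bar>)) = Z p * (?D' p + \<bar>?G p\<bar>)"
    proof -
      have G: "?G p = rN p * \<delta>" by (simp add: \<delta>_def)
      show ?thesis unfolding G d_def abs_mult by (simp add: distrib_left mult.left_commute)
    qed
    ultimately show ?case by linarith
  qed
  show "bounded_in_prob M ?G"
    by (rule bounded_in_prob_linear_root(1)[OF S tD b _ Z le]) (use k in \<open>simp add: k_def\<close>)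
  show "((\<lambda>p. ?S p + ?D p - (\<mu> * logistic' \<zeta> - W \<bullet> e0) * ?G p) \<longlongrightarrow> 0) (wp1 M)"
    by (rule bounded_in_prob_linear_root(2)[OF S tD b _ Z le[unfolded k_def]]) (rule k)
qed

text \<open>At the logit of the exact pooled proportion the centred intercept score has total mean
  zero for the actual sizes, so \<open>nsum_triangular\<close> bounds it at the root N
  scale.\<close>

lemma pooled_score_bounded_in_prob:
  assumes J': "J' \<subseteq> {1, 2, 3}" and \<zeta>: "\<zeta> \<longlonglongrightarrow> \<zeta>0"
    and pool: "\<forall>\<^sub>F k in sequentially. \<exists>K s. 0 < s \<and> s < 1 \<and> \<zeta> k = logit s \<and> pooled J' (\<lambda>j. real (n k j)) K s"
  shows "bounded_in_prob M (\<lambda>p. rN p * ((\<Sum>j\<in>J'. score j (\<beta> + \<zeta> (fst p) *\<^sub>R e0) e0 p) 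
    - (\<Sum>j\<in>J'. real (n (fst p) j) / real (total_size (n (fst p)))) * logistic (\<zeta> (fst p))))"
proof -
  define f where "f z j y = (if j \<in> J' then Q z y - logistic z else 0)" for z j y
  have [measurable]: "f z j \<in> borel_measurable borel" for z j unfolding f_def by (cases "j \<in> J'") simp_all
  have f_bound: "\<bar>f z j y\<bar> \<le> 1 * norm (design y)" for z j y
  proof -
    have "\<bar>Q z y - logistic z\<bar> \<le> norm (design y)"
      using norm_design_ge_1[of y] Q_bounds[of z y] logistic_bounds[of z] by linarith
    then show ?thesis by (simp add: f_def)
  qed
  have fint: "integrable (P j) (f z j)" if "j \<in> {1, 2, 3}" for z j
    by (rule square_integrable_P[OF that _ square_integrable_of_bound[OF that _ f_bound]]) measurable
  have "bounded_in_prob M (\<lambda>p. nsum (f (\<zeta> (fst p))) p)"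
  proof (rule nsum_triangular(1)[where fk = "\<lambda>k. f (\<zeta> k)" and f = "f \<zeta>0" and r = "\<lambda>k. \<bar>\<zeta> k - \<zeta>0\<bar>" and h = "\<lambda>y. 2 * norm (design y)"])
    show "\<bar>f (\<zeta> k) j y - f \<zeta>0 j y\<bar> \<le> \<bar>\<zeta> k - \<zeta>0\<bar> * (2 * norm (design y))" for k j and y :: "real ^ 'p"
    proof -
      have "\<bar>f (\<zeta> k) j y - f \<zeta>0 j y\<bar> \<le> \<bar>\<zeta> k - \<zeta>0\<bar> * 2"
      proof -
        have "\<bar>(Q (\<zeta> k) y - logistic (\<zeta> k)) - (Q \<zeta>0 y - logistic \<zeta>0)\<bar> \<le> \<bar>\<zeta> k - \<zeta>0\<bar> * 2"
          using order_trans[OF abs_triangle_ineq4 add_mono[OF Q_lipschitz[of "\<zeta> k" y \<zeta>0] logistic_lipschitz[of "\<zeta> k" \<zeta>0]]]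
          by (simp add: algebra_simps)
        then show ?thesis by (simp add: f_def)
      qed
      also have "\<dots> \<le> \<bar>\<zeta> k - \<zeta>0\<bar> * (2 * norm (design y))"
        using norm_design_ge_1[of y] by (intro mult_left_mono) auto
      finally show ?thesis .
    qed
    show "(\<lambda>k. \<bar>\<zeta> k - \<zeta>0\<bar>) \<longlonglongrightarrow> 0" using \<zeta> by (simp add: LIM_zero tendsto_rabs_zero)
    show "integrable (P j) (\<lambda>y. (2 * norm (design y))\<^sup>2)" if "j \<in> {1, 2, 3}" for j
      by (rule square_integrable_of_bound[OF that, of _ 2]) auto
    show "integrable (P j) (\<lambda>y. (f \<zeta>0 j y)\<^sup>2)" if "j \<in> {1, 2, 3}" for j
      by (rule square_integrable_of_bound[OF that _ f_bound]) measurable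
    from pool show "\<forall>\<^sub>F k in sequentially. (\<Sum>j\<in>{1, 2, 3}. real (n k j) * (\<integral>y. f (\<zeta> k) j y \<partial>P j)) = 0"
    proof eventually_elim
      case (elim k)
      then obtain K s where s: "0 < s" "s < 1" "\<zeta> k = logit s" and pl: "pooled J' (\<lambda>j. real (n k j)) K s" by blast
      have "(\<Sum>j\<in>{1, 2, 3}. real (n k j) * (\<integral>y. f (\<zeta> k) j y \<partial>P j)) = (\<Sum>j\<in>J'. real (n k j) * (\<integral>y. Q (logit s) y - s \<partial>P j))"
        using J' by (intro sum.mono_neutral_cong_right) (auto simp: f_def s logistic_logit)
      also have "\<dots> = (\<integral>y. K * (tilt_density s (linpred \<beta> y) * (Q (logit s) y - s)) \<partial>G0)"
      proof (rule sum_integral_pooled[OF pl])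
        show "integrable (P j) (\<lambda>y. Q (logit s) y - s)" if "j \<in> J'" for j
        proof (rule bounded_integrable_P[of _ _ 1])
          show "\<bar>Q (logit s) y - s\<bar> \<le> 1" for y using Q_bounds[of "logit s" y] s by linarith
        qed (use that J' in auto)
      qed measurable
      also have "\<dots> = (\<integral>y. K * s * (1 - s) * (tilt_ratio y - 1) \<partial>G0)"
      proof (rule Bochner_Integration.integral_cong[OF refl])
        fix y
        have "tilt_density s (linpred \<beta> y) * (Q (logit s) y - s) = s * (tilt_density s (linpred \<beta> y) * ratio s y) - s * tilt_density s (linpred \<beta> y)"
          using s by (simp add: Q_logit algebra_simps)
        also have "\<dots> = s * (1 - s) * (tilt_ratio y - 1)"
          unfolding ratio_eq(1)[OF s(1,2)] by (simp add: tilt_density_def algebra_simps)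
        finally show "K * (tilt_density s (linpred \<beta> y) * (Q (logit s) y - s)) = K * s * (1 - s) * (tilt_ratio y - 1)" by simp
      qed
      also have "\<dots> = 0" using tilt_ratio_integral by (simp add: G0.prob_space)
      finally show ?case .
    qed
  qed measurable
  moreover have "nsum (f (\<zeta> (fst p))) p = rN p * ((\<Sum>j\<in>J'. score j (\<beta> + \<zeta> (fst p) *\<^sub>R e0) e0 p) 
    - (\<Sum>j\<in>J'. real (n (fst p) j) / real (total_size (n (fst p)))) * logistic (\<zeta> (fst p)))" for p
  proof -
    have "(\<Sum>j\<in>{1, 2, 3}. emp j (f (\<zeta> (fst p)) j) p) = (\<Sum>j\<in>J'. emp j (\<lambda>y. Q (\<zeta> (fst p)) y - logistic (\<zeta> (fst p))) p)"
      using J' by (intro sum.mono_neutral_cong_right) (auto simp: f_def[abs_def] emp_def)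
    also have "\<dots> = (\<Sum>j\<in>J'. score j (\<beta> + \<zeta> (fst p) *\<^sub>R e0) e0 p - logistic (\<zeta> (fst p)) * (real (n (fst p) j) / real (total_size (n (fst p)))))"
      unfolding emp_diff emp_const score_shift by (simp add: Q_def)
    finally show ?thesis unfolding nsum_eq_emp by (simp add: sum_subtractf sum_distrib_left mult.commute)
  qed
  ultimately show ?thesis by simp
qed

end

section \<open>Asymptotic linearity of the two estimators of \<beta>\<close>

context ETM_asymptotics
begin

abbreviation share :: "nat \<Rightarrow> nat \<Rightarrow> real" where
  "share k j \<equiv> real (n k j) / real (total_size (n k))"

definition alpha_N :: "nat \<Rightarrow> real" where "alpha_N k = share k 2 + share k 3 * \<rho>"

text \<open>
  The expansions are centred at these sample-size dependent values, at which the scores have mean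
  exactly zero; no rate is assumed for the convergence of the shares.
\<close>

definition zeta_N :: "nat \<Rightarrow> real" where "zeta_N k = logit (alpha_N k)"

definition shift_N :: "nat \<Rightarrow> real" where "shift_N k = ln (real (n k 2) / real (n k 1))"

lemma total_size_eq: "total_size m = m 1 + m 2 + m 3"
proof -
  have "{1..3::nat} = {1, 2, 3}" by auto
  then show ?thesis by (simp add: total_size_def)
qed

lemma alpha_N_lim: "alpha_N \<longlonglongrightarrow> \<alpha>"
  unfolding alpha_N_def[abs_def] \<alpha>_def by (intro tendsto_intros proportions) auto

lemma zeta_N_lim: "zeta_N \<longlonglongrightarrow> logit \<alpha>"
  unfolding zeta_N_def[abs_def] by (rule tendsto_logit[OF alpha_N_lim alpha_range])

lemma alpha_N_range: "\<forall>\<^sub>F k in sequentially. 0 < alpha_N k \<and> alpha_N k < 1"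
  using order_tendstoD[OF alpha_N_lim] alpha_range by (intro eventually_conj) auto

lemma pooled_3: "pooled {3} a (a 3) \<rho>"
  by (simp add: pooled_def tilt_density_mixprop)

lemma pooled_all: "pooled {1, 2, 3} \<eta> 1 \<alpha>"
proof -
  have e1: "\<eta> 1 = 1 - \<eta> 2 - \<eta> 3" using sum_eta by linarith
  show ?thesis using e1 by (simp add: pooled_def mixprop_def tilt_density_def \<alpha>_def algebra_simps)
qed

lemma pooled_all_N:
  assumes "total_size (n k) > 0"
  shows "pooled {1, 2, 3} (\<lambda>j. real (n k j)) (real (total_size (n k))) (alpha_N k)"
proof -
  have a: "real (total_size (n k)) * alpha_N k = real (n k 2) + real (n k 3) * \<rho>"
    using assms by (simp add: alpha_N_def field_simps)
  have t: "real (total_size (n k)) = real (n k 1) + real (n k 2) + real (n k 3)"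
    by (simp add: total_size_eq)
  have "real (total_size (n k)) * tilt_density (alpha_N k) u =
      real (total_size (n k)) - (real (total_size (n k)) * alpha_N k) + (real (total_size (n k)) * alpha_N k) * exp u" for u
    by (simp add: tilt_density_def algebra_simps)
  then show ?thesis unfolding pooled_def a unfolding t
    by (simp add: mixprop_def tilt_density_def algebra_simps)
qed

lemma n_pos: assumes "j \<in> {1, 2, 3}" shows "\<forall>\<^sub>F k in sequentially. n k j > 0"
proof -
  have "\<forall>\<^sub>F k in sequentially. 0 < share k j"
    using order_tendstoD(1)[OF proportions[OF assms]] sizes(3)[OF assms] by auto
  then show ?thesis by eventually_elim (auto simp: zero_less_divide_iff)
qed

lemma shift_N_lim: "shift_N \<longlonglongrightarrow> logit a_lab"
proof -
  have l: "logit a_lab = ln (\<eta> 2 / \<eta> 1)"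
  proof -
    have "1 - a_lab = \<eta> 1 / (\<eta> 1 + \<eta> 2)" using eta_pos by (simp add: a_lab_def field_simps)
    then have "a_lab / (1 - a_lab) = \<eta> 2 / \<eta> 1" using eta_pos by (simp add: a_lab_def)
    then show ?thesis by (simp add: logit_def)
  qed
  have "(\<lambda>k. ln (share k 2 / share k 1)) \<longlonglongrightarrow> ln (\<eta> 2 / \<eta> 1)"
    using eta_pos by (intro tendsto_ln tendsto_divide proportions) auto
  then show ?thesis unfolding l
  proof (rule Lim_transform_eventually)
    show "\<forall>\<^sub>F k in sequentially. ln (share k 2 / share k 1) = shift_N k"
      using N_pos by eventually_elim (simp add: shift_N_def)
  qed
qed

text \<open>Exhibits the efficient score as the \<open>\<beta>\<close>-score at the truth corrected
  by the two nuisance equations, with the coefficients \<open>proj\<close>; this is the combination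
  that eliminates the nuisance errors.\<close>

lemma nsum_eff:
  "nsum (eff \<zeta> c) p = rN p * (emp 2 (\<lambda>y. c \<bullet> design y) p + score 3 (\<beta> + logit \<rho> *\<^sub>R e0) c p - (\<Sum>j\<in>{1, 2, 3}. score j (\<beta> + \<zeta> *\<^sub>R e0) c p))
    + proj \<rho> c * (rN p * ((\<Sum>j\<in>{3}. score j (\<beta> + logit \<rho> *\<^sub>R e0) e0 p) - (\<Sum>j\<in>{3}. share (fst p) j) * logistic (logit \<rho>)))
    - proj \<alpha> c * (rN p * ((\<Sum>j\<in>{1, 2, 3}. score j (\<beta> + \<zeta> *\<^sub>R e0) e0 p) - (\<Sum>j\<in>{1, 2, 3}. share (fst p) j) * logistic \<zeta>))"
proof -
  have common: "emp j (\<lambda>y. f y - Q \<zeta> y * (c \<bullet> design y) - proj \<alpha> c * (Q \<zeta> y - logistic \<zeta>)) p =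
      emp j f p - score j (\<beta> + \<zeta> *\<^sub>R e0) c p - proj \<alpha> c * (score j (\<beta> + \<zeta> *\<^sub>R e0) e0 p - logistic \<zeta> * share (fst p) j)" for j f
    unfolding emp_diff emp_cmult emp_const score_shift by (simp add: Q_def)
  have 1: "emp 1 (eff \<zeta> c 1) p = - score 1 (\<beta> + \<zeta> *\<^sub>R e0) c p - proj \<alpha> c * (score 1 (\<beta> + \<zeta> *\<^sub>R e0) e0 p - logistic \<zeta> * share (fst p) 1)"
    using common[of 1 "\<lambda>_. 0"] by (simp add: eff_def[abs_def] emp_const)
  have 2: "emp 2 (eff \<zeta> c 2) p = emp 2 (\<lambda>y. c \<bullet> design y) p - score 2 (\<beta> + \<zeta> *\<^sub>R e0) c p - proj \<alpha> c * (score 2 (\<beta> + \<zeta> *\<^sub>R e0) e0 p - logistic \<zeta> * share (fst p) 2)"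
    using common[of 2 "\<lambda>y. c \<bullet> design y"] by (simp add: eff_def[abs_def])
  have 3: "emp 3 (eff \<zeta> c 3) p = score 3 (\<beta> + logit \<rho> *\<^sub>R e0) c p + proj \<rho> c * (score 3 (\<beta> + logit \<rho> *\<^sub>R e0) e0 p - \<rho> * share (fst p) 3)
     - score 3 (\<beta> + \<zeta> *\<^sub>R e0) c p - proj \<alpha> c * (score 3 (\<beta> + \<zeta> *\<^sub>R e0) e0 p - logistic \<zeta> * share (fst p) 3)"
  proof -
    have "emp 3 (\<lambda>y. Q (logit \<rho>) y * (c \<bullet> design y) + proj \<rho> c * (Q (logit \<rho>) y - \<rho>)) p = 
      score 3 (\<beta> + logit \<rho> *\<^sub>R e0) c p + proj \<rho> c * (score 3 (\<beta> + logit \<rho> *\<^sub>R e0) e0 p - \<rho> * share (fst p) 3)"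
      unfolding emp_add emp_cmult emp_diff emp_const score_shift by (simp add: Q_def)
    then show ?thesis
      using common[of 3 "\<lambda>y. Q (logit \<rho>) y * (c \<bullet> design y) + proj \<rho> c * (Q (logit \<rho>) y - \<rho>)"]
      by (simp add: eff_def[abs_def])
  qed
  have s: "(\<Sum>j\<in>{1, 2, 3::nat}. h j) = h 1 + h 2 + h 3" for h :: "nat \<Rightarrow> real" by simp
  have s3: "(\<Sum>j\<in>{3::nat}. h j) = h 3" for h :: "nat \<Rightarrow> real" by simp
  show ?thesis
    unfolding nsum_eq_emp s s3 1 2 3 logistic_logit[OF mixing_proportion] by (simp only: algebra_simps)
qed

lemma nsum_lab:
  "nsum (lab \<zeta> c) p = rN p * (emp 2 (\<lambda>y. c \<bullet> design y) p - (\<Sum>j\<in>{1, 2}. score j (\<beta> + \<zeta> *\<^sub>R e0) c p))"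
proof -
  have 1: "emp 1 (lab \<zeta> c 1) p = - score 1 (\<beta> + \<zeta> *\<^sub>R e0) c p"
    using emp_cmult[of 1 "-1" "\<lambda>y. Q \<zeta> y * (c \<bullet> design y)" p] unfolding score_shift
    by (simp add: lab_def[abs_def] Q_def)
  have 2: "emp 2 (lab \<zeta> c 2) p = emp 2 (\<lambda>y. c \<bullet> design y) p - score 2 (\<beta> + \<zeta> *\<^sub>R e0) c p"
    unfolding score_shift emp_diff[symmetric] by (simp add: lab_def[abs_def] Q_def left_diff_distrib)
  have 3: "emp 3 (lab \<zeta> c 3) p = 0" by (simp add: lab_def[abs_def] emp_def)
  have s: "(\<Sum>j\<in>{1, 2, 3::nat}. h j) = h 1 + h 2 + h 3" for h :: "nat \<Rightarrow> real" by simp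
  have s2: "(\<Sum>j\<in>{1, 2::nat}. h j) = h 1 + h 2" for h :: "nat \<Rightarrow> real" by simp
  show ?thesis unfolding nsum_eq_emp s s2 1 2 3 by (simp only: algebra_simps)
qed

lemma scaled_remainder:
  assumes Y: "(Y \<longlongrightarrow> 0) (wp1 M)" and R: "\<And>p. \<bar>R p\<bar> \<le> Y p * norm (w p)" and w: "bounded_in_prob M (\<lambda>p. rN p * norm (w p))"
  shows "((\<lambda>p. rN p * R p) \<longlongrightarrow> 0) (wp1 M)"
proof (rule Lim_null_comparison[OF always_eventually bounded_in_probD[OF w Y]], rule allI)
  fix p
  have "rN p * \<bar>R p\<bar> \<le> rN p * (Y p * norm (w p))" by (intro mult_left_mono R) simp
  then show "norm (rN p * R p) \<le> Y p * (rN p * norm (w p))" by (simp add: abs_mult mult_ac)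
qed

lemma bounded_in_prob_shifted:
  assumes b: "bounded_in_prob M (\<lambda>p. rN p * norm (b p - \<beta>))" and g: "bounded_in_prob M (\<lambda>p. rN p * (g p - g0 p))"
  shows "bounded_in_prob M (\<lambda>p. rN p * norm ((b p + g p *\<^sub>R e0) - (\<beta> + g0 p *\<^sub>R e0)))"
proof (rule bounded_in_prob_dominated[OF bounded_in_prob_add[OF b bounded_in_prob_dominated[OF g]]])
  show "\<forall>\<^sub>F p in wp1 M. \<bar>\<bar>rN p * (g p - g0 p)\<bar>\<bar> \<le> \<bar>rN p * (g p - g0 p)\<bar>" by simp
  show "\<forall>\<^sub>F p in wp1 M. \<bar>rN p * norm ((b p + g p *\<^sub>R e0) - (\<beta> + g0 p *\<^sub>R e0))\<bar> \<le> \<bar>rN p * norm (b p - \<beta>) + \<bar>rN p * (g p - g0 p)\<bar>\<bar>"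
  proof (rule always_eventually, rule allI)
    fix p
    have "norm ((b p + g p *\<^sub>R e0) - (\<beta> + g0 p *\<^sub>R e0)) \<le> norm (b p - \<beta>) + \<bar>g p - g0 p\<bar>"
    proof -
      have eq: "(b p + g p *\<^sub>R e0) - (\<beta> + g0 p *\<^sub>R e0) = (b p - \<beta>) + (g p - g0 p) *\<^sub>R e0"
        by (simp add: scaleR_diff_left)
      show ?thesis unfolding eq using norm_triangle_ineq[of "b p - \<beta>" "(g p - g0 p) *\<^sub>R e0"] by (simp add: norm_axis_1)
    qed
    then have "rN p * norm ((b p + g p *\<^sub>R e0) - (\<beta> + g0 p *\<^sub>R e0)) \<le> rN p * (norm (b p - \<beta>) + \<bar>g p - g0 p\<bar>)"
      by (intro mult_left_mono) auto
    then show "\<bar>rN p * norm ((b p + g p *\<^sub>R e0) - (\<beta> + g0 p *\<^sub>R e0))\<bar> \<le> \<bar>rN p * norm (b p - \<beta>) + \<bar>rN p * (g p - g0 p)\<bar>\<bar>"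
      by (simp add: abs_mult distrib_left)
  qed
qed

lemma score_logit: "0 < a \<Longrightarrow> a < 1 \<Longrightarrow>
  score j (b + logit a *\<^sub>R e0) e0 p = a * share (fst p) j + a * (1 - a) * emp j (\<lambda>y. tilt_score a (linpred b y)) p"
  unfolding score_shift by (simp add: logistic_tilt_score emp_add emp_const emp_cmult)

lemma consistent_of_bounded_in_prob:
  assumes "bounded_in_prob M (\<lambda>p. rN p * norm (b p - \<beta>))"
  shows "(b \<longlongrightarrow> \<beta>) (wp1 M)"
  using tendsto_of_bounded_in_prob[OF assms] by (simp add: LIM_zero_iff tendsto_norm_zero_iff)

text \<open>The same deterministic shift is added to the estimator and to the true parameter and
  cancels from their difference, so a single score expansion suffices.\<close>

lemma labeled_linearization:
  assumes est: "with_prob_tending_to_1 M (\<lambda>k \<omega>. is_labeled_estimator (n k) (\<lambda>j i. x j i \<omega>) (b_lab k \<omega>))"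
    and tight: "bounded_in_prob M (\<lambda>p. rN p * norm (b_lab (fst p) (snd p) - \<beta>))"
  shows "((\<lambda>(k, \<omega>). nsum (lab (shift_N k) c) (k, \<omega>) - sqrt (real (total_size (n k))) * (Lv c \<bullet> (b_lab k \<omega> - \<beta>))) \<longlongrightarrow> 0) (wp1 M)"
proof -
  define b where "b p = b_lab (fst p) (snd p)" for p
  note tb = tight[folded b_def]
  have "((\<lambda>p. shift_N (fst p)) \<longlongrightarrow> logit a_lab) (wp1 M)" by (rule tendsto_fst_wp1[OF shift_N_lim])
  then have l: "((\<lambda>p. b p + shift_N (fst p) *\<^sub>R e0) \<longlongrightarrow> \<beta> + logit a_lab *\<^sub>R e0) (wp1 M)"
    "((\<lambda>p. \<beta> + shift_N (fst p) *\<^sub>R e0) \<longlongrightarrow> \<beta> + logit a_lab *\<^sub>R e0) (wp1 M)"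
    by (intro tendsto_intros consistent_of_bounded_in_prob[OF tb]; assumption)+
  obtain Y where Y: "(Y \<longlongrightarrow> 0) (wp1 M)"
    "\<And>p. \<bar>(\<Sum>j\<in>{1, 2}. score j (b p + shift_N (fst p) *\<^sub>R e0) c p) - (\<Sum>j\<in>{1, 2}. score j (\<beta> + shift_N (fst p) *\<^sub>R e0) c p)
        - ((\<Sum>j\<in>{1, 2}. \<eta> j *\<^sub>R info j (\<beta> + logit a_lab *\<^sub>R e0) c) \<bullet> ((b p + shift_N (fst p) *\<^sub>R e0) - (\<beta> + shift_N (fst p) *\<^sub>R e0)))\<bar> 
      \<le> Y p * norm ((b p + shift_N (fst p) *\<^sub>R e0) - (\<beta> + shift_N (fst p) *\<^sub>R e0))"
    using score_expansion_sum[OF _ l, of "{1, 2}" c] by blast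
  define R where "R p = (\<Sum>j\<in>{1, 2}. score j (b p + shift_N (fst p) *\<^sub>R e0) c p) - (\<Sum>j\<in>{1, 2}. score j (\<beta> + shift_N (fst p) *\<^sub>R e0) c p) - Lv c \<bullet> (b p - \<beta>)" for p
  have "\<bar>R p\<bar> \<le> Y p * norm (b p - \<beta>)" for p
    using Y(2)[of p] by (simp only: R_def Lv_def add_diff_cancel_right)
  then have lim: "((\<lambda>p. rN p * R p) \<longlongrightarrow> 0) (wp1 M)" by (rule scaled_remainder[OF Y(1) _ tb])
  have "\<forall>\<^sub>F p in wp1 M. is_labeled_estimator (n (fst p)) (\<lambda>j i. x j i (snd p)) (b p)"
    using est unfolding eventually_wp1 b_def by simp
  moreover have "\<forall>\<^sub>F p in wp1 M. n (fst p) 1 > 0" "\<forall>\<^sub>F p in wp1 M. n (fst p) 2 > 0"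
    by (rule eventually_fst_wp1[OF n_pos], simp)+
  ultimately have "\<forall>\<^sub>F p in wp1 M. rN p * R p = nsum (lab (shift_N (fst p)) c) p - rN p * (Lv c \<bullet> (b p - \<beta>))"
  proof eventually_elim
    case (elim p)
    have "b p + ln (real (n (fst p) 2) / real (n (fst p) 1)) *\<^sub>R e0 = b p + shift_N (fst p) *\<^sub>R e0"
      by (simp add: shift_N_def)
    note st = labeled_estimator_stationary[OF elim, of c, unfolded this, unfolded linpred_eq_inner]
    have "emp 2 (\<lambda>y. c \<bullet> design y) p - score 1 (b p + shift_N (fst p) *\<^sub>R e0) c p - score 2 (b p + shift_N (fst p) *\<^sub>R e0) c p = 0"
      unfolding emp_def score_def diff_divide_distrib[symmetric] using st by simp
    then have "emp 2 (\<lambda>y. c \<bullet> design y) p = (\<Sum>j\<in>{1, 2}. score j (b p + shift_N (fst p) *\<^sub>R e0) c p)" by simp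
    then show ?case unfolding nsum_lab R_def by (simp only: right_diff_distrib)
  qed
  then show ?thesis using lim unfolding b_def split_def by (auto elim: Lim_transform_eventually)
qed

text \<open>Four expansions are combined: \<open>T3\<close> and \<open>T4\<close> for the
  \<open>\<beta>\<close>-equation at the two intercept shifts, \<open>X1\<close> and
  \<open>X2\<close> for the equations of the proportions. The multipliers of \<open>X1\<close> and
  \<open>X2\<close> cancel the nuisance errors \<open>G1\<close> and \<open>G2\<close>, and the
  coefficient left on the error in \<open>\<beta>\<close> is \<open>Jv c\<close>.\<close>

lemma MLE_linearization:
  assumes est: "with_prob_tending_to_1 M (\<lambda>k \<omega>. is_MLE (n k) (\<lambda>j i. x j i \<omega>) (rho_hat k \<omega>, beta_hat k \<omega>))"
    and tight: "bounded_in_prob M (\<lambda>p. rN p * norm (beta_hat (fst p) (snd p) - \<beta>))"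
  shows "((\<lambda>(k, \<omega>). nsum (eff (zeta_N k) c) (k, \<omega>) - sqrt (real (total_size (n k))) * (Jv c \<bullet> (beta_hat k \<omega> - \<beta>))) \<longlongrightarrow> 0) (wp1 M)"
proof -
  define b where "b p = beta_hat (fst p) (snd p)" for p
  define r where "r p = rho_hat (fst p) (snd p)" for p
  define d where "d p = (\<lambda>j i. x j i (snd p))" for p :: "nat \<times> 'w"
  note tb = tight[folded b_def]
  note bl = consistent_of_bounded_in_prob[OF tb]
  have mle: "\<forall>\<^sub>F p in wp1 M. is_MLE (n (fst p)) (d p) (r p, b p)"
    using est unfolding eventually_wp1 b_def r_def d_def by simp
  have Npos: "\<forall>\<^sub>F p in wp1 M. total_size (n (fst p)) > 0"
    by (rule eventually_fst_wp1[OF N_pos])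
  have s123: "{1..3::nat} = {1, 2, 3}" by auto
  have tts: "(\<Sum>j\<in>{1, 2, 3}. emp j (\<lambda>y. tilt_score a (linpred b' y)) p) = total_tilt_score (n (fst p)) (d p) a b' / real (total_size (n (fst p)))" for a b' p
    unfolding emp_def total_tilt_score_def d_def s123 by (simp only: sum_divide_distrib)

  have root_rho: "\<forall>\<^sub>F p in wp1 M. 0 < r p \<and> r p < 1 \<and> (\<Sum>j\<in>{3}. emp j (\<lambda>y. tilt_score (r p) (linpred (b p) y)) p) = 0"
    using mle Npos
  proof eventually_elim
    case (elim p)
    show ?case using is_MLE_range[OF elim(1)] is_MLE_tilt_score_rho[OF elim] by (simp add: emp_def d_def)
  qed
  have r_lim: "(r \<longlongrightarrow> \<rho>) (wp1 M)"
    by (rule pooled_root_consistent[OF pooled_3 _ mixing_proportion bl root_rho]) (rule eta_pos(3))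

  \<comment> \<open>A root in the unit interval is guaranteed only with probability tending to one;
    elsewhere the choice is arbitrary.\<close>
  define ah where "ah p = (SOME a. 0 < a \<and> a < 1 \<and> total_tilt_score (n (fst p)) (d p) a (b p) = 0)" for p
  have half: "0 < \<alpha> / 2" "\<alpha> / 2 < 1" "\<alpha> / 2 < \<alpha>" "0 < (1 + \<alpha>) / 2" "(1 + \<alpha>) / 2 < 1" "\<alpha> < (1 + \<alpha>) / 2"
    using alpha_range by auto
  have sign1: "\<forall>\<^sub>F p in wp1 M. 0 < total_tilt_score (n (fst p)) (d p) (\<alpha> / 2) (b p)"
    using pooled_sign(1)[OF pooled_all zero_less_one bl half(1-3)] unfolding tts
    by eventually_elim (auto simp: zero_less_divide_iff)
  have sign2: "\<forall>\<^sub>F p in wp1 M. total_tilt_score (n (fst p)) (d p) ((1 + \<alpha>) / 2) (b p) < 0"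
    using pooled_sign(2)[OF pooled_all zero_less_one bl half(4-6)] unfolding tts
    by eventually_elim (auto simp: divide_less_0_iff)
  have ah_root: "\<forall>\<^sub>F p in wp1 M. 0 < ah p \<and> ah p < 1 \<and> total_tilt_score (n (fst p)) (d p) (ah p) (b p) = 0"
    using sign1 sign2
  proof eventually_elim
    case (elim p)
    obtain a where "\<alpha> / 2 \<le> a" "a \<le> (1 + \<alpha>) / 2" "total_tilt_score (n (fst p)) (d p) a (b p) = 0"
      by (rule total_tilt_score_root[of "\<alpha> / 2" "(1 + \<alpha>) / 2" "n (fst p)" "d p" "b p"]) (use half elim in auto)
    then have "0 < a \<and> a < 1 \<and> total_tilt_score (n (fst p)) (d p) a (b p) = 0" using half by auto
    then show ?case unfolding ah_def by (rule someI)
  qed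
  have root_alpha: "\<forall>\<^sub>F p in wp1 M. 0 < ah p \<and> ah p < 1 \<and> (\<Sum>j\<in>{1, 2, 3}. emp j (\<lambda>y. tilt_score (ah p) (linpred (b p) y)) p) = 0"
    using ah_root unfolding tts by eventually_elim simp
  have ah_lim: "(ah \<longlongrightarrow> \<alpha>) (wp1 M)"
    by (rule pooled_root_consistent[OF pooled_all zero_less_one alpha_range bl root_alpha])

  define g where "g p = logit (r p)" for p
  define h where "h p = logit (ah p)" for p
  have g_lim: "(g \<longlongrightarrow> logit \<rho>) (wp1 M)"
    unfolding g_def[abs_def] by (rule tendsto_logit[OF r_lim mixing_proportion])
  have h_lim: "(h \<longlongrightarrow> logit \<alpha>) (wp1 M)"
    unfolding h_def[abs_def] by (rule tendsto_logit[OF ah_lim alpha_range])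
  have z_lim: "((\<lambda>p. zeta_N (fst p)) \<longlongrightarrow> logit \<alpha>) (wp1 M)" by (rule tendsto_fst_wp1[OF zeta_N_lim])
  have share_lim: "((\<lambda>p. \<Sum>j\<in>J'. share (fst p) j) \<longlongrightarrow> (\<Sum>j\<in>J'. \<eta> j)) (wp1 M)" if "J' \<subseteq> {1, 2, 3}" for J'
    using that by (intro tendsto_sum tendsto_fst_wp1[of "\<lambda>k. share k j" for j] proportions) auto

  have eq1: "\<forall>\<^sub>F p in wp1 M. (\<Sum>j\<in>{3}. score j (b p + g p *\<^sub>R e0) e0 p) = (\<Sum>j\<in>{3}. share (fst p) j) * logistic (g p)"
    using root_rho by eventually_elim (simp add: g_def score_logit logistic_logit)
  have eq2: "\<forall>\<^sub>F p in wp1 M. (\<Sum>j\<in>{1, 2, 3}. score j (b p + h p *\<^sub>R e0) e0 p) = (\<Sum>j\<in>{1, 2, 3}. share (fst p) j) * logistic (h p)"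
    using root_alpha
  proof eventually_elim
    case (elim p)
    then have "(\<Sum>j\<in>{1, 2, 3}. score j (b p + h p *\<^sub>R e0) e0 p) = (\<Sum>j\<in>{1, 2, 3}. ah p * share (fst p) j + ah p * (1 - ah p) * emp j (\<lambda>y. tilt_score (ah p) (linpred (b p) y)) p)"
      unfolding h_def by (intro sum.cong refl score_logit) auto
    also have "\<dots> = (\<Sum>j\<in>{1, 2, 3}. share (fst p) j) * ah p + ah p * (1 - ah p) * (\<Sum>j\<in>{1, 2, 3}. emp j (\<lambda>y. tilt_score (ah p) (linpred (b p) y)) p)"
      unfolding sum.distrib sum_distrib_left sum_distrib_right by (simp add: mult.commute)
    finally show ?case using elim by (simp add: h_def logistic_logit)
  qed
  have eq3: "\<forall>\<^sub>F p in wp1 M. emp 2 (\<lambda>y. c \<bullet> design y) p + score 3 (b p + g p *\<^sub>R e0) c p - (\<Sum>j\<in>{1, 2, 3}. score j (b p + h p *\<^sub>R e0) c p) = 0"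
    using mle Npos ah_root sign1 root_rho
  proof eventually_elim
    case (elim p)
    \<comment> \<open>If all linear predictors vanished, the total score would be zero at every
      proportion, contrary to its sign at \<open>\<alpha> / 2\<close>.\<close>
    have nz: "\<exists>j0\<in>{1..3}. \<exists>i0<n (fst p) j0. linpred (b p) (d p j0 i0) \<noteq> 0"
    proof (rule ccontr)
      assume "\<not> ?thesis"
      then have "total_tilt_score (n (fst p)) (d p) (\<alpha> / 2) (b p) = 0"
        unfolding total_tilt_score_def by (intro sum.neutral ballI) (auto simp: tilt_score_def)
      with elim(4) show False by simp
    qed
    then obtain j0 i0 where "j0 \<in> {1..3}" "i0 < n (fst p) j0" "linpred (b p) (d p j0 i0) \<noteq> 0" by blast
    with elim have "beta_score (n (fst p)) (d p) (r p) (b p) (ah p) c = 0"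
      by (intro is_MLE_beta_score[of _ _ _ _ _ j0 i0]) auto
    moreover have "a * exp t / tilt_density a t = logistic (t + logit a)" if "0 < a" "a < 1" for a t
      using logistic_logit_add[OF that] by simp
    ultimately have "(\<Sum>i<n (fst p) 2. c \<bullet> design (d p 2 i)) + (\<Sum>i<n (fst p) 3. logistic (linpred (b p) (d p 3 i) + g p) * (c \<bullet> design (d p 3 i)))
       - (\<Sum>j\<in>{1, 2, 3}. \<Sum>i<n (fst p) j. logistic (linpred (b p) (d p j i) + h p) * (c \<bullet> design (d p j i))) = 0"
      using elim by (simp only: beta_score_def g_def h_def s123 linpred_eq_inner[of c])
    then have "((\<Sum>i<n (fst p) 2. c \<bullet> design (d p 2 i)) + (\<Sum>i<n (fst p) 3. logistic (linpred (b p) (d p 3 i) + g p) * (c \<bullet> design (d p 3 i)))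
       - (\<Sum>j\<in>{1, 2, 3}. \<Sum>i<n (fst p) j. logistic (linpred (b p) (d p j i) + h p) * (c \<bullet> design (d p j i)))) / real (total_size (n (fst p))) = 0"
      by simp
    then show ?case
      unfolding score_shift emp_def d_def diff_divide_distrib add_divide_distrib sum_divide_distrib .
  qed

  define G1 where "G1 p = rN p * (g p - logit \<rho>)" for p
  define G2 where "G2 p = rN p * (h p - zeta_N (fst p))" for p
  define S1 where "S1 p = rN p * ((\<Sum>j\<in>{3}. score j (\<beta> + logit \<rho> *\<^sub>R e0) e0 p) - (\<Sum>j\<in>{3}. share (fst p) j) * logistic (logit \<rho>))" for p
  define S2 where "S2 p = rN p * ((\<Sum>j\<in>{1, 2, 3}. score j (\<beta> + zeta_N (fst p) *\<^sub>R e0) e0 p) - (\<Sum>j\<in>{1, 2, 3}. share (fst p) j) * logistic (zeta_N (fst p)))" for p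
  define k1 where "k1 = \<eta> 3 * \<rho> * (1 - \<rho>) * (1 - I0 \<rho>)"
  define k2 where "k2 = \<alpha> * (1 - \<alpha>) * (1 - I0 \<alpha>)"
  have kpos: "k1 > 0" "k2 > 0"
    using eta_pos mixing_proportion alpha_range I0_less_1[OF mixing_proportion] I0_less_1[OF alpha_range]
    by (auto simp: k1_def k2_def)
  have Av3: "(\<Sum>j\<in>{3}. \<eta> j *\<^sub>R info j (\<beta> + logit \<rho> *\<^sub>R e0) e0) = Av e0" by (simp add: Av_def)
  have k1_eq: "(\<Sum>j\<in>{3}. \<eta> j) * logistic' (logit \<rho>) - Av e0 \<bullet> e0 = k1"
    by (simp add: k1_def Av_inner I2_e0 logistic'_def logistic_logit mixing_proportion algebra_simps)
  have k2_eq: "(\<Sum>j\<in>{1, 2, 3}. \<eta> j) * logistic' (logit \<alpha>) - Bv e0 \<bullet> e0 = k2"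
  proof -
    have "(\<Sum>j\<in>{1, 2, 3}. \<eta> j) = 1" using sum_eta by simp
    then show ?thesis by (simp only:) (simp add: k2_def Bv_inner I2_e0 logistic'_def logistic_logit alpha_range algebra_simps)
  qed
  have S1_tight: "bounded_in_prob M S1"
    unfolding S1_def[abs_def]
  proof (rule pooled_score_bounded_in_prob[where \<zeta> = "\<lambda>_. logit \<rho>", OF _ tendsto_const])
    show "\<forall>\<^sub>F k in sequentially. \<exists>K s. 0 < s \<and> s < 1 \<and> logit \<rho> = logit s \<and> pooled {3} (\<lambda>j. real (n k j)) K s"
      using mixing_proportion pooled_3[of "\<lambda>j. real (n k j)" for k] by (intro always_eventually allI exI conjI) auto
  qed simp
  have S2_tight: "bounded_in_prob M S2"
    unfolding S2_def[abs_def]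
  proof (rule pooled_score_bounded_in_prob[OF _ zeta_N_lim])
    show "\<forall>\<^sub>F k in sequentially. \<exists>K s. 0 < s \<and> s < 1 \<and> zeta_N k = logit s \<and> pooled {1, 2, 3} (\<lambda>j. real (n k j)) K s"
      using alpha_N_range N_pos by eventually_elim (use pooled_all_N zeta_N_def in blast)
  qed simp
  note x1 = pooled_root_expansion[OF _ share_lim tb g_lim tendsto_const eq1 S1_tight[unfolded S1_def[abs_def]], unfolded Av3 k1_eq]
  have G1_tight: "bounded_in_prob M G1" unfolding G1_def[abs_def] by (rule x1(1)) (use kpos in auto)
  have X1: "((\<lambda>p. S1 p + rN p * (Av e0 \<bullet> (b p - \<beta>)) - k1 * G1 p) \<longlongrightarrow> 0) (wp1 M)"
    unfolding S1_def G1_def by (rule x1(2)) (use kpos in auto)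
  note x2 = pooled_root_expansion[OF _ share_lim tb h_lim z_lim eq2 S2_tight[unfolded S2_def[abs_def]], folded Bv_def, unfolded k2_eq]
  have G2_tight: "bounded_in_prob M G2" unfolding G2_def[abs_def] by (rule x2(1)) (use kpos in auto)
  have X2: "((\<lambda>p. S2 p + rN p * (Bv e0 \<bullet> (b p - \<beta>)) - k2 * G2 p) \<longlongrightarrow> 0) (wp1 M)"
    unfolding S2_def G2_def by (rule x2(2)) (use kpos in auto)

  have lu: "((\<lambda>p. b p + g p *\<^sub>R e0) \<longlongrightarrow> \<beta> + logit \<rho> *\<^sub>R e0) (wp1 M)" by (intro tendsto_intros bl g_lim)
  have lv: "((\<lambda>p. b p + h p *\<^sub>R e0) \<longlongrightarrow> \<beta> + logit \<alpha> *\<^sub>R e0) (wp1 M)" by (intro tendsto_intros bl h_lim)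
  have lv0: "((\<lambda>p. \<beta> + zeta_N (fst p) *\<^sub>R e0) \<longlongrightarrow> \<beta> + logit \<alpha> *\<^sub>R e0) (wp1 M)" by (intro tendsto_intros z_lim)
  define T3 where "T3 p = (\<Sum>j\<in>{3}. score j (b p + g p *\<^sub>R e0) c p) - (\<Sum>j\<in>{3}. score j (\<beta> + logit \<rho> *\<^sub>R e0) c p) 
      - Av c \<bullet> ((b p + g p *\<^sub>R e0) - (\<beta> + logit \<rho> *\<^sub>R e0))" for p
  define T4 where "T4 p = (\<Sum>j\<in>{1, 2, 3}. score j (b p + h p *\<^sub>R e0) c p) - (\<Sum>j\<in>{1, 2, 3}. score j (\<beta> + zeta_N (fst p) *\<^sub>R e0) c p) 
      - Bv c \<bullet> ((b p + h p *\<^sub>R e0) - (\<beta> + zeta_N (fst p) *\<^sub>R e0))" for p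
  have Avc: "(\<Sum>j\<in>{3}. \<eta> j *\<^sub>R info j (\<beta> + logit \<rho> *\<^sub>R e0) c) = Av c" by (simp add: Av_def)
  have T3_lim: "((\<lambda>p. rN p * T3 p) \<longlongrightarrow> 0) (wp1 M)"
  proof -
    obtain Y where Y: "(Y \<longlongrightarrow> 0) (wp1 M)" "\<And>p. \<bar>T3 p\<bar> \<le> Y p * norm ((b p + g p *\<^sub>R e0) - (\<beta> + logit \<rho> *\<^sub>R e0))"
      using score_expansion_sum[OF _ lu tendsto_const, of "{3}" c] unfolding T3_def Avc by blast
    show ?thesis by (rule scaled_remainder[OF Y bounded_in_prob_shifted[OF tb G1_tight[unfolded G1_def[abs_def]]]])
  qed
  have T4_lim: "((\<lambda>p. rN p * T4 p) \<longlongrightarrow> 0) (wp1 M)"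
  proof -
    obtain Y where Y: "(Y \<longlongrightarrow> 0) (wp1 M)" "\<And>p. \<bar>T4 p\<bar> \<le> Y p * norm ((b p + h p *\<^sub>R e0) - (\<beta> + zeta_N (fst p) *\<^sub>R e0))"
      using score_expansion_sum[OF _ lv lv0, of "{1, 2, 3}" c] unfolding T4_def Bv_def by blast
    show ?thesis by (rule scaled_remainder[OF Y bounded_in_prob_shifted[OF tb G2_tight[unfolded G2_def[abs_def]]]])
  qed

  \<comment> \<open>Chosen so that \<open>A * k1\<close> and \<open>B * k2\<close> match the
    coefficients of \<open>G1\<close> and \<open>G2\<close> in \<open>T3\<close> and
    \<open>T4\<close>; this is where the defining equation of \<open>proj\<close> is used.\<close>
  define A B where "A = proj \<rho> c" and "B = proj \<alpha> c"
  have Ak: "A * k1 = Av c \<bullet> e0"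
    using proj_eq[OF mixing_proportion, of c] by (simp add: A_def k1_def Av_inner I2_e0 mult_ac)
  have Bk: "B * k2 = Bv c \<bullet> e0"
    using proj_eq[OF alpha_range, of c] by (simp add: B_def k2_def Bv_inner I2_e0 mult_ac)
  have "((\<lambda>p. - (rN p * T3 p) + rN p * T4 p + A * (S1 p + rN p * (Av e0 \<bullet> (b p - \<beta>)) - k1 * G1 p)
      - B * (S2 p + rN p * (Bv e0 \<bullet> (b p - \<beta>)) - k2 * G2 p)) \<longlongrightarrow> - 0 + 0 + A * 0 - B * 0) (wp1 M)"
    by (intro tendsto_intros T3_lim T4_lim X1 X2)
  then have lim: "((\<lambda>p. - (rN p * T3 p) + rN p * T4 p + A * (S1 p + rN p * (Av e0 \<bullet> (b p - \<beta>)) - k1 * G1 p)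
      - B * (S2 p + rN p * (Bv e0 \<bullet> (b p - \<beta>)) - k2 * G2 p)) \<longlongrightarrow> 0) (wp1 M)" by simp
  have "\<forall>\<^sub>F p in wp1 M. - (rN p * T3 p) + rN p * T4 p + A * (S1 p + rN p * (Av e0 \<bullet> (b p - \<beta>)) - k1 * G1 p)
      - B * (S2 p + rN p * (Bv e0 \<bullet> (b p - \<beta>)) - k2 * G2 p) = nsum (eff (zeta_N (fst p)) c) p - rN p * (Jv c \<bullet> (b p - \<beta>))"
    using eq3
  proof eventually_elim
    case (elim p)
    define \<delta> where "\<delta> = b p - \<beta>"
    define e2 where "e2 = emp 2 (\<lambda>y. c \<bullet> design y) p"
    define su where "su = score 3 (\<beta> + logit \<rho> *\<^sub>R e0) c p"
    define sv where "sv = (\<Sum>j\<in>{1, 2, 3}. score j (\<beta> + zeta_N (fst p) *\<^sub>R e0) c p)"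
    define su' where "su' = score 3 (b p + g p *\<^sub>R e0) c p"
    define sv' where "sv' = (\<Sum>j\<in>{1, 2, 3}. score j (b p + h p *\<^sub>R e0) c p)"
    have dg: "(b p + g p *\<^sub>R e0) - (\<beta> + logit \<rho> *\<^sub>R e0) = \<delta> + (g p - logit \<rho>) *\<^sub>R e0"
      "(b p + h p *\<^sub>R e0) - (\<beta> + zeta_N (fst p) *\<^sub>R e0) = \<delta> + (h p - zeta_N (fst p)) *\<^sub>R e0"
      by (simp_all add: \<delta>_def scaleR_diff_left)
    have T3: "rN p * T3 p = rN p * (su' - su) - rN p * (Av c \<bullet> \<delta>) - (Av c \<bullet> e0) * G1 p"
      unfolding T3_def dg by (simp add: su_def su'_def G1_def inner_add_right algebra_simps)
    have T4: "rN p * T4 p = rN p * (sv' - sv) - rN p * (Bv c \<bullet> \<delta>) - (Bv c \<bullet> e0) * G2 p"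
      unfolding T4_def dg sv_def[symmetric] sv'_def[symmetric] by (simp add: G2_def inner_add_right algebra_simps)
    have ns: "nsum (eff (zeta_N (fst p)) c) p = rN p * (e2 + su - sv) + A * S1 p - B * S2 p"
      unfolding nsum_eff e2_def su_def sv_def S1_def S2_def A_def B_def ..
    have e: "sv' = e2 + su'" using elim unfolding e2_def su'_def sv'_def by linarith
    have J: "Jv c \<bullet> \<delta> = Bv c \<bullet> \<delta> - Av c \<bullet> \<delta> - A * (Av e0 \<bullet> \<delta>) + B * (Bv e0 \<bullet> \<delta>)"
      by (simp add: Jv_def inner_diff_left inner_add_left A_def B_def)
    show ?case unfolding ns T3 T4 \<delta>_def[symmetric] J Ak[symmetric] Bk[symmetric] e by (simp add: algebra_simps)
  qed
  then show ?thesis using lim unfolding b_def split_def by (auto elim: Lim_transform_eventually)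
qed

text \<open>Evaluates the variance only in directions \<open>Jv c\<close>, for which the score of
  \<open>c\<close> linearizes the estimator; surjectivity of \<open>Jv\<close> later reaches all
  directions.\<close>

lemma eff_variance:
  assumes "asymptotic_variance M (\<lambda>k. total_size (n k)) beta_hat \<beta> V" "\<And>k. beta_hat k \<in> borel_measurable M"
    and "with_prob_tending_to_1 M (\<lambda>k \<omega>. is_MLE (n k) (\<lambda>j i. x j i \<omega>) (rho_hat k \<omega>, beta_hat k \<omega>))"
  shows "Jv c \<bullet> (V *v Jv c) = Jv c \<bullet> c"
proof (rule asymptotic_variance_eq[OF assms(1,2) _ MLE_linearization[OF assms(3) asymptotic_variance_bounded_in_prob[OF assms(1,2)]]])
  show "(\<lambda>\<omega>. nsum (eff (zeta_N k) c) (k, \<omega>)) \<in> borel_measurable M" for k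
    by (rule nsum_measurable) simp
  define K where "K = norm c + 2 * \<bar>proj \<alpha> c\<bar>"
  have "(\<lambda>k. expectation (\<lambda>\<omega>. cos (nsum (eff (zeta_N k) c) (k, \<omega>)))) \<longlonglongrightarrow> exp (- (\<Sum>j\<in>{1, 2, 3}. \<eta> j * var j (eff (logit \<alpha>) c j)) / 2)"
  proof (rule nsum_triangular(2)[where r = "\<lambda>k. \<bar>zeta_N k - logit \<alpha>\<bar>" and h = "\<lambda>y. K * norm (design y)"])
    show "(\<lambda>k. \<bar>zeta_N k - logit \<alpha>\<bar>) \<longlonglongrightarrow> 0" using zeta_N_lim by (simp add: LIM_zero tendsto_rabs_zero)
    show "integrable (P j) (\<lambda>y. (K * norm (design y))\<^sup>2)" if "j \<in> {1, 2, 3}" for j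
      by (rule square_integrable_of_bound[OF that, of _ K]) (auto simp: K_def abs_mult)
    show "\<forall>\<^sub>F k in sequentially. (\<Sum>j\<in>{1, 2, 3}. real (n k j) * (\<integral>y. eff (zeta_N k) c j y \<partial>P j)) = 0"
      using alpha_N_range N_pos
    proof eventually_elim
      case (elim k)
      have "real (n k 2) + real (n k 3) * \<rho> = alpha_N k * (real (n k 1) + real (n k 2) + real (n k 3))"
      proof -
        have "real (total_size (n k)) * alpha_N k = real (n k 2) + real (n k 3) * \<rho>"
          using elim by (simp add: alpha_N_def field_simps)
        then show ?thesis by (simp add: total_size_eq mult.commute)
      qed
      from eff_mean_total[OF _ _ this, of c] elim show ?case by (simp add: zeta_N_def)
    qed
  qed (use eff_lipschitz eff_square_integrable in \<open>auto simp: K_def\<close>)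
  then show "(\<lambda>k. expectation (\<lambda>\<omega>. cos (nsum (eff (zeta_N k) c) (k, \<omega>)))) \<longlonglongrightarrow> exp (- (Jv c \<bullet> c) / 2)"
    unfolding sum_var_eff .
qed

lemma labeled_variance:
  assumes "asymptotic_variance M (\<lambda>k. total_size (n k)) b_lab \<beta> V" "\<And>k. b_lab k \<in> borel_measurable M"
    and "with_prob_tending_to_1 M (\<lambda>k \<omega>. is_labeled_estimator (n k) (\<lambda>j i. x j i \<omega>) (b_lab k \<omega>))"
  shows "Lv c \<bullet> (V *v Lv c) = lab_var c"
proof (rule asymptotic_variance_eq[OF assms(1,2) _ labeled_linearization[OF assms(3) asymptotic_variance_bounded_in_prob[OF assms(1,2)]]])
  show "(\<lambda>\<omega>. nsum (lab (shift_N k) c) (k, \<omega>)) \<in> borel_measurable M" for k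
    by (rule nsum_measurable) simp
  show "(\<lambda>k. expectation (\<lambda>\<omega>. cos (nsum (lab (shift_N k) c) (k, \<omega>)))) \<longlonglongrightarrow> exp (- lab_var c / 2)"
    unfolding lab_var_def
  proof (rule nsum_triangular(2)[where r = "\<lambda>k. \<bar>shift_N k - logit a_lab\<bar>" and h = "\<lambda>y. norm c * norm (design y)"])
    show "(\<lambda>k. \<bar>shift_N k - logit a_lab\<bar>) \<longlonglongrightarrow> 0" using shift_N_lim by (simp add: LIM_zero tendsto_rabs_zero)
    show "integrable (P j) (\<lambda>y. (norm c * norm (design y))\<^sup>2)" if "j \<in> {1, 2, 3}" for j
      by (rule square_integrable_of_bound[OF that, of _ "norm c"]) (auto simp: abs_mult)
    have "\<forall>\<^sub>F k in sequentially. n k 1 > 0" "\<forall>\<^sub>F k in sequentially. n k 2 > 0" by (rule n_pos, simp)+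
    then show "\<forall>\<^sub>F k in sequentially. (\<Sum>j\<in>{1, 2, 3}. real (n k j) * (\<integral>y. lab (shift_N k) c j y \<partial>P j)) = 0"
    proof eventually_elim
      case (elim k)
      then show ?case using lab_mean_total[of "real (n k 1)" "real (n k 2)" c "real (n k 3)"] by (simp add: shift_N_def)
    qed
  qed (use lab_lipschitz lab_square_integrable in auto)
qed

section \<open>Invertibility of the information operators and the final comparison\<close>

lemma I2_linear:
  assumes "0 < s" "s < 1"
  shows "I2 s (c + c') d = I2 s c d + I2 s c' d" "I2 s (t *\<^sub>R c) d = t * I2 s c d"
proof -
  show "I2 s (c + c') d = I2 s c d + I2 s c' d"
    unfolding I2_def using ratio_integrable(3)[OF assms]
    by (simp add: inner_add_left distrib_left distrib_right)
  have "I2 s (t *\<^sub>R c) d = (\<integral>y. t * (ratio s y * ((c \<bullet> design y) * (d \<bullet> design y))) \<partial>G0)"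
    unfolding I2_def by (rule Bochner_Integration.integral_cong) (auto simp: mult_ac)
  then show "I2 s (t *\<^sub>R c) d = t * I2 s c d" by (simp add: I2_def)
qed

lemma proj_linear:
  assumes "0 < s" "s < 1"
  shows "proj s (c + c') = proj s c + proj s c'" "proj s (t *\<^sub>R c) = t * proj s c"
  unfolding proj_def I2_e0(1)[symmetric] I2_linear[OF assms] by (simp_all add: add_divide_distrib)

lemma linear_Lv: "linear Lv"
proof (rule linearI)
  show "Lv (c + c') = Lv c + Lv c'" for c c'
    by (rule vector_eq_rdot[THEN iffD1], rule allI) (simp add: Lv_inner inner_add_left I2_linear[OF a_lab_range] algebra_simps)
  show "Lv (t *\<^sub>R c) = t *\<^sub>R Lv c" for t c
    by (rule vector_eq_rdot[THEN iffD1], rule allI) (simp add: Lv_inner I2_linear[OF a_lab_range])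
qed

lemma linear_Jv: "linear Jv"
proof (rule linearI)
  note l = I2_linear[OF alpha_range] I2_linear[OF mixing_proportion] proj_linear[OF alpha_range] proj_linear[OF mixing_proportion]
  show "Jv (c + c') = Jv c + Jv c'" for c c'
    by (rule vector_eq_rdot[THEN iffD1], rule allI) (simp add: Jv_inner inner_add_left l algebra_simps)
  show "Jv (t *\<^sub>R c) = t *\<^sub>R Jv c" for t c
    by (rule vector_eq_rdot[THEN iffD1], rule allI) (simp add: Jv_inner l algebra_simps)
qed

text \<open>Otherwise the variance inequality would fail for large multiples of \<open>c\<close>, because \<open>L c \<bullet> c > 0\<close>.\<close>

lemma Jv_pos:
  assumes "c \<noteq> 0"
  shows "0 < Jv c \<bullet> c"
proof (rule ccontr)
  assume neg: "\<not> 0 < Jv c \<bullet> c"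
  define l where "l = Lv c \<bullet> c"
  have l: "l > 0" using Lv_pos[OF assms] by (simp add: l_def)
  \<comment> \<open>Makes the linear term exceed \<open>lab_var c\<close> by one, while the
    quadratic term cannot be positive.\<close>
  define t where "t = (lab_var c + 1) / (2 * l)"
  have "0 \<le> lab_var c - 2 * (Lv c \<bullet> (t *\<^sub>R c)) + Jv (t *\<^sub>R c) \<bullet> (t *\<^sub>R c)" by (rule variance_inequality)
  also have "\<dots> = lab_var c - 2 * t * l + t\<^sup>2 * (Jv c \<bullet> c)"
    by (simp add: linear_cmul[OF linear_Jv] l_def power2_eq_square)
  also have "2 * t * l = lab_var c + 1" using l by (simp add: t_def)
  finally have "1 \<le> t\<^sup>2 * (Jv c \<bullet> c)" by simp
  moreover have "t\<^sup>2 * (Jv c \<bullet> c) \<le> 0" using neg by (simp add: mult_nonneg_nonpos)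
  ultimately show False by simp
qed

lemma surj_of_pos:
  fixes f :: "real ^ 'p option \<Rightarrow> real ^ 'p option"
  assumes "linear f" "\<And>c. c \<noteq> 0 \<Longrightarrow> 0 < f c \<bullet> c"
  shows "surj f"
proof (rule linear_inj_imp_surj[OF assms(1)])
  have "c = 0" if "f c = 0" for c using assms(2)[of c] that by fastforce
  then show "inj f" unfolding linear_injective_0[OF assms(1)] by blast
qed

end

theorem proposition3:
  fixes M :: "'w measure" and x :: "nat \<Rightarrow> nat \<Rightarrow> 'w \<Rightarrow> real ^ 'p::finite"
    and G0 :: "(real ^ 'p) measure"
    and rho_true :: real and beta_true :: "real ^ 'p option"
    and n :: "nat \<Rightarrow> nat \<Rightarrow> nat" and \<eta> :: "nat \<Rightarrow> real"
    and rho_hat :: "nat \<Rightarrow> 'w \<Rightarrow> real" and beta_hat :: "nat \<Rightarrow> 'w \<Rightarrow> real ^ 'p option"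
    and beta_lab :: "nat \<Rightarrow> 'w \<Rightarrow> real ^ 'p option"
    and V V_lab :: "real ^ 'p option ^ 'p option"
  assumes model: "ETM M x G0 rho_true beta_true"
    and sizes: "filterlim (\<lambda>k. total_size (n k)) at_top sequentially"
      "\<And>j. j \<in> {1, 2, 3} \<Longrightarrow> (\<lambda>k. real (n k j) / real (total_size (n k))) \<longlonglongrightarrow> \<eta> j"
      "\<And>j. j \<in> {1, 2, 3} \<Longrightarrow> 0 < \<eta> j \<and> \<eta> j < 1"
    and identifiable: "slope beta_true \<noteq> 0"
    and nondegenerate: "\<And>b. b \<noteq> 0 \<Longrightarrow> \<not> (AE y in G0. linpred b y = 0)"
    and moments: "integrable G0 (\<lambda>y. (norm y)\<^sup>2)"
      "integrable (tilt G0 beta_true) (\<lambda>y. (norm y)\<^sup>2)"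
    and measurable: "\<And>k. rho_hat k \<in> borel_measurable M"
      "\<And>k. beta_hat k \<in> borel_measurable M" "\<And>k. beta_lab k \<in> borel_measurable M"
    and MLE: "with_prob_tending_to_1 M
      (\<lambda>k \<omega>. is_MLE (n k) (\<lambda>j i. x j i \<omega>) (rho_hat k \<omega>, beta_hat k \<omega>))"
    and labeled: "with_prob_tending_to_1 M
      (\<lambda>k \<omega>. is_labeled_estimator (n k) (\<lambda>j i. x j i \<omega>) (beta_lab k \<omega>))"
    and normality: "asymptotic_variance M (\<lambda>k. total_size (n k)) beta_hat beta_true V"
      "asymptotic_variance M (\<lambda>k. total_size (n k)) beta_lab beta_true V_lab"
  shows "loewner_le V V_lab"
proof -
  interpret ETM_asymptotics M x G0 rho_true beta_true n \<eta>
    by (rule ETM_asymptotics.intro[OF model], unfold_locales) (fact sizes identifiable nondegenerate moments)+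
  have sym: "transpose V = V" "transpose V_lab = V_lab"
    using normality by (auto simp: asymptotic_variance_def mvnormal_def psd_def)
  have "0 \<le> c \<bullet> ((V_lab - V) *v c)" for c
  proof -
    obtain u where u: "Lv u = c" using surj_of_pos[OF linear_Lv Lv_pos] by (metis surjD)
    obtain v where v: "Jv v = c" using surj_of_pos[OF linear_Jv Jv_pos] by (metis surjD)
    have 1: "c \<bullet> (V *v c) = c \<bullet> v" using eff_variance[OF normality(1) measurable(2) MLE, of v] v by simp
    have 2: "c \<bullet> (V_lab *v c) = lab_var u" using labeled_variance[OF normality(2) measurable(3) labeled, of u] u by simp
    have "0 \<le> lab_var u - 2 * (c \<bullet> v) + c \<bullet> v" using variance_inequality[of u v] u v by simp
    then show ?thesis by (simp add: matrix_vector_mult_diff_rdistrib inner_diff_right 1 2)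
  qed
  moreover have "transpose (V_lab - V) = V_lab - V"
    using sym by (simp add: transpose_def vec_eq_iff)
  ultimately show ?thesis by (simp add: loewner_le_def psd_def)
qed

end
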